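(* Let $(\mathbf{m},\mathbf{d})$ be an MD pair. Then the map $\mathcal{B}\mapsto\tilde\sigma_{\mathcal{B}}$ is a poset isomorphism from $\mathcal{SBP}(\mathbf{m})$ to the normal fan $\Sigma(\mathrm{PF}(\mathbf{m},\mathbf{d}))$ (ordered by inclusion). Therefore, the face poset of $\mathrm{PF}(\mathbf{m},\mathbf{d})$ is isomorphic to the dual of $\mathcal{SBP}(\mathbf{m})$.
   Context: Parking function polytope. For nonzero $\mathbf{u}=(u_1,\dots,u_n)$ with $0\le u_1\le\cdots\le u_n$, a vector $\mathbf{a}\in\mathbb{R}^n_{\ge0}$ with nondecreasing rearrangement $b_1\le\cdots\le b_n$ is a $\mathbf{u}$-parking function if $b_i\le u_i$ for all $i$; $\mathrm{PF}(\mathbf{u})$ is the convex hull of all $\mathbf{u}$-parking functions. MD pair. Let $d_1<\cdots<d_\ell$ ($\ell\ge1$) be the distinct positive numbers appearing in $\mathbf{u}$, $m_0$ the number of zeros in $\mathbf{u}$, and $m_i$ the number of entries equal to $d_i$. Then $\mathbf{m}=(m_0,m_1,\dots,m_\ell)$ is the multiplicity vector of $\mathbf{u}$ (of magnitude $n=m_0+\cdots+m_\ell$), $\mathbf{d}=(d_1,\dots,d_\ell)$ its data vector, and $(\mathbf{m},\mathbf{d})$ its MD pair; $\mathbf{u}$ is recovered from $(\mathbf{m},\mathbf{d})$, and $\mathrm{PF}(\mathbf{m},\mathbf{d}):=\mathrm{PF}(\mathbf{u})$. Skewed binary partitions. A skewed binary partition of $[0,n]=\{0,\dots,n\}$ is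 an ordered tuple $\mathcal{B}=(B_{-1},B_0,B_1,\dots,B_k)$, $k\ge0$, of disjoint subsets with union $[0,n]$, each labelled homogeneous or non-homogeneous, such that: $B_{-1}$ is non-homogeneous, and $B_0$ is homogeneous if $|B_0|\ge2$; $0\in B_{-1}\cup B_0$, and if $0\in B_{-1}$ then $|B_{-1}|\ge2$ and $B_0=\emptyset$; for $0\le i\le k$, if $B_i$ is a singleton it is non-homogeneous; $B_i\ne\emptyset$ for $1\le i\le k$. (The label of an empty block is irrelevant.) Preorder and cone. $\preceq_{\mathcal{B}}$ is the preorder on $[0,n]$ with $p\preceq_{\mathcal{B}}q$ iff $p=q$, or $p\in B_i,q\in B_j$ with $i<j$, or $p,q$ lie in a common homogeneous block. The sliced preorder cone is $\tilde\sigma_{\mathcal{B}}=\{(c_1,\dots,c_n)\in\mathbb{R}^n : c_0=0\text{ and }c_i\le c_j\text{ whenever } i\preceq_{\mathcal{B}}j,\ i,j\in[0,n]\}$. Contraction. A preorder $\preceq$ has equivalence classes under $i\equiv j\iff i\preceq j\preceq i$ and induces a partial order on them; its Hasse diagram is that of this poset of classes. A preorder $\preceq_1$ is a contraction of $\preceq_2$ if its Hasse diagram is obtained from that of $\preceq_2$ by a (possibly empty) sequence of edge contractions, where contracting an edge $\bar g\lessdot\bar h$ merges the classes $\bar g,\bar h$, the new preorder being the transitive closure of the old one together with $\bar h\preceq\bar g$. A skewed binary partition $\mathcal{C}$ is a contraction of $\mathcal{B}$ if $\preceq_{\mathcal{C}}$ is a contraction of $\preceq_{\mathcal{B}}$.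 Type. $\mathrm{type}(\mathcal{B})=(b_{-1},b_0,\dots,b_k)$, where entries are nonnegative integers, possibly decorated by $\circ$ or $\star$: for $1\le i\le k$, $b_i=|B_i|$ if $B_i$ is non-homogeneous and $b_i=|B_i|^\star$ if homogeneous; if $0\in B_0$ then $b_0=(|B_0|-1)^\circ$ and $b_{-1}=|B_{-1}|$; if $0\in B_{-1}$ then $b_0=0$ (undecorated, distinct from $0^\circ$) and $b_{-1}=|B_{-1}|-1$. $\Omega_{\mathbf{m}}$. Let $r=m_1+\cdots+m_\ell$. $\Omega_{\mathbf{m}}=\{\mathbf{a}_0,\dots,\mathbf{a}_r\}$, where $\mathbf{a}_0=(m_0,0,m_1,\dots,m_\ell)$ if $m_0>0$, $\mathbf{a}_0=(0,0^\circ,m_1,\dots,m_\ell)$ if $m_0=0$; for $1\le i<r$, $\mathbf{a}_i=(m_0+i,0^\circ,m_1+\cdots+m_g-i,m_{g+1},\dots,m_\ell)$, where $g$ is the unique positive integer with $m_1+\cdots+m_{g-1}\le i<m_1+\cdots+m_g$; and $\mathbf{a}_r=(n,0^\circ)$. $\mathcal{SBP}(\mathbf{m})$ is the poset of all skewed binary partitions $\mathcal{B}$ of $[0,n]$ that are contractions of some skewed binary partition $\mathcal{A}$ with $\mathrm{type}(\mathcal{A})\in\Omega_{\mathbf{m}}$, ordered by $\mathcal{B}\le\mathcal{B}'$ iff $\mathcal{B}$ is a contraction of $\mathcal{B}'$. The normal fan $\Sigma(P)$ is the set of normal cones $\{\mathbf{w} : \mathbf{w}\cdot\mathbf{x}\ge\mathbf{w}\cdot\mathbf{y}\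 \forall\mathbf{x}\in F,\mathbf{y}\in P\}$ over all nonempty faces $F$ of $P$, ordered by inclusion. The face poset of $P$ is the set of nonempty faces of $P$ ordered by inclusion. *)

theory Defs
  imports "HOL-Analysis.Analysis"
begin

text \<open>
  Vectors of \<open>\<real>\<^sup>n\<close> are elements of \<open>real ^ 'n\<close> together with an enumeration
  \<open>e\<close> of the index type by \<open>{1..n}\<close> (that is, \<open>bij_betw e {1..n} UNIV\<close>): the
  \<open>i\<close>-th coordinate of \<open>x\<close> is \<open>x $ e i\<close>.
\<close>

section \<open>Parking function polytopes and MD pairs\<close>

definition is_park_vec :: "real list \<Rightarrow> bool" where
  "is_park_vec u \<longleftrightarrow> sorted u \<and> (\<forall>x\<in>set u. 0 \<le> x) \<and> (\<exists>x\<in>set u. x \<noteq> 0)"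

definition parking_function ::
    "(nat \<Rightarrow> 'n::finite) \<Rightarrow> real list \<Rightarrow> real ^ 'n \<Rightarrow> bool" where
  "parking_function e u a \<longleftrightarrow>
     (\<forall>i\<in>{1..length u}. 0 \<le> a $ e i) \<and>
     (let b = sort (map (\<lambda>i. a $ e i) [1..<Suc (length u)])
      in \<forall>i<length u. b ! i \<le> u ! i)"

definition PF :: "(nat \<Rightarrow> 'n::finite) \<Rightarrow> real list \<Rightarrow> (real ^ 'n) set" where
  "PF e u = convex hull {a. parking_function e u a}"

definition data_vector :: "real list \<Rightarrow> real list" where
  "data_vector u = sorted_list_of_set {x \<in> set u. 0 < x}"

definition multiplicity_vector :: "real list \<Rightarrow> nat list" where
  "multiplicity_vector u = map (count_list u) (0 # data_vector u)"

definition is_MD_pair :: "nat list \<Rightarrow> real list \<Rightarrow> bool" where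
  "is_MD_pair m d \<longleftrightarrow>
     (\<exists>u. is_park_vec u \<and> m = multiplicity_vector u \<and> d = data_vector u)"

definition vec_of_MD :: "nat list \<Rightarrow> real list \<Rightarrow> real list" where
  "vec_of_MD m d = concat (map2 replicate m (0 # d))"

definition PF_MD :: "(nat \<Rightarrow> 'n::finite) \<Rightarrow> nat list \<Rightarrow> real list \<Rightarrow> (real ^ 'n) set" where
  "PF_MD e m d = PF e (vec_of_MD m d)"

lemma vec_of_MD_recovers:
  assumes "is_park_vec u"
  shows "vec_of_MD (multiplicity_vector u) (data_vector u) = u"
proof -
  let ?v = "\<lambda>xs. concat (map (\<lambda>x. replicate (count_list u x) x) xs)"
  have rw: "vec_of_MD (multiplicity_vector u) (data_vector u) = ?v (0 # data_vector u)"
  proof -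
    have "map2 replicate (map f xs) xs = map (\<lambda>x. replicate (f x) x) xs"
      for f :: "real \<Rightarrow> nat" and xs
      by (induction xs) auto
    then show ?thesis
      unfolding vec_of_MD_def multiplicity_vector_def by metis
  qed
  have sorted_v: "sorted (?v xs)" if "sorted xs" for xs
    using that by (induction xs) (auto simp: sorted_append)
  have count_v: "count (mset (?v xs)) x = (if x \<in> set xs then count_list u x else 0)"
    if "distinct xs" for xs x
    using that by (induction xs) auto
  have set: "set (0 # data_vector u) = insert 0 {x \<in> set u. 0 < x}"
    by (simp add: data_vector_def)
  have s: "sorted (0 # data_vector u)" and di: "distinct (0 # data_vector u)"
    by (auto simp: data_vector_def)
  have "set u \<subseteq> set (0 # data_vector u)"
    unfolding set using assms by (force simp: is_park_vec_def)
  then have "mset (?v (0 # data_vector u)) = mset u"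
    by (intro multiset_eqI)
       (simp only: count_v[OF di], use count_notin in \<open>force simp: count_mset\<close>)
  then have "?v (0 # data_vector u) = u"
    using sorted_v[OF s] assms
    by (metis is_park_vec_def properties_for_sort sorted_sort_id)
  then show ?thesis using rw by simp
qed

section \<open>Skewed binary partitions\<close>

text \<open>
  A tuple \<open>(B\<^sub>-\<^sub>1, B\<^sub>0, \<dots>, B\<^sub>k)\<close> of labelled blocks is a list of length \<open>k + 2\<close>, so that
  \<open>B\<^sub>i\<close> sits at list position \<open>i + 1\<close>; the label \<open>True\<close> means homogeneous.
\<close>

type_synonym sbp = "(nat set \<times> bool) list"

definition blk :: "sbp \<Rightarrow> nat \<Rightarrow> nat set" where
  "blk B j = fst (B ! j)"

definition homog :: "sbp \<Rightarrow> nat \<Rightarrow> bool" where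
  "homog B j = snd (B ! j)"

text \<open>
  The label of an empty block carries no information. Only \<open>B\<^sub>-\<^sub>1\<close> and \<open>B\<^sub>0\<close> can be empty and
  \<open>B\<^sub>-\<^sub>1\<close> has a fixed label; the last conjunct fixes the label of an empty \<open>B\<^sub>0\<close>, so that equality
  of lists is equality of skewed binary partitions.
\<close>

definition is_sbp :: "nat \<Rightarrow> sbp \<Rightarrow> bool" where
  "is_sbp n B \<longleftrightarrow>
     2 \<le> length B \<and>
     (\<forall>i<length B. \<forall>j<length B. i \<noteq> j \<longrightarrow> blk B i \<inter> blk B j = {}) \<and>
     (\<Union>i<length B. blk B i) = {0..n} \<and>
     \<not> homog B 0 \<and>
     (2 \<le> card (blk B 1) \<longrightarrow> homog B 1) \<and>
     0 \<in> blk B 0 \<union> blk B 1 \<and>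
     (0 \<in> blk B 0 \<longrightarrow> 2 \<le> card (blk B 0) \<and> blk B 1 = {}) \<and>
     (\<forall>j. 1 \<le> j \<and> j < length B \<and> card (blk B j) = 1 \<longrightarrow> \<not> homog B j) \<and>
     (\<forall>j. 2 \<le> j \<and> j < length B \<longrightarrow> blk B j \<noteq> {}) \<and>
     (blk B 1 = {} \<longrightarrow> \<not> homog B 1)"

definition sbp_preorder :: "nat \<Rightarrow> sbp \<Rightarrow> nat rel" where
  "sbp_preorder n B = {(p, q). p \<in> {0..n} \<and> q \<in> {0..n} \<and>
     (p = q \<or>
      (\<exists>i j. i < j \<and> j < length B \<and> p \<in> blk B i \<and> q \<in> blk B j) \<or>
      (\<exists>i<length B. homog B i \<and> p \<in> blk B i \<and> q \<in> blk B i))}"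

definition coord :: "(nat \<Rightarrow> 'n::finite) \<Rightarrow> real ^ 'n \<Rightarrow> nat \<Rightarrow> real" where
  "coord e c i = (if i = 0 then 0 else c $ e i)"

definition sliced_cone :: "(nat \<Rightarrow> 'n::finite) \<Rightarrow> nat \<Rightarrow> sbp \<Rightarrow> (real ^ 'n) set" where
  "sliced_cone e n B = {c. \<forall>(i, j)\<in>sbp_preorder n B. coord e c i \<le> coord e c j}"

section \<open>Contractions\<close>

text \<open>A preorder is given as a relation that is reflexive and transitive on its field.\<close>

definition preorder_classes :: "'a rel \<Rightarrow> 'a set set" where
  "preorder_classes R = Field R // (R \<inter> R\<inverse>)"

definition class_le :: "'a rel \<Rightarrow> 'a set \<Rightarrow> 'a set \<Rightarrow> bool" where
  "class_le R G H \<longleftrightarrow> (\<exists>g\<in>G. \<exists>h\<in>H. (g, h) \<in> R)"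

definition hasse_edge :: "'a rel \<Rightarrow> 'a set \<Rightarrow> 'a set \<Rightarrow> bool" where
  "hasse_edge R G H \<longleftrightarrow>
     G \<in> preorder_classes R \<and> H \<in> preorder_classes R \<and> G \<noteq> H \<and> class_le R G H \<and>
     \<not> (\<exists>K\<in>preorder_classes R. K \<noteq> G \<and> K \<noteq> H \<and> class_le R G K \<and> class_le R K H)"

definition contract_edge :: "'a rel \<Rightarrow> 'a rel \<Rightarrow> bool" where
  "contract_edge R R' \<longleftrightarrow> (\<exists>G H. hasse_edge R G H \<and> R' = (R \<union> H \<times> G)\<^sup>+)"

definition contraction_of :: "'a rel \<Rightarrow> 'a rel \<Rightarrow> bool" where
  "contraction_of R1 R2 \<longleftrightarrow> contract_edge\<^sup>*\<^sup>* R2 R1"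

definition sbp_le :: "nat \<Rightarrow> sbp \<Rightarrow> sbp \<Rightarrow> bool" where
  "sbp_le n C B \<longleftrightarrow> contraction_of (sbp_preorder n C) (sbp_preorder n B)"

section \<open>Types and the poset of skewed binary partitions of a multiplicity vector\<close>

datatype type_entry = Plain nat | Circ nat | Star nat

definition sbp_type :: "sbp \<Rightarrow> type_entry list" where
  "sbp_type B =
     (if 0 \<in> blk B 1 then [Plain (card (blk B 0)), Circ (card (blk B 1) - 1)]
      else [Plain (card (blk B 0) - 1), Plain 0]) @
     map (\<lambda>(S, h). if h then Star (card S) else Plain (card S)) (drop 2 B)"

definition Omega :: "nat list \<Rightarrow> type_entry list set" where
  "Omega m = (let r = sum_list (tl m) in
     {[Plain (m ! 0), if 0 < m ! 0 then Plain 0 else Circ 0] @ map Plain (tl m)} \<union>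
     {[Plain (m ! 0 + i), Circ 0, Plain ((\<Sum>j=1..g. m ! j) - i)] @ map Plain (drop (Suc g) m)
       | i g. 1 \<le> i \<and> i < r \<and> 1 \<le> g \<and> g < length m \<and>
              (\<Sum>j=1..g-1. m ! j) \<le> i \<and> i < (\<Sum>j=1..g. m ! j)} \<union>
     {[Plain (sum_list m), Circ 0]})"

definition SBP :: "nat list \<Rightarrow> sbp set" where
  "SBP m = {B. is_sbp (sum_list m) B \<and>
     (\<exists>A. is_sbp (sum_list m) A \<and> sbp_type A \<in> Omega m \<and> sbp_le (sum_list m) B A)}"

section \<open>Normal fans and poset isomorphisms\<close>

definition nonempty_faces :: "'a::real_vector set \<Rightarrow> 'a set set" where
  "nonempty_faces P = {F. F face_of P \<and> F \<noteq> {}}"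

definition normal_cone :: "'a::real_inner set \<Rightarrow> 'a set \<Rightarrow> 'a set" where
  "normal_cone P F = {w. \<forall>x\<in>F. \<forall>y\<in>P. w \<bullet> x \<ge> w \<bullet> y}"

definition normal_fan :: "'a::real_inner set \<Rightarrow> 'a set set" where
  "normal_fan P = normal_cone P ` nonempty_faces P"

definition poset_iso ::
    "'a set \<Rightarrow> ('a \<Rightarrow> 'a \<Rightarrow> bool) \<Rightarrow> 'b set \<Rightarrow> ('b \<Rightarrow> 'b \<Rightarrow> bool) \<Rightarrow> ('a \<Rightarrow> 'b) \<Rightarrow> bool" where
  "poset_iso A leA B leB f \<longleftrightarrow>
     bij_betw f A B \<and> (\<forall>x\<in>A. \<forall>y\<in>A. leA x y \<longleftrightarrow> leB (f x) (f y))"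

end

theory Submission
  imports Defs
begin

text \<open>
  The faces of the polytope are the sets of maximisers of linear functionals \<open>w\<close>, and the normal cone
  of such a face is the unique face, containing \<open>w\<close> in its relative interior, of the normal
  cone of any point of the face. For a partition \<open>A\<close> with type in \<open>\<Omega>\<^sub>m\<close>, the sliced cone is the normal cone of
  the point that vanishes on the two lowest blocks and takes the remaining values of \<open>u\<close> blockwise;
  one inclusion is the rearrangement inequality, the other tests \<open>w\<close> against transposed, lowered or
  raised copies of this point. Sorting the coordinates of \<open>w\<close> shows that these cones cover the space, so
  the normal fan consists of their faces. Finally, the faces of a preorder cone are the cones of the
  contractions of the preorder, and every contraction of \<open>\<preceq>\<^sub>A\<close> is again the preorder of a skewed binary
  partition.
\<close>

section \<open>Normal fans of polytopes\<close>

text \<open>The recurring device is that two faces of a convex set sharing a relative interior point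
  coincide. A functional \<open>w\<close> is a relative interior point of the normal cone of its own
  maximal face, and also of the cone cut out of a preorder cone by the relations tight at
  \<open>w\<close>; inside the normal cone of a vertex both must agree, and the maximal face need
  not be described. The working relation between cones is therefore being a face; inclusion is
  converted to it only at the end, inside the fan. Contractions proceed one Hasse edge at a time,
  whereas a face reverses many relations at once. Transitive closures of arbitrary relations bridge
  this gap. The index \<open>0\<close> with \<open>c\<^sub>0 = 0\<close> turns sign conditions into
  comparisons: a coordinate below \<open>0\<close> has nonpositive weight and may as well vanish in
  a maximiser. The cut \<open>s\<close> of a type counts the coordinates set to zero. It is at least
  the number of zeros of \<open>u\<close>; in the case of equality, if positive, the weights of
  these coordinates may have either sign, which is why \<open>0\<close> then joins their
  antichain.\<close>

definition maxface :: "'a::real_inner set \<Rightarrow> 'a \<Rightarrow> 'a set" where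
  "maxface P w = {x\<in>P. \<forall>y\<in>P. w \<bullet> y \<le> w \<bullet> x}"

lemma normal_cone_eq_maxface:
  assumes "F \<subseteq> P"
  shows "w \<in> normal_cone P F \<longleftrightarrow> F \<subseteq> maxface P w"
  using assms by (auto simp: normal_cone_def maxface_def)

lemma maxface_in_nonempty_faces:
  fixes P :: "'a::euclidean_space set"
  assumes "polytope P" "P \<noteq> {}"
  shows "maxface P w \<in> nonempty_faces P"
proof -
  have "continuous_on P (\<lambda>x. w \<bullet> x)" by (intro continuous_intros)
  then obtain x where x: "x \<in> P" "\<forall>y\<in>P. w \<bullet> y \<le> w \<bullet> x"
    using continuous_attains_sup[OF polytope_imp_compact[OF assms(1)] assms(2)] by blast
  then have eq: "maxface P w = P \<inter> {z. w \<bullet> z = w \<bullet> x}"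
    by (force simp: maxface_def)
  have "(P \<inter> {z. w \<bullet> z = w \<bullet> x}) face_of P"
    using x polytope_imp_convex[OF assms(1)]
    by (intro face_of_Int_supporting_hyperplane_le) auto
  then show ?thesis using x eq by (auto simp: nonempty_faces_def)
qed

text \<open>Faces of polyhedra are exposed; the improper face \<open>P\<close> is covered because
  the exposing functional may be zero.\<close>

lemma nonempty_face_is_maxface:
  fixes P :: "'a::euclidean_space set"
  assumes "polytope P" "F \<in> nonempty_faces P"
  obtains w where "F = maxface P w"
proof -
  have "F exposed_face_of P"
    using assms exposed_face_of_polyhedron[OF polytope_imp_polyhedron]
    by (auto simp: nonempty_faces_def)
  then obtain a b where ab: "P \<subseteq> {x. a \<bullet> x \<le> b}" "F = P \<inter> {x. a \<bullet> x = b}"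
    by (auto simp: exposed_face_of_def)
  obtain x where "x \<in> F" using assms(2) by (auto simp: nonempty_faces_def)
  then have "F = maxface P a"
    using ab by (force simp: maxface_def)
  then show ?thesis using that by blast
qed

text \<open>A functional exposing \<open>F\<close> lies in the normal cone of \<open>F\<close>. If
  it also lies in that of \<open>F'\<close>, then \<open>F'\<close> consists of its maximisers, and
  these form \<open>F\<close>.\<close>

lemma normal_cone_subset_iff:
  fixes P :: "'a::euclidean_space set"
  assumes "polytope P" "F \<in> nonempty_faces P" "F' \<in> nonempty_faces P"
  shows "normal_cone P F \<subseteq> normal_cone P F' \<longleftrightarrow> F' \<subseteq> F"
proof
  assume l: "normal_cone P F \<subseteq> normal_cone P F'"
  obtain w where w: "F = maxface P w" using nonempty_face_is_maxface assms by blast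
  have "F \<subseteq> P" "F' \<subseteq> P" using assms(2,3) by (auto simp: nonempty_faces_def dest: face_of_imp_subset)
  have "w \<in> normal_cone P F" using w normal_cone_eq_maxface[OF \<open>F \<subseteq> P\<close>] by simp
  then have "w \<in> normal_cone P F'" using l by blast
  then show "F' \<subseteq> F" using w \<open>F' \<subseteq> P\<close> by (auto simp: normal_cone_eq_maxface)
qed (auto simp: normal_cone_def)

lemma convex_normal_cone: "convex (normal_cone P F)"
  unfolding convex_alt normal_cone_def
  by (auto simp: inner_add_left intro!: add_mono mult_left_mono)

text \<open>Inside the normal cone of \<open>F'\<close>, lying in that of \<open>F\<close> means
  that the values at points of \<open>F\<close> and \<open>F'\<close> agree. At both ends of a
  segment the value on \<open>F\<close> is at most that on \<open>F'\<close>, so agreement at an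
  inner point forces agreement at the ends.\<close>

lemma normal_cone_face_of:
  assumes "F' \<subseteq> F" "F \<subseteq> P" "F' \<noteq> {}"
  shows "normal_cone P F face_of normal_cone P F'"
proof -
  obtain x' where x': "x' \<in> F'" using assms by blast
  have key: "a \<in> normal_cone P F"
    if a: "a \<in> normal_cone P F'" and b: "b \<in> normal_cone P F'" and t: "0 < t" "t < 1"
      and z: "(1 - t) *\<^sub>R a + t *\<^sub>R b \<in> normal_cone P F" for a b :: 'a and t
    unfolding normal_cone_def
  proof (intro CollectI ballI)
    fix x y assume xy: "x \<in> F" "y \<in> P"
    have "x' \<in> P" "x \<in> P" using x' xy assms by auto
    have 1: "a \<bullet> x \<le> a \<bullet> x'" "b \<bullet> x \<le> b \<bullet> x'" "a \<bullet> y \<le> a \<bullet> x'"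
      using a b x' \<open>x \<in> P\<close> xy by (auto simp: normal_cone_def)
    have "((1 - t) *\<^sub>R a + t *\<^sub>R b) \<bullet> x' \<le> ((1 - t) *\<^sub>R a + t *\<^sub>R b) \<bullet> x"
      using z xy \<open>x' \<in> P\<close> by (auto simp: normal_cone_def)
    then have "(1 - t) * (a \<bullet> x') + t * (b \<bullet> x') \<le> (1 - t) * (a \<bullet> x) + t * (b \<bullet> x)"
      by (simp add: inner_add_left)
    moreover have "t * (b \<bullet> x) \<le> t * (b \<bullet> x')" using 1 t by simp
    ultimately have "(1 - t) * (a \<bullet> x') \<le> (1 - t) * (a \<bullet> x)" by linarith
    then have "a \<bullet> x' \<le> a \<bullet> x" using t by simp
    then show "a \<bullet> y \<le> a \<bullet> x" using 1 by linarith
  qed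
  show ?thesis
    unfolding face_of_def
  proof (intro conjI ballI impI)
    show "normal_cone P F \<subseteq> normal_cone P F'" using assms by (auto simp: normal_cone_def)
    show "convex (normal_cone P F)" by (rule convex_normal_cone)
  next
    fix a b x assume *: "a \<in> normal_cone P F'" "b \<in> normal_cone P F'" "x \<in> normal_cone P F"
      "x \<in> open_segment a b"
    then obtain t where t: "0 < t" "t < 1" "x = (1 - t) *\<^sub>R a + t *\<^sub>R b"
      by (auto simp: in_segment)
    then show "a \<in> normal_cone P F" using key[of a b t] * by auto
    have "x = (1 - (1 - t)) *\<^sub>R b + (1 - t) *\<^sub>R a" using t by (simp add: add.commute)
    then show "b \<in> normal_cone P F" using key[of b a "1 - t"] * t(1,2) by auto
  qed
qed

text \<open>Meant for extrapolation: a relative interior point is one beyond which every segment of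
  the set can be prolonged a little, so \<open>e\<close> tends to 1 from above. A constraint strict
  at the limit survives by continuity; a tight one is kept by equality.\<close>

lemma eventually_affine_le:
  fixes a b c d :: real
  assumes "c < d \<or> c = d \<and> a = b"
  shows "eventually (\<lambda>e. (1 - e) * a + e * c \<le> (1 - e) * b + e * d) (at_right 1)"
proof (cases "c < d")
  case True
  have t: "((\<lambda>e. (1 - e) * b + e * d - ((1 - e) * a + e * c)) \<longlongrightarrow>
      (1 - 1) * b + 1 * d - ((1 - 1) * a + 1 * c)) (at_right 1)"
    by (intro tendsto_intros)
  have "eventually (\<lambda>e. 0 < (1 - e) * b + e * d - ((1 - e) * a + e * c)) (at_right 1)"
    using order_tendstoD(1)[OF t, of 0] True by simp
  then show ?thesis by eventually_elim simp
qed (use assms in auto)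

text \<open>Only the finitely many generators \<open>V\<close> have to be tested. Those outside the
  maximal face satisfy their inequality strictly at \<open>w\<close>; on the others every functional
  of the cone takes the same value as at \<open>x\<close>.\<close>

lemma in_rel_interior_normal_cone_maxface:
  fixes P :: "'a::euclidean_space set"
  assumes "polytope P" "P \<noteq> {}"
  shows "w \<in> rel_interior (normal_cone P (maxface P w))"
proof -
  let ?N = "normal_cone P (maxface P w)"
  have sub: "maxface P w \<subseteq> P" by (auto simp: maxface_def)
  have w: "w \<in> ?N" using sub by (simp add: normal_cone_eq_maxface)
  obtain x where x: "x \<in> maxface P w"
    using maxface_in_nonempty_faces[OF assms] by (auto simp: nonempty_faces_def)
  obtain V where V: "finite V" "P = convex hull V"
    using assms(1) by (auto simp: polytope_def)
  have VP: "V \<subseteq> P" using V hull_subset by metis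
  have "\<exists>e>1. (1 - e) *\<^sub>R w' + e *\<^sub>R w \<in> ?N" if w': "w' \<in> ?N" for w'
  proof -
    have "eventually (\<lambda>e. \<forall>y\<in>V. (1 - e) * (w' \<bullet> y) + e * (w \<bullet> y)
        \<le> (1 - e) * (w' \<bullet> x) + e * (w \<bullet> x)) (at_right 1)"
    proof (intro eventually_ball_finite V ballI eventually_affine_le)
      fix y assume y: "y \<in> V"
      have "w \<bullet> y \<le> w \<bullet> x" using x y VP by (auto simp: maxface_def)
      moreover have "w' \<bullet> y = w' \<bullet> x" if "w \<bullet> y = w \<bullet> x"
      proof -
        have "y \<in> maxface P w" using that x y VP by (auto simp: maxface_def)
        then show ?thesis using w' x sub by (auto simp: normal_cone_def intro!: antisym)
      qed
      ultimately show "w \<bullet> y < w \<bullet> x \<or> w \<bullet> y = w \<bullet> x \<and> w' \<bullet> y = w' \<bullet> x"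
        by linarith
    qed
    moreover have "eventually (\<lambda>e::real. 1 < e) (at_right 1)"
      by (simp add: eventually_at_right_less)
    ultimately have "\<exists>e. 1 < e \<and> (\<forall>y\<in>V. (1 - e) * (w' \<bullet> y) + e * (w \<bullet> y)
        \<le> (1 - e) * (w' \<bullet> x) + e * (w \<bullet> x))"
      using eventually_happens[OF eventually_conj] by fastforce
    then obtain e where e: "1 < e" "\<forall>y\<in>V. (1 - e) * (w' \<bullet> y) + e * (w \<bullet> y)
        \<le> (1 - e) * (w' \<bullet> x) + e * (w \<bullet> x)" by blast
    let ?z = "(1 - e) *\<^sub>R w' + e *\<^sub>R w"
    have "V \<subseteq> {y. ?z \<bullet> y \<le> ?z \<bullet> x}"
      using e by (auto simp: inner_add_left)
    then have le: "P \<subseteq> {y. ?z \<bullet> y \<le> ?z \<bullet> x}"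
      unfolding V by (rule hull_minimal) (rule convex_halfspace_le)
    have eq: "?z \<bullet> x' = ?z \<bullet> x" if "x' \<in> maxface P w" for x'
    proof -
      have "w \<bullet> x' = w \<bullet> x" using that x by (auto simp: maxface_def intro!: antisym)
      moreover have "w' \<bullet> x' = w' \<bullet> x"
        using that w' x sub by (auto simp: normal_cone_def intro!: antisym)
      ultimately show ?thesis by (simp add: inner_add_left)
    qed
    have "?z \<in> ?N"
      unfolding normal_cone_def
    proof (intro CollectI ballI)
      fix x' y assume "x' \<in> maxface P w" "y \<in> P"
      then show "?z \<bullet> y \<le> ?z \<bullet> x'" using eq le by auto
    qed
    then show ?thesis using e by blast
  qed
  then show ?thesis
    using convex_rel_interior_iff[OF convex_normal_cone] w by blast
qed

text \<open>Both cones are faces of the normal cone of \<open>v\<close> with \<open>w\<close> in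
  their relative interior. This identifies an abstract face as a member of the fan.\<close>

lemma face_of_normal_cone_eq:
  fixes P :: "'a::euclidean_space set"
  assumes "polytope P" "v \<in> P" "T face_of normal_cone P {v}" "w \<in> rel_interior T"
  shows "T = normal_cone P (maxface P w)"
proof -
  have "w \<in> normal_cone P {v}"
    using assms(3,4) rel_interior_subset face_of_imp_subset by blast
  then have "{v} \<subseteq> maxface P w" using assms by (simp add: normal_cone_eq_maxface)
  then have "normal_cone P (maxface P w) face_of normal_cone P {v}"
    by (intro normal_cone_face_of) (auto simp: maxface_def)
  moreover have "w \<in> rel_interior (normal_cone P (maxface P w))"
    using assms in_rel_interior_normal_cone_maxface by blast
  ultimately show ?thesis using face_of_eq[OF assms(3)] assms(4) by blast
qed

text \<open>Normal cones reverse the inclusion of faces and determine them, so they can be composed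
  with the inverse of \<open>f\<close>.\<close>

lemma poset_iso_normal_fan_imp_dual:
  fixes P :: "'a::euclidean_space set"
  assumes P: "polytope P" and iso: "poset_iso S le (normal_fan P) (\<subseteq>) f"
  shows "\<exists>g. poset_iso (nonempty_faces P) (\<subseteq>) S (\<lambda>x y. le y x) g"
proof -
  let ?N = "normal_cone P" and ?g = "inv_into S f"
  have f: "bij_betw f S (normal_fan P)" and ord: "\<And>x y. x \<in> S \<Longrightarrow> y \<in> S \<Longrightarrow> le x y \<longleftrightarrow> f x \<subseteq> f y"
    using iso by (auto simp: poset_iso_def)
  have "inj_on ?N (nonempty_faces P)"
    by (rule inj_onI) (metis P normal_cone_subset_iff order_refl subset_antisym)
  then have N: "bij_betw ?N (nonempty_faces P) (normal_fan P)"
    by (simp add: bij_betw_def normal_fan_def)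
  have "bij_betw (?g \<circ> ?N) (nonempty_faces P) S"
    using bij_betw_trans[OF N bij_betw_inv_into[OF f]] .
  moreover have "F \<subseteq> F' \<longleftrightarrow> le ((?g \<circ> ?N) F') ((?g \<circ> ?N) F)"
    if "F \<in> nonempty_faces P" "F' \<in> nonempty_faces P" for F F'
  proof -
    have "?N F \<in> f ` S" "?N F' \<in> f ` S"
      using N f that by (auto simp: bij_betw_def)
    then show ?thesis
      using that by (simp add: ord inv_into_into f_inv_into_f normal_cone_subset_iff[OF P])
  qed
  ultimately show ?thesis unfolding poset_iso_def by blast
qed

section \<open>Cones of preorders and contractions\<close>

text \<open>Any relation is allowed, because the generators of a closure and the preorders met
  during a contraction need cones as well.\<close>

definition preorder_cone :: "(nat \<Rightarrow> 'n::finite) \<Rightarrow> nat rel \<Rightarrow> (real ^ 'n) set" where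
  "preorder_cone e R = {c. \<forall>(i, j)\<in>R. coord e c i \<le> coord e c j}"

lemma sliced_cone_eq: "sliced_cone e n B = preorder_cone e (sbp_preorder n B)"
  by (simp add: sliced_cone_def preorder_cone_def)

lemma coord_add: "coord e (a + b) i = coord e a i + coord e b i"
  and coord_scaleR: "coord e (r *\<^sub>R a) i = r * coord e a i"
  and coord_zero [simp]: "coord e a 0 = 0"
  by (auto simp: coord_def)

definition vec_of :: "nat \<Rightarrow> (nat \<Rightarrow> 'n::finite) \<Rightarrow> (nat \<Rightarrow> real) \<Rightarrow> real ^ 'n" where
  "vec_of n e f = (\<chi> k. f (inv_into {1..n} e k))"

lemma coord_vec_of:
  assumes "bij_betw e {1..n} UNIV" "i \<in> {1..n}"
  shows "coord e (vec_of n e f) i = f i"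
  using assms by (auto simp: coord_def vec_of_def bij_betw_def inv_into_f_f)

lemma in_preorder_coneD: "c \<in> preorder_cone e R \<Longrightarrow> (i, j) \<in> R \<Longrightarrow> coord e c i \<le> coord e c j"
  by (auto simp: preorder_cone_def)

lemma preorder_cone_antimono: "R \<subseteq> T \<Longrightarrow> preorder_cone e T \<subseteq> preorder_cone e R"
  by (auto simp: preorder_cone_def)

lemma preorder_cone_trancl: "preorder_cone e (R\<^sup>+) = preorder_cone e R"
proof
  have "coord e c i \<le> coord e c j" if "(i, j) \<in> R\<^sup>+" "c \<in> preorder_cone e R" for c i j
    using that(1) by (induction rule: trancl_induct)
      (use that(2) in_preorder_coneD order_trans in blast)+
  then show "preorder_cone e R \<subseteq> preorder_cone e (R\<^sup>+)"
    by (auto simp: preorder_cone_def)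
qed (rule preorder_cone_antimono, auto)

lemma zero_in_preorder_cone: "0 \<in> preorder_cone e R"
  by (auto simp: preorder_cone_def coord_def)

lemma convex_preorder_cone: "convex (preorder_cone e R)"
  unfolding convex_def preorder_cone_def
  by (auto simp: coord_add coord_scaleR intro!: add_mono mult_left_mono)

text \<open>Each pair of \<open>S\<close> reverses an inequality of \<open>R\<close> and makes it an
  equation. An inequality that is an equation at an inner point of a segment is one at both
  ends.\<close>

lemma preorder_cone_closure_face_of:
  assumes "S \<subseteq> R\<inverse>"
  shows "preorder_cone e ((R \<union> S)\<^sup>+) face_of preorder_cone e R"
proof -
  have key: "a \<in> preorder_cone e (R \<union> S)"
    if a: "a \<in> preorder_cone e R" and b: "b \<in> preorder_cone e R" and t: "0 < t" "t < 1"
      and z: "(1 - t) *\<^sub>R a + t *\<^sub>R b \<in> preorder_cone e (R \<union> S)" for a b t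
    unfolding preorder_cone_def
  proof (clarify)
    fix i j assume "(i, j) \<in> R \<union> S"
    then consider "(i, j) \<in> R" | "(i, j) \<in> S" "(j, i) \<in> R" using assms by auto
    then show "coord e a i \<le> coord e a j"
    proof cases
      case 2
      have "(1 - t) * coord e a i + t * coord e b i \<le> (1 - t) * coord e a j + t * coord e b j"
        using in_preorder_coneD[OF z, of i j] 2 by (simp add: coord_add coord_scaleR)
      moreover have "t * coord e b j \<le> t * coord e b i"
        using in_preorder_coneD[OF b 2(2)] t by simp
      ultimately have "(1 - t) * coord e a i \<le> (1 - t) * coord e a j" by linarith
      then show ?thesis using t by simp
    qed (rule in_preorder_coneD[OF a])
  qed
  show ?thesis
    unfolding face_of_def preorder_cone_trancl
  proof (intro conjI ballI impI)
    show "preorder_cone e (R \<union> S) \<subseteq> preorder_cone e R"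
      by (rule preorder_cone_antimono) auto
    show "convex (preorder_cone e (R \<union> S))" by (rule convex_preorder_cone)
  next
    fix a b x assume *: "a \<in> preorder_cone e R" "b \<in> preorder_cone e R"
      "x \<in> preorder_cone e (R \<union> S)" "x \<in> open_segment a b"
    then obtain t where t: "0 < t" "t < 1" "x = (1 - t) *\<^sub>R a + t *\<^sub>R b"
      by (auto simp: in_segment)
    then show "a \<in> preorder_cone e (R \<union> S)" using key[of a b t] * by auto
    have "x = (1 - (1 - t)) *\<^sub>R b + (1 - t) *\<^sub>R a" using t by (simp add: add.commute)
    then show "b \<in> preorder_cone e (R \<union> S)" using key[of b a "1 - t"] * t(1,2) by auto
  qed
qed

text \<open>The pairs to be reversed: adding them makes equations of the inequalities that
  \<open>f\<close> satisfies with equality.\<close>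

definition tight :: "(nat \<Rightarrow> real) \<Rightarrow> nat rel \<Rightarrow> nat rel" where
  "tight f R = {(q, p). (p, q) \<in> R \<and> f p = f q}"

lemma tight_subset: "tight f R \<subseteq> R\<inverse>"
  by (auto simp: tight_def)

text \<open>Extrapolation past \<open>w\<close> again, now over the finitely many pairs: strict ones
  survive, and tight ones are equations on the whole cone because both directions are
  present.\<close>

lemma in_rel_interior_tight_cone:
  assumes "finite R" "w \<in> preorder_cone e R"
  shows "w \<in> rel_interior (preorder_cone e ((R \<union> tight (coord e w) R)\<^sup>+))"
proof -
  let ?S = "tight (coord e w) R"
  have "\<exists>t>1. (1 - t) *\<^sub>R c + t *\<^sub>R w \<in> preorder_cone e (R \<union> ?S)"
    if c: "c \<in> preorder_cone e (R \<union> ?S)" for c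
  proof -
    have "eventually (\<lambda>t. \<forall>(i, j)\<in>R \<union> ?S. (1 - t) * coord e c i + t * coord e w i
        \<le> (1 - t) * coord e c j + t * coord e w j) (at_right 1)"
    proof (intro eventually_ball_finite ballI, goal_cases)
      case 1
      have "finite ?S" using finite_subset[OF tight_subset] assms(1) by blast
      then show ?case using assms(1) by simp
    next
      case (2 x)
      obtain i j where x: "x = (i, j)" by force
      have "coord e w i \<le> coord e w j"
        using 2 assms(2) x by (auto simp: tight_def preorder_cone_def)
      moreover have "coord e c i = coord e c j" if "coord e w i = coord e w j"
      proof -
        have "(i, j) \<in> R \<union> ?S" "(j, i) \<in> R \<union> ?S" using 2 x that by (auto simp: tight_def)
        then show ?thesis using c by (meson antisym in_preorder_coneD)
      qed
      ultimately have "coord e w i < coord e w j \<or>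
        coord e w i = coord e w j \<and> coord e c i = coord e c j" by linarith
      from eventually_affine_le[OF this] show ?case by (simp add: x)
    qed
    moreover have "eventually (\<lambda>t::real. 1 < t) (at_right 1)"
      by (simp add: eventually_at_right_less)
    ultimately obtain t :: real where "1 < t" "\<forall>(i, j)\<in>R \<union> ?S. (1 - t) * coord e c i + t * coord e w i
        \<le> (1 - t) * coord e c j + t * coord e w j"
      using eventually_happens[OF eventually_conj] by fastforce
    then show ?thesis
      by (intro exI[of _ t]) (auto simp: preorder_cone_def coord_add coord_scaleR)
  qed
  moreover have "w \<in> preorder_cone e (R \<union> ?S)"
    using assms(2) by (auto simp: preorder_cone_def tight_def)
  ultimately show ?thesis
    unfolding preorder_cone_trancl using convex_rel_interior_iff[OF convex_preorder_cone] by blast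
qed

lemma trancl_least: "R \<subseteq> T \<Longrightarrow> trans T \<Longrightarrow> R\<^sup>+ \<subseteq> T"
  by (metis subrelI trancl_id trancl_mono)

lemma preorder_cone_determines:
  assumes e: "bij_betw e {1..n} UNIV" and R: "R \<subseteq> {0..n} \<times> {0..n}" "trans R" "refl_on {0..n} R"
    and ij: "i \<le> n" "j \<le> n"
  shows "(i, j) \<in> R \<longleftrightarrow> (\<forall>c\<in>preorder_cone e R. coord e c i \<le> coord e c j)"
proof
  assume *: "\<forall>c\<in>preorder_cone e R. coord e c i \<le> coord e c j"
  \<comment> \<open>The indicator of the up-set of \<open>i\<close>, shifted by a constant so that
    it vanishes at \<open>0\<close> and is a point of the slice; the shift leaves all comparisons
    unchanged.\<close>
  define f :: "nat \<Rightarrow> real" where "f k = of_bool ((i, k) \<in> R) - of_bool ((i, 0) \<in> R)" for k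
  have f: "coord e (vec_of n e f) k = f k" if "k \<le> n" for k
    using coord_vec_of[OF e, of k f] that by (cases "k = 0") (auto simp: f_def)
  have "vec_of n e f \<in> preorder_cone e R"
    unfolding preorder_cone_def
  proof clarify
    fix k l assume kl: "(k, l) \<in> R"
    have "f k \<le> f l" using kl transD[OF R(2)] by (auto simp: f_def)
    then show "coord e (vec_of n e f) k \<le> coord e (vec_of n e f) l" using f kl R(1) by force
  qed
  then have "f i \<le> f j" using * f ij by fastforce
  moreover have "(i, i) \<in> R" using R(3) ij by (auto simp: refl_on_def)
  ultimately show "(i, j) \<in> R" by (cases "(i, j) \<in> R") (auto simp: f_def)
qed (auto dest: in_preorder_coneD)

lemma preorder_cone_inj:
  assumes e: "bij_betw e {1..n} UNIV"
    and R: "R \<subseteq> {0..n} \<times> {0..n}" "trans R" "refl_on {0..n} R"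
    and T: "T \<subseteq> {0..n} \<times> {0..n}" "trans T" "refl_on {0..n} T"
    and eq: "preorder_cone e R = preorder_cone e T"
  shows "R = T"
proof -
  have "(i, j) \<in> R \<longleftrightarrow> (i, j) \<in> T" if "i \<le> n" "j \<le> n" for i j
    using preorder_cone_determines[OF e R that] preorder_cone_determines[OF e T that] eq by simp
  then show ?thesis using R(1) T(1) by fastforce
qed

section \<open>Contractions of abstract preorders as closures under reversed relations\<close>

lemma preorder_class_memD:
  assumes "G \<in> preorder_classes R" "g \<in> G" "g' \<in> G" "trans R" "refl_on X R" "R \<subseteq> X \<times> X"
  shows "(g, g') \<in> R"
proof -
  obtain x where x: "G = (R \<inter> R\<inverse>) `` {x}"
    using assms(1) by (auto simp: preorder_classes_def quotient_def)
  then show ?thesis using assms transD[OF assms(4)] by blast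
qed

lemma Field_preorder: "refl_on X R \<Longrightarrow> R \<subseteq> X \<times> X \<Longrightarrow> Field R = X"
  by (auto simp: Field_def refl_on_def)

text \<open>The members of a class are mutually related, so one relation from \<open>G\<close> to
  \<open>H\<close> gives all of them, and the added pairs \<open>H \<times> G\<close> reverse
  relations of \<open>R\<close>. A contraction is thus a closure of the kind that cuts out a
  face.\<close>

lemma contract_edge_preorder:
  assumes "contract_edge R R'" "trans R" "refl_on X R" "R \<subseteq> X \<times> X"
  shows "\<exists>S. S \<subseteq> R\<inverse> \<and> R' = (R \<union> S)\<^sup>+ \<and> trans R' \<and> refl_on X R' \<and> R' \<subseteq> X \<times> X"
proof -
  obtain G H where GH: "hasse_edge R G H" "R' = (R \<union> H \<times> G)\<^sup>+"
    using assms(1) by (auto simp: contract_edge_def)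
  have cl: "G \<in> preorder_classes R" "H \<in> preorder_classes R" "class_le R G H"
    using GH by (auto simp: hasse_edge_def)
  then obtain g h where gh: "g \<in> G" "h \<in> H" "(g, h) \<in> R" by (auto simp: class_le_def)
  have "(g', h') \<in> R" if "g' \<in> G" "h' \<in> H" for g' h'
  proof -
    have "(g', g) \<in> R" "(h, h') \<in> R"
      using preorder_class_memD[OF cl(1) that(1) gh(1) assms(2-4)]
        preorder_class_memD[OF cl(2) gh(2) that(2) assms(2-4)] .
    then show ?thesis using gh(3) assms(2) by (meson transD)
  qed
  then have S: "H \<times> G \<subseteq> R\<inverse>" by auto
  then have "(R \<union> H \<times> G) \<subseteq> X \<times> X" using assms(4) by auto
  then have "R' \<subseteq> X \<times> X" unfolding GH by (rule trancl_subset_Sigma)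
  moreover have "refl_on X R'" using assms(3) \<open>R' \<subseteq> X \<times> X\<close> unfolding GH(2)
    by (auto simp: refl_on_def)
  moreover have "trans R'" unfolding GH(2) by (rule trans_trancl)
  ultimately show ?thesis using S GH(2) by (intro exI[of _ "H \<times> G"] conjI)
qed

lemma contraction_preorder_cone_face_of:
  assumes "contraction_of R' R" "trans R" "refl_on X R" "R \<subseteq> X \<times> X"
  shows "preorder_cone e R' face_of preorder_cone e R"
proof -
  have "contract_edge\<^sup>*\<^sup>* R R'" using assms(1) by (simp add: contraction_of_def)
  then have "preorder_cone e R' face_of preorder_cone e R \<and>
    trans R' \<and> refl_on X R' \<and> R' \<subseteq> X \<times> X"
  proof (induction rule: rtranclp_induct)
    case base
    then show ?case using assms face_of_refl[OF convex_preorder_cone] by blast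
  next
    case (step R1 R2)
    then obtain S where "S \<subseteq> R1\<inverse>" "R2 = (R1 \<union> S)\<^sup>+" "trans R2" "refl_on X R2" "R2 \<subseteq> X \<times> X"
      using contract_edge_preorder by metis
    then show ?case
      using preorder_cone_closure_face_of face_of_trans step.IH by metis
  qed
  then show ?thesis by blast
qed

text \<open>A minimal element strictly above \<open>p\<close> among those below \<open>q\<close>
  covers \<open>p\<close>, since anything strictly between would be a smaller candidate.\<close>

lemma ex_hasse_edge:
  assumes R: "finite X" "trans R" "refl_on X R" "R \<subseteq> X \<times> X"
    and pq: "(p, q) \<in> R" "(q, p) \<notin> R"
  obtains h where "(p, h) \<in> R" "(h, p) \<notin> R" "(h, q) \<in> R"
    "hasse_edge R ((R \<inter> R\<inverse>) `` {p}) ((R \<inter> R\<inverse>) `` {h})"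
proof -
  have rfl: "(x, x) \<in> R" if "x \<in> X" for x using R(3) that by (auto simp: refl_on_def)
  let ?A = "{h. (p, h) \<in> R \<and> (h, p) \<notin> R \<and> (h, q) \<in> R}"
  let ?lt = "{(x, y). (x, y) \<in> R \<and> (y, x) \<notin> R}"
  have "wf ?lt"
  proof (rule finite_acyclic_wf)
    have "?lt \<subseteq> X \<times> X" using R(4) by auto
    then show "finite ?lt" using R(1) by (meson finite_SigmaI finite_subset)
    have "trans ?lt" using R(2) by (auto simp: trans_def)
    then show "acyclic ?lt" by (simp add: acyclic_def)
  qed
  moreover have "q \<in> ?A" using pq rfl R(4) by auto
  ultimately obtain h where h: "h \<in> ?A" "\<And>y. (y, h) \<in> ?lt \<Longrightarrow> y \<notin> ?A"
    by (rule wfE_min) blast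
  let ?c = "\<lambda>x. (R \<inter> R\<inverse>) `` {x}"
  have X: "p \<in> X" "h \<in> X" using h(1) R(4) by auto
  have F: "Field R = X" using R Field_preorder by blast
  have "hasse_edge R (?c p) (?c h)"
    unfolding hasse_edge_def
  proof (intro conjI notI)
    show "?c p \<in> preorder_classes R" "?c h \<in> preorder_classes R"
      using X F by (auto simp: preorder_classes_def quotient_def)
    show "?c p = ?c h \<Longrightarrow> False" using h(1) rfl X by blast
    show "class_le R (?c p) (?c h)" using h(1) rfl X by (auto simp: class_le_def)
  next
    assume "\<exists>K\<in>preorder_classes R. K \<noteq> ?c p \<and> K \<noteq> ?c h \<and> class_le R (?c p) K \<and> class_le R K (?c h)"
    then obtain k where k: "k \<in> X" "?c k \<noteq> ?c p" "?c k \<noteq> ?c h"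
      "class_le R (?c p) (?c k)" "class_le R (?c k) (?c h)"
      using F by (auto simp: preorder_classes_def quotient_def)
    have pk: "(p, k) \<in> R" and kh: "(k, h) \<in> R"
      using k(4,5) transD[OF R(2)] unfolding class_le_def by blast+
    have "(k, p) \<notin> R" using pk k(2) transD[OF R(2)] by blast
    moreover have "(h, k) \<notin> R" using kh k(3) transD[OF R(2)] by blast
    ultimately show False using h pk kh transD[OF R(2)] by blast
  qed
  then show ?thesis using that h(1) by blast
qed

text \<open>Greedy argument: reversing a relation of \<open>R\<close> forces all relations on a chain of covers
  to be reversed, so one can start by contracting a cover.\<close>

lemma contraction_of_closure:
  assumes "finite X" "trans R" "refl_on X R" "R \<subseteq> X \<times> X" "S \<subseteq> R\<inverse>"
  shows "contraction_of ((R \<union> S)\<^sup>+) R"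
  using assms
\<comment> \<open>Each contraction lowers the number of unrelated pairs. \<open>S\<close> can stay
  fixed, since its pairs remain reversals of relations while \<open>R\<close> grows.\<close>
proof (induction "card (X \<times> X - R)" arbitrary: R rule: less_induct)
  case less
  let ?C = "(R \<union> S)\<^sup>+"
  show ?case
  proof (cases "S \<subseteq> R")
    case True
    then have "?C = R" using less.prems by (simp add: Un_absorb2)
    then show ?thesis by (simp add: contraction_of_def)
  next
    case False
    then obtain p q where pq: "(p, q) \<in> R" "(q, p) \<notin> R" "(q, p) \<in> S" using less.prems(5) by auto
    then obtain h where h: "(p, h) \<in> R" "(h, p) \<notin> R" "(h, q) \<in> R"
      "hasse_edge R ((R \<inter> R\<inverse>) `` {p}) ((R \<inter> R\<inverse>) `` {h})"
      using ex_hasse_edge less.prems by metis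
    let ?G = "(R \<inter> R\<inverse>) `` {p}" and ?H = "(R \<inter> R\<inverse>) `` {h}"
    let ?R' = "(R \<union> ?H \<times> ?G)\<^sup>+"
    have edge: "contract_edge R ?R'" using h(4) by (auto simp: contract_edge_def)
    then have R': "trans ?R'" "refl_on X ?R'" "?R' \<subseteq> X \<times> X"
      using contract_edge_preorder[OF edge less.prems(2-4)] by blast+
    have sub: "R \<subseteq> ?R'" by auto
    have "p \<in> X" "h \<in> X" using h less.prems by auto
    then have "(h, p) \<in> ?R'"
      using less.prems(3) by (intro r_into_trancl) (auto simp: refl_on_def)
    moreover have "(h, p) \<in> X \<times> X" using \<open>p \<in> X\<close> \<open>h \<in> X\<close> by simp
    ultimately have "X \<times> X - ?R' \<subset> X \<times> X - R" using h(2) sub by blast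
    then have "card (X \<times> X - ?R') < card (X \<times> X - R)"
      using less.prems(1) by (intro psubset_card_mono) auto
    then have IH: "contraction_of ((?R' \<union> S)\<^sup>+) ?R'"
      using less.hyps R' less.prems(1,5) sub by blast
    \<comment> \<open>Merging the edge stays within the closure: \<open>h'\<close>,
      \<open>h\<close>, \<open>q\<close>, \<open>p\<close>, \<open>g'\<close> is an ascending chain
      there, its step from \<open>q\<close> to \<open>p\<close> coming from
      \<open>S\<close>.\<close>
    have "?H \<times> ?G \<subseteq> ?C"
    proof clarify
      fix g' h' assume "(p, g') \<in> R" "(h, h') \<in> R" "(g', p) \<in> R" "(h', h) \<in> R"
      then have "(h', h) \<in> ?C" "(h, q) \<in> ?C" "(q, p) \<in> ?C" "(p, g') \<in> ?C" using h pq by auto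
      then show "(h', g') \<in> ?C" by (meson trancl_trans)
    qed
    then have "R \<union> ?H \<times> ?G \<subseteq> ?C" by auto
    then have "?R' \<subseteq> ?C" by (rule trancl_least) simp
    then have "(?R' \<union> S)\<^sup>+ \<subseteq> ?C"
      by (intro trancl_least) auto
    moreover have "?C \<subseteq> (?R' \<union> S)\<^sup>+" using sub by (intro trancl_least) auto
    ultimately have "(?R' \<union> S)\<^sup>+ = ?C" by blast
    then show ?thesis using IH edge unfolding contraction_of_def
      by (metis converse_rtranclp_into_rtranclp)
  qed
qed

section \<open>Positions and levels\<close>

text \<open>The common shape of all preorders that occur: levels may be block positions, real values
  or the doubled positions of glued classes, and \<open>h\<close> labels the homogeneous
  levels.\<close>

definition level_preorder :: "nat \<Rightarrow> (nat \<Rightarrow> 'a::linorder) \<Rightarrow> ('a \<Rightarrow> bool) \<Rightarrow> nat rel" where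
  "level_preorder n lvl h = {(p, q). p \<le> n \<and> q \<le> n \<and>
     (p = q \<or> lvl p < lvl q \<or> lvl p = lvl q \<and> h (lvl p))}"

lemma level_preorder: "trans (level_preorder n lvl h)" "refl_on {0..n} (level_preorder n lvl h)"
  "level_preorder n lvl h \<subseteq> {0..n} \<times> {0..n}"
  by (auto simp: level_preorder_def trans_def refl_on_def)

lemma sbp_length: "is_sbp n B \<Longrightarrow> 2 \<le> length B"
  unfolding is_sbp_def by (elim conjE)

definition block_pos :: "sbp \<Rightarrow> nat \<Rightarrow> nat" where
  "block_pos B p = (THE j. j < length B \<and> p \<in> blk B j)"

lemma block_pos_eq:
  assumes "is_sbp n B" "j < length B" "p \<in> blk B j"
  shows "block_pos B p = j"
  unfolding block_pos_def using assms unfolding is_sbp_def by (intro the_equality) blast+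

lemma block_pos:
  assumes "is_sbp n B" "p \<le> n"
  shows "block_pos B p < length B" "p \<in> blk B (block_pos B p)"
proof -
  have "p \<in> (\<Union>i<length B. blk B i)" using assms unfolding is_sbp_def by simp
  then obtain j where "j < length B" "p \<in> blk B j" by blast
  then show "block_pos B p < length B" "p \<in> blk B (block_pos B p)"
    using block_pos_eq[OF assms(1)] by auto
qed

lemma blk_eq_block_pos:
  assumes "is_sbp n B" "j < length B"
  shows "blk B j = {p. p \<le> n \<and> block_pos B p = j}"
proof -
  have "p \<le> n" if "p \<in> blk B j" for p
    using that assms unfolding is_sbp_def by fastforce
  then show ?thesis using block_pos_eq[OF assms] block_pos[OF assms(1)] by auto
qed

lemma sbp_preorder_eq_level:
  assumes "\<And>p. p \<le> n \<Longrightarrow> pos p < length B"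
    and "\<And>j. j < length B \<Longrightarrow> blk B j = {p. p \<le> n \<and> pos p = j}"
  shows "sbp_preorder n B = level_preorder n pos (homog B)"
proof -
  have "(\<exists>i j. i < j \<and> j < length B \<and> p \<in> blk B i \<and> q \<in> blk B j) \<longleftrightarrow> pos p < pos q"
    if "p \<le> n" "q \<le> n" for p q
    using assms that by (metis (mono_tags, lifting) mem_Collect_eq order_less_trans)
  moreover have "(\<exists>i<length B. homog B i \<and> p \<in> blk B i \<and> q \<in> blk B i) \<longleftrightarrow>
      pos p = pos q \<and> homog B (pos p)"
    if "p \<le> n" "q \<le> n" for p q
    using assms that by (metis (mono_tags, lifting) mem_Collect_eq)
  ultimately show ?thesis
    by (simp add: sbp_preorder_def level_preorder_def cong: conj_cong)
qed

lemma sbp_preorder_block_pos: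
  "is_sbp n B \<Longrightarrow> sbp_preorder n B = level_preorder n (block_pos B) (homog B)"
  using sbp_preorder_eq_level block_pos(1) blk_eq_block_pos by blast

section \<open>Recovering a skewed binary partition from its preorder\<close>

lemma sbp_preorder_less_iff:
  assumes "is_sbp n B" "p \<le> n" "q \<le> n"
  shows "block_pos B p < block_pos B q \<longleftrightarrow> (p, q) \<in> sbp_preorder n B \<and> (q, p) \<notin> sbp_preorder n B"
  using assms by (auto simp: sbp_preorder_block_pos level_preorder_def)

text \<open>The preorder has to reveal which of the first two blocks contains \<open>0\<close>, as
  either may be empty. In \<open>B\<^sub>-\<^sub>1\<close> the element \<open>0\<close> has an
  incomparable companion, whereas \<open>B\<^sub>0\<close> is homogeneous as soon as it has two
  elements.\<close>

lemma zero_in_blk_0_iff: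
  assumes B: "is_sbp n B"
  shows "0 \<in> blk B 0 \<longleftrightarrow> (\<exists>q\<le>n. (0, q) \<notin> sbp_preorder n B \<and> (q, 0) \<notin> sbp_preorder n B)"
proof -
  have len: "0 < length B" "1 < length B" using B by (auto simp: is_sbp_def)
  have fin: "finite (blk B 0)" "finite (blk B 1)" using blk_eq_block_pos[OF B] len by auto
  show ?thesis
  proof
    assume 0: "0 \<in> blk B 0"
    then have "2 \<le> card (blk B 0)" "\<not> homog B 0" using B by (auto simp: is_sbp_def)
    then obtain q where "q \<in> blk B 0" "q \<noteq> 0"
      by (metis card_1_singleton_iff card_2_iff' card_le_Suc0_iff_eq fin(1) 0 not_less_eq_eq numeral_2_eq_2)
    then show "\<exists>q\<le>n. (0, q) \<notin> sbp_preorder n B \<and> (q, 0) \<notin> sbp_preorder n B"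
      using 0 blk_eq_block_pos[OF B len(1)] \<open>\<not> homog B 0\<close>
      by (auto simp: sbp_preorder_block_pos[OF B] level_preorder_def intro!: exI[of _ q])
  next
    assume "\<exists>q\<le>n. (0, q) \<notin> sbp_preorder n B \<and> (q, 0) \<notin> sbp_preorder n B"
    then obtain q where q: "q \<le> n" "block_pos B q = block_pos B 0" "q \<noteq> 0" "\<not> homog B (block_pos B 0)"
      by (auto simp: sbp_preorder_block_pos[OF B] level_preorder_def linorder_neq_iff)
    show "0 \<in> blk B 0"
    proof (rule ccontr)
      assume "0 \<notin> blk B 0"
      then have 1: "0 \<in> blk B 1" using B by (auto simp: is_sbp_def)
      then have "{0, q} \<subseteq> blk B 1" using q blk_eq_block_pos[OF B len(2)] by auto
      then have "card {0, q} \<le> card (blk B 1)" using fin by (metis card_mono)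
      then have "homog B 1" using B q by (auto simp: is_sbp_def)
      then show False using q 1 block_pos_eq[OF B len(2)] by auto
    qed
  qed
qed

text \<open>Strict comparisons fix positions only up to gaps. Positions 0 and 1 are anchored by the
  element \<open>0\<close>; from position 2 on no block is empty, so strong induction settles the
  rest.\<close>

lemma sbp_block_pos_cong:
  assumes B: "is_sbp n B" and C: "is_sbp n C" and eq: "sbp_preorder n B = sbp_preorder n C"
    and p: "p \<le> n"
  shows "block_pos B p = block_pos C p"
proof -
  have less: "block_pos B p < block_pos B q \<longleftrightarrow> block_pos C p < block_pos C q" if "p \<le> n" "q \<le> n" for p q
    using sbp_preorder_less_iff[OF B that] sbp_preorder_less_iff[OF C that] eq by simp
  \<comment> \<open>If \<open>0\<close> is in position 0, then position 1 is empty and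
    \<open>p\<close> shares the block of \<open>0\<close>. Otherwise \<open>0\<close> is in position
    1, and \<open>p\<close> is in position 0 exactly if it lies strictly below
    \<open>0\<close>.\<close>
  have low: "block_pos B p = block_pos C p" if "p \<le> n" "block_pos B p \<le> 1"
    "is_sbp n B" "is_sbp n C" "sbp_preorder n B = sbp_preorder n C" for p B C
  proof -
    have z: "0 \<in> blk B 0 \<longleftrightarrow> 0 \<in> blk C 0"
      using zero_in_blk_0_iff[OF that(3)] zero_in_blk_0_iff[OF that(4)] that(5) by simp
    have less: "block_pos B p < block_pos B q \<longleftrightarrow> block_pos C p < block_pos C q" if "p \<le> n" "q \<le> n" for p q
      using sbp_preorder_less_iff[OF \<open>is_sbp n B\<close> that] sbp_preorder_less_iff[OF \<open>is_sbp n C\<close> that]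
        \<open>sbp_preorder n B = sbp_preorder n C\<close> by simp
    have len: "0 < length B" "0 < length C" "1 < length B" "1 < length C"
      using sbp_length[OF that(3)] sbp_length[OF that(4)] by auto
    show ?thesis
    proof (cases "0 \<in> blk B 0")
      case True
      then have "blk B 1 = {}" using that by (auto simp: is_sbp_def)
      then have "block_pos B p \<noteq> 1" using that blk_eq_block_pos[OF that(3) len(3)] by auto
      then have 0: "block_pos B p = 0" using that by auto
      have "block_pos B 0 = 0" "block_pos C 0 = 0"
        using True z len block_pos_eq that(3,4) by auto
      then have "\<not> block_pos C 0 < block_pos C p" using less[of 0 p] 0 that by simp
      then show ?thesis using 0 \<open>block_pos C 0 = 0\<close> by simp
    next
      case False
      then have 01: "block_pos B 0 = 1" "block_pos C 0 = 1"
        using z len block_pos_eq that(3,4) by (auto simp: is_sbp_def)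
      then show ?thesis using less[of 0 p] less[of p 0] that(1,2) by auto
    qed
  qed
  have "block_pos B p = j \<longleftrightarrow> block_pos C p = j" if "p \<le> n" for j p
    using that
  proof (induction j arbitrary: p rule: less_induct)
    case (less j)
    show ?case
    proof (cases "j \<le> 1")
      case True
      then show ?thesis using low[OF less.prems _ B C eq] low[OF less.prems _ C B eq[symmetric]] by auto
    next
      case False
      \<comment> \<open>Used in both directions. If \<open>C\<close> placed \<open>p\<close> beyond
        \<open>j\<close>, its nonempty block \<open>j\<close> would contain some \<open>q\<close>
        below \<open>p\<close>; then \<open>B\<close> places \<open>q\<close> before
        \<open>j\<close>, where both partitions already agree.\<close>
      have *: "block_pos C p = j"
        if H: "block_pos B p = j" "is_sbp n B" "is_sbp n C" "p \<le> n"
          "\<And>p q. p \<le> n \<Longrightarrow> q \<le> n \<Longrightarrow> block_pos B p < block_pos B q \<longleftrightarrow> block_pos C p < block_pos C q"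
          "\<And>i p. i < j \<Longrightarrow> p \<le> n \<Longrightarrow> block_pos B p = i \<longleftrightarrow> block_pos C p = i" for B C p
      proof (rule ccontr)
        assume ne: "block_pos C p \<noteq> j"
        have "\<not> block_pos C p < j" using H(6)[OF _ H(4), of "block_pos C p"] H(1) by auto
        then have gt: "j < block_pos C p" using ne by simp
        then have "j < length C" using block_pos(1)[OF H(3,4)] by simp
        then have "blk C j \<noteq> {}" using H(3) False by (auto simp: is_sbp_def)
        then obtain q where q: "q \<le> n" "block_pos C q = j"
          using blk_eq_block_pos[OF H(3) \<open>j < length C\<close>] by auto
        then have "block_pos B q < j" using H(5)[OF q(1) H(4)] gt H(1) by simp
        then show False using H(6)[of "block_pos B q" q] q by auto
      qed
      show ?thesis
        using *[OF _ B C less.prems] *[OF _ C B less.prems]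
          \<open>\<And>p q. p \<le> n \<Longrightarrow> q \<le> n \<Longrightarrow> (block_pos B p < block_pos B q) = (block_pos C p < block_pos C q)\<close>
          less.IH by blast
    qed
  qed
  then show ?thesis using p by blast
qed

text \<open>Labels without effect on the preorder are normalised: \<open>B\<^sub>-\<^sub>1\<close>,
  singletons and an empty \<open>B\<^sub>0\<close> are non-homogeneous. Any other label is visible
  on two distinct elements of the block.\<close>

lemma homog_iff_preorder:
  assumes B: "is_sbp n B" and j: "j < length B"
  shows "homog B j \<longleftrightarrow> 1 \<le> j \<and> (\<exists>p q. p \<noteq> q \<and> p \<in> blk B j \<and> q \<in> blk B j \<and> (p, q) \<in> sbp_preorder n B)"
proof
  assume h: "homog B j"
  then have "1 \<le> j" using B by (cases j) (auto simp: is_sbp_def)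
  moreover have "blk B j \<noteq> {}" using h B \<open>1 \<le> j\<close> j
    by (cases "j = 1") (auto simp: is_sbp_def)
  moreover have "card (blk B j) \<noteq> 1" using h B \<open>1 \<le> j\<close> j by (auto simp: is_sbp_def)
  ultimately obtain p q where pq: "p \<noteq> q" "p \<in> blk B j" "q \<in> blk B j"
    by (metis ex_in_conv is_singletonI' is_singleton_altdef)
  then have "(p, q) \<in> sbp_preorder n B"
    using h blk_eq_block_pos[OF B j]
    by (auto simp: sbp_preorder_block_pos[OF B] level_preorder_def)
  then show "1 \<le> j \<and> (\<exists>p q. p \<noteq> q \<and> p \<in> blk B j \<and> q \<in> blk B j \<and> (p, q) \<in> sbp_preorder n B)"
    using pq \<open>1 \<le> j\<close> by blast
next
  assume "1 \<le> j \<and> (\<exists>p q. p \<noteq> q \<and> p \<in> blk B j \<and> q \<in> blk B j \<and> (p, q) \<in> sbp_preorder n B)"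
  then show "homog B j"
    using blk_eq_block_pos[OF B j]
    by (auto simp: sbp_preorder_block_pos[OF B] level_preorder_def)
qed

lemma sbp_length_le:
  assumes B: "is_sbp n B" and C: "is_sbp n C" and eq: "\<And>p. p \<le> n \<Longrightarrow> block_pos B p = block_pos C p"
  shows "length B \<le> length C"
proof (cases "length B = 2")
  case True
  then show ?thesis using C by (auto simp: is_sbp_def)
next
  case False
  then have l: "2 \<le> length B - 1" "length B - 1 < length B" using B by (auto simp: is_sbp_def)
  then have "blk B (length B - 1) \<noteq> {}" using B unfolding is_sbp_def by blast
  then obtain p where "p \<le> n" "block_pos B p = length B - 1"
    using blk_eq_block_pos[OF B l(2)] by auto
  then show ?thesis using eq block_pos(1)[OF C, of p] by simp
qed

lemma sbp_preorder_inj: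
  assumes B: "is_sbp n B" and C: "is_sbp n C" and eq: "sbp_preorder n B = sbp_preorder n C"
  shows "B = C"
proof (rule nth_equalityI)
  have pos: "block_pos B p = block_pos C p" if "p \<le> n" for p
    using sbp_block_pos_cong assms that by blast
  then show len: "length B = length C"
    using sbp_length_le[OF B C] sbp_length_le[OF C B] by simp
  fix j assume j: "j < length B"
  then have "blk B j = blk C j"
    using pos len blk_eq_block_pos[OF B] blk_eq_block_pos[OF C] by auto
  moreover from this have "homog B j = homog C j"
    using homog_iff_preorder[OF B] homog_iff_preorder[OF C] j len eq by auto
  ultimately show "B ! j = C ! j"
    by (simp add: blk_def homog_def prod_eq_iff)
qed

text \<open>Two different block structures at the bottom: \<open>0\<close> shares an antichain with other
  elements (then this antichain is \<open>B\<^sub>-\<^sub>1\<close>), or its level set is the block \<open>B\<^sub>0\<close>.\<close>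

definition mk_sbp :: "nat \<Rightarrow> (nat \<Rightarrow> 'a::linorder) \<Rightarrow> ('a \<Rightarrow> bool) \<Rightarrow> sbp" where
  "mk_sbp n lvl h = (let c = (\<not> h (lvl 0) \<and> (\<exists>p\<in>{1..n}. lvl p = lvl 0)) in
     ({p. p \<le> n \<and> (lvl p < lvl 0 \<or> c \<and> lvl p = lvl 0)}, False) #
     ({p. p \<le> n \<and> \<not> c \<and> lvl p = lvl 0}, \<not> c \<and> h (lvl 0)) #
     map (\<lambda>t. ({p. p \<le> n \<and> lvl p = t}, h t)) (sorted_list_of_set {t \<in> lvl ` {0..n}. lvl 0 < t}))"

text \<open>The hypotheses are what the construction does not enforce by itself: homogeneous levels
  have two elements; below the level of \<open>0\<close> there is at most one level, an antichain,
  which becomes \<open>B\<^sub>-\<^sub>1\<close>; and if \<open>0\<close> shares an antichain level,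
  nothing lies below it, so that this level can become \<open>B\<^sub>-\<^sub>1\<close>
  instead.\<close>

lemma mk_sbp:
  fixes lvl :: "nat \<Rightarrow> 'a::linorder"
  assumes h1: "\<And>p. p \<le> n \<Longrightarrow> h (lvl p) \<Longrightarrow> \<exists>q\<le>n. q \<noteq> p \<and> lvl q = lvl p"
    and h2: "\<And>p. p \<le> n \<Longrightarrow> lvl p < lvl 0 \<Longrightarrow> \<not> h (lvl p)"
    and h3: "\<And>p q. p \<le> n \<Longrightarrow> q \<le> n \<Longrightarrow> lvl p < lvl 0 \<Longrightarrow> lvl q < lvl 0 \<Longrightarrow> lvl q = lvl p"
    and h4: "\<And>p q. \<not> h (lvl 0) \<Longrightarrow> p \<le> n \<Longrightarrow> p \<noteq> 0 \<Longrightarrow> lvl p = lvl 0 \<Longrightarrow> q \<le> n \<Longrightarrow> lvl 0 \<le> lvl q"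
  shows "is_sbp n (mk_sbp n lvl h)" "sbp_preorder n (mk_sbp n lvl h) = level_preorder n lvl h"
proof -
  define c where "c = (\<not> h (lvl 0) \<and> (\<exists>p\<in>{1..n}. lvl p = lvl 0))"
  define T where "T = {t \<in> lvl ` {0..n}. lvl 0 < t}"
  define ts where "ts = sorted_list_of_set T"
  define idx where "idx = inv_into {..<length ts} ((!) ts)"
  \<comment> \<open>The list position of an element: two slots are reserved for
    \<open>B\<^sub>-\<^sub>1\<close> and \<open>B\<^sub>0\<close>, and the levels above that of
    \<open>0\<close> follow in increasing order.\<close>
  define pp where "pp p = (if lvl p < lvl 0 \<or> c \<and> lvl p = lvl 0 then 0
    else if lvl p = lvl 0 then 1 else idx (lvl p) + 2)" for p
  let ?B = "mk_sbp n lvl h"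
  have B: "?B = ({p. p \<le> n \<and> (lvl p < lvl 0 \<or> c \<and> lvl p = lvl 0)}, False) #
     ({p. p \<le> n \<and> \<not> c \<and> lvl p = lvl 0}, \<not> c \<and> h (lvl 0)) #
     map (\<lambda>t. ({p. p \<le> n \<and> lvl p = t}, h t)) ts"
    unfolding mk_sbp_def Let_def c_def[symmetric] T_def[symmetric] ts_def[symmetric] ..
  have fT: "finite T" by (simp add: T_def)
  have ts: "set ts = T" "distinct ts" "sorted_wrt (<) ts"
    using fT by (auto simp: ts_def)
  have bij: "bij_betw ((!) ts) {..<length ts} T" using bij_betw_nth ts by blast
  have idx: "idx t < length ts" "ts ! idx t = t" if "t \<in> T" for t
    using bij that unfolding idx_def
    by (metis bij_betw_def inv_into_into lessThan_iff, metis bij_betw_def f_inv_into_f)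
  have idx_nth: "idx (ts ! i) = i" if "i < length ts" for i
    using bij that unfolding idx_def by (simp add: bij_betw_def inv_into_f_f)
  have idx_mono: "idx t < idx t'" if "t \<in> T" "t' \<in> T" "t < t'" for t t'
    using sorted_wrt_nth_less[OF ts(3), of "idx t'" "idx t"] idx that
    by (metis less_asym linorder_neqE_nat)
  have Tin: "lvl p \<in> T" if "p \<le> n" "lvl 0 < lvl p" for p using that by (auto simp: T_def)
  have len: "length ?B = length ts + 2" by (simp add: B)
  have pos: "pp p < length ?B" if "p \<le> n" for p
    using idx(1)[of "lvl p"] Tin[OF that] by (auto simp: pp_def len)
  have blk: "blk ?B j = {p. p \<le> n \<and> pp p = j}" if j: "j < length ?B" for j
  proof -
    consider "j = 0" | "j = 1" | i where "j = Suc (Suc i)"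
      by (metis One_nat_def not0_implies_Suc)
    then show ?thesis
    proof cases
      case 3
      then have i: "i < length ts" using j len by simp
      then have "ts ! i \<in> T" using ts(1) nth_mem by blast
      then have gt: "lvl 0 < ts ! i" by (simp add: T_def)
      have "lvl p = ts ! i \<longleftrightarrow> pp p = j" if p: "p \<le> n" for p
      proof
        assume p: "lvl p = ts ! i"
        then have "\<not> lvl p < lvl 0" "lvl p \<noteq> lvl 0" using gt by auto
        moreover have "idx (lvl p) = i" using idx_nth[OF i] p by simp
        ultimately show "pp p = j" using 3 by (simp add: pp_def)
      next
        assume a: "pp p = j"
        then have "lvl 0 < lvl p" "idx (lvl p) = i" using 3 by (auto simp: pp_def split: if_splits)
        then show "lvl p = ts ! i" using idx(2) Tin p by metis
      qed
      then show ?thesis using i by (auto simp: B blk_def 3)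
    qed (auto simp: B blk_def pp_def)
  qed
  \<comment> \<open>The first block never mixes two levels, because \<open>c\<close> excludes
    everything below the level of \<open>0\<close>.\<close>
  have low: "\<not> c" if "p \<le> n" "lvl p < lvl 0" for p
    using h4[of _ p] that unfolding c_def by fastforce
  have mono: "pp p < pp q" if "p \<le> n" "q \<le> n" "lvl p < lvl q" for p q
  proof (cases "lvl q" "lvl 0" rule: linorder_cases)
    case less
    then show ?thesis using h3[of p q] that order.strict_trans[OF that(3) less] by simp
  next
    case equal
    then show ?thesis using low[of p] that by (simp add: pp_def)
  next
    case greater
    then have "lvl q \<noteq> lvl 0" "\<not> lvl q < lvl 0" by auto
    moreover have "idx (lvl p) < idx (lvl q)" if "lvl 0 < lvl p"
      using idx_mono[of "lvl p" "lvl q"] Tin that \<open>p \<le> n\<close> \<open>q \<le> n\<close> greater \<open>lvl p < lvl q\<close> by blast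
    ultimately show ?thesis by (auto simp: pp_def)
  qed
  have pp_cong: "pp p = pp q" if "lvl p = lvl q" for p q using that by (simp add: pp_def)
  have hom: "homog ?B (pp p) \<longleftrightarrow> h (lvl p)" if p: "p \<le> n" for p
  proof (cases "lvl p" "lvl 0" rule: linorder_cases)
    case less
    then show ?thesis using h2[OF p] by (simp add: pp_def homog_def B)
  next
    case equal
    then show ?thesis by (auto simp: pp_def homog_def B c_def)
  next
    case greater
    then show ?thesis using idx[of "lvl p"] Tin[OF p] by (auto simp: pp_def homog_def B)
  qed
  have E: "sbp_preorder n ?B = level_preorder n pp (homog ?B)"
    by (rule sbp_preorder_eq_level) (use pos blk in auto)
  have "p \<le> n \<Longrightarrow> q \<le> n \<Longrightarrow> pp p < pp q \<longleftrightarrow> lvl p < lvl q" for p q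
    using mono mono[of q p] pp_cong[of p q] by (metis less_asym less_irrefl linorder_cases)
  moreover have "p \<le> n \<Longrightarrow> q \<le> n \<Longrightarrow> pp p = pp q \<longleftrightarrow> lvl p = lvl q" for p q
    using mono mono[of q p] pp_cong[of p q] by (metis less_irrefl linorder_cases)
  ultimately show "sbp_preorder n ?B = level_preorder n lvl h"
    unfolding E using hom by (auto simp: level_preorder_def)
  have b0: "blk ?B 0 = {p. p \<le> n \<and> pp p = 0}" and b1: "blk ?B 1 = {p. p \<le> n \<and> pp p = 1}"
    using blk len by auto
  have pp0: "pp 0 = (if c then 0 else 1)" by (simp add: pp_def)
  show "is_sbp n ?B"
    unfolding is_sbp_def
  proof (intro conjI allI impI)
    show "2 \<le> length ?B" by (simp add: len)
  next
    fix i j assume "i < length ?B" "j < length ?B" "i \<noteq> j"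
    then show "blk ?B i \<inter> blk ?B j = {}" using blk by auto
  next
    show "(\<Union>i<length ?B. blk ?B i) = {0..n}" using blk pos by auto
  next
    show "\<not> homog ?B 0" by (simp add: homog_def B)
  next
    assume 2: "2 \<le> card (blk ?B 1)"
    have nc: "\<not> c"
    proof
      assume c then have "blk ?B 1 = {}" unfolding b1 by (auto simp: pp_def)
      then show False using 2 by simp
    qed
    have "h (lvl 0)"
    proof (rule ccontr)
      assume "\<not> h (lvl 0)"
      have ne: "lvl p \<noteq> lvl 0" if "p \<le> n" "p \<noteq> 0" for p
      proof
        assume "lvl p = lvl 0"
        moreover have "p \<in> {1..n}" using that by auto
        ultimately have c unfolding c_def using \<open>\<not> h (lvl 0)\<close> by blast
        then show False using nc by blast
      qed
      have "p = 0" if "p \<in> blk ?B 1" for p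
      proof -
        have "p \<le> n" "pp p = 1" using that unfolding b1 by auto
        then have "lvl p = lvl 0" by (auto simp: pp_def split: if_splits)
        then show ?thesis using ne \<open>p \<le> n\<close> by blast
      qed
      then have "blk ?B 1 \<subseteq> {0}" by blast
      then have "card (blk ?B 1) \<le> card {0 :: nat}" by (intro card_mono) auto
      then show False using 2 by simp
    qed
    then show "homog ?B 1" using nc by (simp add: homog_def B)
  next
    show "0 \<in> blk ?B 0 \<union> blk ?B 1" unfolding b0 b1 by (simp add: pp0)
  next
    assume "0 \<in> blk ?B 0"
    then have c: c by (auto simp: b0 pp0 split: if_splits)
    then obtain p where "p \<in> {1..n}" "lvl p = lvl 0" by (auto simp: c_def)
    then have "{0, p} \<subseteq> blk ?B 0" "p \<noteq> 0" using c by (auto simp: b0 pp_def)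
    moreover have "finite (blk ?B 0)" by (simp add: b0)
    ultimately show "2 \<le> card (blk ?B 0)" by (metis card_2_iff card_mono)
    show "blk ?B 1 = {}" unfolding b1 using c by (auto simp: pp_def)
  next
    fix j assume j: "1 \<le> j \<and> j < length ?B \<and> card (blk ?B j) = 1"
    then obtain p where p: "blk ?B j = {p}" by (auto simp: card_1_singleton_iff)
    then have pj: "p \<le> n" "pp p = j" using blk[of j] j by blast+
    show "\<not> homog ?B j"
    proof
      assume "homog ?B j"
      then have "h (lvl p)" using hom pj by auto
      then obtain q where "q \<le> n" "q \<noteq> p" "lvl q = lvl p" using h1 pj by blast
      then have "pp q = j" using pp_cong[of q p] pj by simp
      then have "q \<in> blk ?B j" using blk[of j] j \<open>q \<le> n\<close> by simp
      then show False using p \<open>q \<noteq> p\<close> by simp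
    qed
  next
    fix j assume j: "2 \<le> j \<and> j < length ?B"
    then obtain i where i: "j = Suc (Suc i)" by (metis One_nat_def add_2_eq_Suc le_Suc_ex)
    then have "ts ! i \<in> T" using j len ts(1) nth_mem[of i ts] by simp
    then show "blk ?B j \<noteq> {}" using i j len by (auto simp: B blk_def T_def)
  next
    assume "blk ?B 1 = {}"
    then have "pp 0 \<noteq> 1" unfolding b1 by blast
    then have c unfolding pp0 by presburger
    then show "\<not> homog ?B 1" by (simp add: homog_def B)
  qed
qed

section \<open>Faces of the cone of an antichain-block partition\<close>

text \<open>For \<open>w\<close> in the cone of a preorder with positions \<open>a\<close> and only antichain blocks,
  the smallest face containing \<open>w\<close> glues together the elements whose \<open>w\<close>-value occurs
  in several blocks. Such a glued class sits right above what remains of its lowest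
  block.\<close>

definition glued :: "nat \<Rightarrow> (nat \<Rightarrow> nat) \<Rightarrow> (nat \<Rightarrow> real) \<Rightarrow> nat \<Rightarrow> bool" where
  "glued n a w p \<longleftrightarrow> (\<exists>q\<le>n. w q = w p \<and> a q \<noteq> a p)"

definition low_pos :: "nat \<Rightarrow> (nat \<Rightarrow> nat) \<Rightarrow> (nat \<Rightarrow> real) \<Rightarrow> nat \<Rightarrow> nat" where
  "low_pos n a w p = Min (a ` {q. q \<le> n \<and> w q = w p})"

text \<open>Doubling leaves a free slot after each block: \<open>2 * j\<close> is what remains of
  block \<open>j\<close>, and \<open>2 * j + 1\<close> is a glued class with lowest block
  \<open>j\<close>. Parity thus serves as the homogeneity label.\<close>

definition glue_level :: "nat \<Rightarrow> (nat \<Rightarrow> nat) \<Rightarrow> (nat \<Rightarrow> real) \<Rightarrow> nat \<Rightarrow> nat" where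
  "glue_level n a w p = (if glued n a w p then 2 * low_pos n a w p + 1 else 2 * a p)"

context
  fixes n :: nat and a :: "nat \<Rightarrow> nat" and w :: "nat \<Rightarrow> real"
  assumes mono: "p \<le> n \<Longrightarrow> q \<le> n \<Longrightarrow> a p < a q \<Longrightarrow> w p \<le> w q"
begin


lemma low_pos_le: "p \<le> n \<Longrightarrow> q \<le> n \<Longrightarrow> w q = w p \<Longrightarrow> low_pos n a w p \<le> a q"
  unfolding low_pos_def by (intro Min_le) auto

lemma low_pos_obtain:
  assumes "p \<le> n"
  obtains q where "q \<le> n" "w q = w p" "a q = low_pos n a w p"
proof -
  have "low_pos n a w p \<in> a ` {q. q \<le> n \<and> w q = w p}"
    unfolding low_pos_def using assms by (intro Min_in) auto
  then show ?thesis using that by auto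
qed

lemma glued_obtain:
  assumes "p \<le> n" "glued n a w p"
  obtains q where "q \<le> n" "w q = w p" "low_pos n a w p < a q"
proof -
  obtain q where q: "q \<le> n" "w q = w p" "a q \<noteq> a p" using assms by (auto simp: glued_def)
  then have "low_pos n a w p \<le> a q" "low_pos n a w p \<le> a p" using low_pos_le assms by auto
  then have "low_pos n a w p < a q \<or> low_pos n a w p < a p" using q by linarith
  then show ?thesis using that assms q by blast
qed

lemma gluedI: "p \<le> n \<Longrightarrow> q \<le> n \<Longrightarrow> w p = w q \<Longrightarrow> a p \<noteq> a q \<Longrightarrow> glued n a w p"
  by (auto simp: glued_def)

lemma glued_cong: "p \<le> n \<Longrightarrow> q \<le> n \<Longrightarrow> w p = w q \<Longrightarrow> glued n a w p \<Longrightarrow> glued n a w q"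
  unfolding glued_def by metis

lemma low_pos_cong: "w p = w q \<Longrightarrow> low_pos n a w p = low_pos n a w q"
  by (simp add: low_pos_def)

text \<open>A glued class also meets a block above its lowest one. If the larger value reached down
  to that lowest block, it would occur before a smaller value, against monotonicity. In particular,
  different glued classes have different odd levels.\<close>

lemma low_pos_less:
  assumes "p \<le> n" "q \<le> n" "glued n a w p" "w p < w q"
  shows "low_pos n a w p < low_pos n a w q"
proof -
  obtain x where x: "x \<le> n" "w x = w p" "low_pos n a w p < a x" using glued_obtain assms by blast
  obtain y where y: "y \<le> n" "w y = w q" "a y = low_pos n a w q" using low_pos_obtain assms by blast
  show ?thesis
  proof (rule ccontr)
    assume "\<not> low_pos n a w p < low_pos n a w q"
    then have "a y < a x" using x y by linarith
    then show False using mono[OF y(1) x(1)] x y assms by simp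
  qed
qed

lemma pos_le_low_pos:
  assumes "p \<le> n" "q \<le> n" "w p < w q"
  shows "a p \<le> low_pos n a w q"
proof -
  obtain y where y: "y \<le> n" "w y = w q" "a y = low_pos n a w q" using low_pos_obtain assms by blast
  then show ?thesis using mono[OF y(1) assms(1)] assms by force
qed

lemma glue_level_less:
  assumes "p \<le> n" "q \<le> n" "a p < a q" "w p < w q"
  shows "glue_level n a w p < glue_level n a w q"
  using low_pos_less[OF assms(1,2) _ assms(4)] pos_le_low_pos[OF assms(1,2,4)] low_pos_le[OF assms(1,1)] assms(3)
  by (auto simp: glue_level_def)

lemma glue_level_glued:
  assumes "p \<le> n" "q \<le> n" "a p \<noteq> a q" "w p = w q"
  shows "glue_level n a w p = glue_level n a w q" "odd (glue_level n a w p)"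
  using gluedI[of p q] gluedI[of q p] low_pos_cong[of p q] assms by (auto simp: glue_level_def)

lemma odd_glue_level_iff: "odd (glue_level n a w p) \<longleftrightarrow> glued n a w p"
  by (auto simp: glue_level_def)

lemma odd_glue_level_value:
  assumes "p \<le> n" "q \<le> n" "glue_level n a w p = glue_level n a w q" "odd (glue_level n a w p)"
  shows "w p = w q"
proof -
  have m: "glued n a w p" "glued n a w q" using assms odd_glue_level_iff[of p] odd_glue_level_iff[of q] by auto
  then have "low_pos n a w p = low_pos n a w q" using assms by (simp add: glue_level_def)
  then show ?thesis using low_pos_less[of p q] low_pos_less[of q p] m assms by (metis less_irrefl linorder_cases)
qed

text \<open>The level preorder is transitive, so one inclusion is a check of generators. For the
  other, elements of one block become comparable by a detour through another block: ascents belong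
  to \<open>R\<close>, and descents between equal values are reversed relations.\<close>

lemma closure_eq_level_preorder:
  defines "R \<equiv> level_preorder n a (\<lambda>_. False)"
  shows "(R \<union> tight w R)\<^sup>+ = level_preorder n (glue_level n a w) odd"
proof
  have "R \<union> tight w R \<subseteq> level_preorder n (glue_level n a w) odd"
  proof -
    have 1: "(p, q) \<in> level_preorder n (glue_level n a w) odd" if "p \<le> n" "q \<le> n" "a p < a q" for p q
      using glue_level_less[of p q] glue_level_glued[of p q] mono[of p q] that
      by (cases "w p = w q") (auto simp: level_preorder_def)
    have 2: "(q, p) \<in> level_preorder n (glue_level n a w) odd" if "p \<le> n" "q \<le> n" "a p < a q" "w p = w q" for p q
      using glue_level_glued[of p q] that by (auto simp: level_preorder_def)
    have 3: "(p, p) \<in> level_preorder n (glue_level n a w) odd" if "p \<le> n" for p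
      using that by (simp add: level_preorder_def)
    have "(p, q) \<in> level_preorder n (glue_level n a w) odd \<and> (w p = w q \<longrightarrow> (q, p) \<in> level_preorder n (glue_level n a w) odd)"
      if "(p, q) \<in> R" for p q
    proof -
      consider "p = q" "p \<le> n" | "p \<le> n" "q \<le> n" "a p < a q"
        using \<open>(p, q) \<in> R\<close> unfolding R_def level_preorder_def by blast
      then show ?thesis using 1 2 3 by cases blast+
    qed
    then show ?thesis unfolding tight_def by auto
  qed
  then show "(R \<union> tight w R)\<^sup>+ \<subseteq> level_preorder n (glue_level n a w) odd"
    by (rule trancl_least) (rule level_preorder(1))
next
  let ?C = "(R \<union> tight w R)\<^sup>+"
  have up: "(p, q) \<in> ?C" if "p \<le> n" "q \<le> n" "a p < a q" for p q
    using that by (auto simp: R_def level_preorder_def)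
  have down: "(p, q) \<in> ?C" if "p \<le> n" "q \<le> n" "a q < a p" "w p = w q" for p q
    using that by (auto simp: R_def level_preorder_def tight_def)
  have via: "(p, q) \<in> ?C" if "(p, x) \<in> ?C" "(x, q) \<in> ?C" for p q x
    using that by (rule trancl_trans)
  have less: "(p, q) \<in> ?C" if pq: "p \<le> n" "q \<le> n" "glue_level n a w p < glue_level n a w q" for p q
  proof (cases "a p" "a q" rule: linorder_cases)
    case less
    then show ?thesis using up pq by blast
  next
    case greater
    then have "w q < w p \<or> w q = w p" using mono[of q p] pq by force
    then show ?thesis using glue_level_less[of q p] glue_level_glued[of q p] greater pq by auto
  next
    \<comment> \<open>Within one block: if \<open>p\<close> is glued, its class meets a lower block,
      so one descends there and rises to \<open>q\<close>. Otherwise \<open>q\<close> is glued with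
      this block as its lowest one, so one rises to a higher member of its class and descends to
      \<open>q\<close>.\<close>
    case equal
    show ?thesis
    proof (cases "glued n a w p")
      case True
      have "low_pos n a w p < a p"
      proof (cases "glued n a w q")
        case True
        then show ?thesis using \<open>glued n a w p\<close> pq equal low_pos_le[of q q] by (simp add: glue_level_def)
      qed (use True pq equal in \<open>simp add: glue_level_def\<close>)
      moreover obtain y where y: "y \<le> n" "w y = w p" "a y = low_pos n a w p" using low_pos_obtain pq by blast
      ultimately show ?thesis using via[OF down[of p y] up[of y q]] pq equal by simp
    next
      case False
      then have "glued n a w q" using pq equal by (auto simp: glue_level_def split: if_splits)
      then obtain y where y: "y \<le> n" "w y = w q" "low_pos n a w q < a y" using glued_obtain pq by blast
      have "low_pos n a w q = a q" using low_pos_le[of q q] pq False \<open>glued n a w q\<close> equal by (simp add: glue_level_def)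
      then show ?thesis using via[OF up[of p y] down[of y q]] pq y equal by simp
    qed
  qed
  have glue: "(p, q) \<in> ?C" if pq: "p \<le> n" "q \<le> n" "glue_level n a w p = glue_level n a w q" "odd (glue_level n a w p)" for p q
  proof -
    have w: "w p = w q" using odd_glue_level_value pq by blast
    show ?thesis
    proof (cases "a p" "a q" rule: linorder_cases)
      case equal
      have "glued n a w p" using pq odd_glue_level_iff by blast
      then obtain y where y: "y \<le> n" "w y = w p" "a y \<noteq> a p" by (auto simp: glued_def)
      then show ?thesis
        using via[OF up[of p y] down[of y q]] via[OF down[of p y] up[of y q]] pq w equal
        by (metis linorder_neqE_nat)
    qed (use up down pq w in auto)
  qed
  show "level_preorder n (glue_level n a w) odd \<subseteq> ?C"
  proof clarify
    fix p q assume "(p, q) \<in> level_preorder n (glue_level n a w) odd"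
    moreover have "(p, p) \<in> ?C" if "p \<le> n" using that by (auto simp: R_def level_preorder_def)
    ultimately show "(p, q) \<in> ?C" using less glue by (auto simp: level_preorder_def)
  qed
qed

lemma ex_sbp_glued_closure:
  defines "R \<equiv> level_preorder n a (\<lambda>_. False)"
  assumes a01: "a 0 \<le> 1" and a1: "\<And>p. p \<le> n \<Longrightarrow> a p = 1 \<Longrightarrow> p = 0"
  shows "\<exists>B. is_sbp n B \<and> sbp_preorder n B = (R \<union> tight w R)\<^sup>+"
proof -
  \<comment> \<open>Other candidates are levels 1 and 2. Level 2 is the rest of block 1, where only
    \<open>0\<close> can be. A class of level 1 contains a member of block 0 and one that is
    \<open>0\<close> or lies beyond block 1; as \<open>0\<close> is in block 1, monotonicity
    squeezes it into the same class.\<close>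
  have low0: "glue_level n a w p = 0" if p: "p \<le> n" "glue_level n a w p < glue_level n a w 0" for p
  proof (rule ccontr)
    assume "glue_level n a w p \<noteq> 0"
    then have nz: "0 < glue_level n a w p" by simp
    have l0: "low_pos n a w 0 \<le> a 0" using low_pos_le by blast
    have a0: "a 0 = 1" and lp: "glue_level n a w p < 3" "glue_level n a w 0 \<le> 3"
      using nz p l0 a01 by (auto simp: glue_level_def split: if_splits)
    have "p \<noteq> 0" using p by (metis less_irrefl)
    have "glued n a w p"
    proof (rule ccontr)
      assume "\<not> glued n a w p"
      then have "a p = 1" using nz lp by (auto simp: glue_level_def)
      then show False using a1 p \<open>p \<noteq> 0\<close> by blast
    qed
    then have "low_pos n a w p = 0" using lp by (simp add: glue_level_def)
    then obtain x y where xy: "x \<le> n" "w x = w p" "a x = 0" "y \<le> n" "w y = w p" "0 < a y"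
      using low_pos_obtain[of p] glued_obtain[of p] \<open>glued n a w p\<close> p by metis
    have "a y > 1 \<or> y = 0" using a1 xy by fastforce
    then have "w 0 = w p" using mono[of x 0] mono[of 0 y] xy a0 by force
    then have "low_pos n a w 0 = 0" "glued n a w 0"
      using low_pos_cong[of 0 p] \<open>low_pos n a w p = 0\<close> glued_cong[of p 0] \<open>glued n a w p\<close> p by auto
    then show False using nz p \<open>glued n a w p\<close> \<open>low_pos n a w p = 0\<close> by (simp add: glue_level_def)
  qed
  have 1: "\<exists>q\<le>n. q \<noteq> p \<and> glue_level n a w q = glue_level n a w p" if "p \<le> n" "odd (glue_level n a w p)" for p
  proof -
    have "glued n a w p" using that odd_glue_level_iff by blast
    then obtain q where "q \<le> n" "w q = w p" "a q \<noteq> a p" by (auto simp: glued_def)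
    then show ?thesis using glue_level_glued[of q p] that by metis
  qed
  have 2: "\<not> odd (glue_level n a w p)" if "p \<le> n" "glue_level n a w p < glue_level n a w 0" for p using low0 that by fastforce
  have 3: "glue_level n a w q = glue_level n a w p" if "p \<le> n" "q \<le> n" "glue_level n a w p < glue_level n a w 0" "glue_level n a w q < glue_level n a w 0" for p q
    using low0[OF that(1,3)] low0[OF that(2,4)] by simp
  \<comment> \<open>An even level shared with \<open>0\<close> is the unglued part of one block.
    Block 1 holds nothing besides \<open>0\<close>, so this is block 0, whose level is the least
    possible.\<close>
  have 4: "glue_level n a w 0 \<le> glue_level n a w q" if "\<not> odd (glue_level n a w 0)" "p \<le> n" "p \<noteq> 0" "glue_level n a w p = glue_level n a w 0" "q \<le> n" for p q
  proof -
    have "\<not> glued n a w 0" "\<not> glued n a w p" using that odd_glue_level_iff[of 0] odd_glue_level_iff[of p] by auto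
    then have "a p = a 0" using that by (simp add: glue_level_def)
    then have "a 0 = 0" using a01 a1[of p] that by linarith
    then show ?thesis using \<open>\<not> glued n a w 0\<close> by (simp add: glue_level_def)
  qed
  have "is_sbp n (mk_sbp n (glue_level n a w) odd)" by (rule mk_sbp(1)) (fact 1 2 3 4)+
  moreover have "sbp_preorder n (mk_sbp n (glue_level n a w) odd) = level_preorder n (glue_level n a w) odd"
    by (rule mk_sbp(2)) (fact 1 2 3 4)+
  ultimately show ?thesis
    unfolding R_def closure_eq_level_preorder by blast
qed

end

section \<open>The types of the maximal partitions\<close>

text \<open>Run-length decoding, applied to the positive part of \<open>u\<close>: its zeros are
  split off first.\<close>

definition runs :: "nat list \<Rightarrow> 'a list \<Rightarrow> 'a list" where
  "runs ks ds = concat (map2 replicate ks ds)"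

lemma runs_Cons: "runs (k # ks) (x # ds) = replicate k x @ runs ks ds"
  by (simp add: runs_def)

lemma set_runs:
  assumes "length ks = length ds" "\<forall>k\<in>set ks. 0 < k"
  shows "set (runs ks ds) = set ds"
  using assms by (induction ks ds rule: list_induct2) (auto simp: runs_def)

lemma count_list_replicate: "count_list (replicate k x) y = (if x = y then k else 0)"
  by (induction k) auto

lemma count_list_runs:
  assumes "length ks = length ds" "distinct ds"
  shows "map (count_list (runs ks ds)) ds = ks"
  using assms
proof (induction ks ds rule: list_induct2)
  case (Cons k ks x ds)
  have "set (runs ks ds) \<subseteq> set ds"
    using Cons.hyps by (induction ks ds rule: list_induct2) (auto simp: runs_def)
  then have "x \<notin> set (runs ks ds)" using Cons.prems by auto
  then have "count_list (runs (k # ks) (x # ds)) x = k"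
    by (simp add: runs_Cons count_list_replicate)
  moreover have "map (count_list (runs (k # ks) (x # ds))) ds = map (count_list (runs ks ds)) ds"
    using Cons.prems by (auto simp: runs_Cons count_list_replicate)
  moreover have "map (count_list (runs ks ds)) ds = ks" using Cons by simp
  ultimately show ?case by (simp only: list.map)
qed (simp add: runs_def)

lemma length_runs: "length ks = length ds \<Longrightarrow> length (runs ks ds) = sum_list ks"
  by (induction ks ds rule: list_induct2) (auto simp: runs_def)

lemma drop_runs:
  assumes "length ks = length ds" "g < length ks" "sum_list (take g ks) \<le> i"
    "i \<le> sum_list (take (Suc g) ks)"
  shows "drop i (runs ks ds) = runs ((sum_list (take (Suc g) ks) - i) # drop (Suc g) ks) (drop g ds)"
  using assms
proof (induction ks ds arbitrary: g i rule: list_induct2)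
  case (Cons k ks x ds)
  show ?case
  proof (cases g)
    case 0
    then show ?thesis using Cons.prems by (auto simp: runs_def)
  next
    case (Suc g')
    then have "k \<le> i" using Cons.prems by simp
    then have "drop i (runs (k # ks) (x # ds)) = drop (i - k) (runs ks ds)"
      by (simp add: runs_def)
    also have "\<dots> = runs ((sum_list (take (Suc g') ks) - (i - k)) # drop (Suc g') ks) (drop g' ds)"
      using Cons.prems Suc \<open>k \<le> i\<close> by (intro Cons.IH) auto
    finally show ?thesis using Suc \<open>k \<le> i\<close> by (simp add: add.commute)
  qed
qed simp

lemma ex_run:
  assumes "i < sum_list (ks :: nat list)"
  shows "\<exists>g<length ks. sum_list (take g ks) \<le> i \<and> i < sum_list (take (Suc g) ks)"
  using assms
proof (induction ks arbitrary: i)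
  case (Cons k ks)
  show ?case
  proof (cases "i < k")
    case True
    then show ?thesis by (intro exI[of _ 0]) auto
  next
    case False
    then have "i - k < sum_list ks" using Cons.prems by simp
    then obtain g where "g < length ks" "sum_list (take g ks) \<le> i - k" "i - k < sum_list (take (Suc g) ks)"
      using Cons.IH[of "i - k"] by blast
    then show ?thesis using False by (intro exI[of _ "Suc g"]) auto
  qed
qed simp

lemma sum_nth_Cons:
  assumes "g \<le> length ks"
  shows "(\<Sum>j=1..g. (k # ks) ! j) = sum_list (take g (ks :: nat list))"
proof -
  have "(\<Sum>j=1..g. (k # ks) ! j) = (\<Sum>j=0..<g. ks ! j)"
    by (rule sum.reindex_bij_witness[of _ Suc "\<lambda>j. j - 1"]) (auto simp: nth_Cons')
  also have "\<dots> = sum_list (take g ks)"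
    using assms by (simp add: sum_list_sum_nth min_def)
  finally show ?thesis .
qed

definition value_counts :: "real list \<Rightarrow> nat list" where
  "value_counts v = map (count_list v) (sorted_list_of_set (set v))"

lemma value_counts_runs:
  assumes "length ks = length ds" "\<forall>k\<in>set ks. 0 < k" "sorted ds" "distinct ds"
  shows "value_counts (runs ks ds) = ks"
  unfolding value_counts_def set_runs[OF assms(1,2)]
  using assms count_list_runs by (simp add: sorted_list_of_set.idem_if_sorted_distinct)

text \<open>One formula for all members of \<open>\<Omega>\<^sub>m\<close>: for the type with index
  \<open>i\<close>, the first \<open>m\<^sub>0 + i\<close> entries of \<open>u\<close> are cut off,
  and the multiplicities of the others form the tail. The undecorated 0 occurs only at
  \<open>i = 0\<close>, when \<open>u\<close> has zeros.\<close>

definition omega_type :: "real list \<Rightarrow> nat \<Rightarrow> type_entry list" where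
  "omega_type u s = [Plain s, if 0 < s \<and> s = count_list u 0 then Plain 0 else Circ 0] @
     map Plain (value_counts (drop s u))"

text \<open>Cutting \<open>u\<close> inside a run of positive entries shortens this run and keeps
  the later ones, which is the shape of the intermediate types. Runs are counted from 1 in
  \<open>Omega\<close> and from 0 in \<open>drop_runs\<close>.\<close>

lemma Omega_eq:
  assumes u: "is_park_vec u"
  shows "Omega (multiplicity_vector u) = omega_type u ` {count_list u 0..length u}"
proof -
  define m0 ks ds where "m0 = count_list u 0" and "ks = map (count_list u) (data_vector u)"
    and "ds = data_vector u"
  have m: "multiplicity_vector u = m0 # ks"
    by (simp add: multiplicity_vector_def m0_def ks_def)
  have len: "length ks = length ds" by (simp add: ks_def ds_def)
  have ds: "sorted ds" "distinct ds" by (auto simp: ds_def data_vector_def)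
  have "u = vec_of_MD (m0 # ks) ds" using vec_of_MD_recovers[OF u] m by (simp add: ds_def)
  then have u_eq: "u = replicate m0 0 @ runs ks ds" by (simp add: vec_of_MD_def runs_def)
  have pos: "\<forall>k\<in>set ks. 0 < k"
    using count_list_0_iff[of u] by (fastforce simp: ks_def data_vector_def)
  obtain x where "x \<in> set u" "x \<noteq> 0" "0 \<le> x" using u by (auto simp: is_park_vec_def)
  then have "ds \<noteq> []" by (auto simp: ds_def data_vector_def)
  then obtain k where k: "k \<in> set ks" using len by (cases ks) auto
  have lu: "length u = m0 + sum_list ks" using length_runs[OF len] by (simp add: u_eq)
  have t0: "omega_type u m0 = [Plain m0, if 0 < m0 then Plain 0 else Circ 0] @ map Plain ks"
    using value_counts_runs[OF len pos ds] by (simp add: omega_type_def m0_def[symmetric]) (simp add: u_eq)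
  \<comment> \<open>As \<open>u\<close> is nonzero, some multiplicity is positive; hence the cut
    differs from \<open>m0\<close> and the second entry is \<open>Circ 0\<close>.\<close>
  have tr: "omega_type u (m0 + sum_list ks) = [Plain (m0 + sum_list ks), Circ 0]"
    using pos k by (auto simp: omega_type_def m0_def[symmetric] lu value_counts_def)
  have ti: "omega_type u (m0 + i) =
      [Plain (m0 + i), Circ 0, Plain (sum_list (take (Suc g) ks) - i)] @ map Plain (drop (Suc g) ks)"
    if "1 \<le> i" and g: "g < length ks" "sum_list (take g ks) \<le> i" "i < sum_list (take (Suc g) ks)" for i g
  proof -
    have "drop (m0 + i) u = drop i (runs ks ds)" by (simp add: u_eq)
    also have "\<dots> = runs ((sum_list (take (Suc g) ks) - i) # drop (Suc g) ks) (drop g ds)"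
      using drop_runs[OF len g(1,2)] g(3) by simp
    finally have "value_counts (drop (m0 + i) u) = (sum_list (take (Suc g) ks) - i) # drop (Suc g) ks"
      using g len ds pos
      by (simp del: drop_append, intro value_counts_runs)
        (auto dest: in_set_dropD intro: sorted_wrt_drop)
    then show ?thesis using \<open>1 \<le> i\<close> by (simp add: omega_type_def m0_def[symmetric])
  qed
  have O: "Omega (m0 # ks) =
     {omega_type u m0} \<union>
     {[Plain (m0 + i), Circ 0, Plain ((\<Sum>j=1..g. (m0 # ks) ! j) - i)] @ map Plain (drop g ks)
       | i g. 1 \<le> i \<and> i < sum_list ks \<and> 1 \<le> g \<and> g \<le> length ks \<and>
              (\<Sum>j=1..g-1. (m0 # ks) ! j) \<le> i \<and> i < (\<Sum>j=1..g. (m0 # ks) ! j)} \<union>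
     {omega_type u (m0 + sum_list ks)}" (is "_ = {_} \<union> ?M \<union> {_}")
    unfolding t0 tr Omega_def Let_def by (simp add: less_Suc_eq_le)
  have M: "?M = (\<lambda>i. omega_type u (m0 + i)) ` {1..<sum_list ks}"
  proof (intro equalityI subsetI)
    fix t assume "t \<in> ?M"
    then obtain i g where t: "t = [Plain (m0 + i), Circ 0, Plain ((\<Sum>j=1..g. (m0 # ks) ! j) - i)] @
        map Plain (drop g ks)" and i: "1 \<le> i" "i < sum_list ks" and g: "1 \<le> g" "g \<le> length ks"
      "(\<Sum>j=1..g-1. (m0 # ks) ! j) \<le> i" "i < (\<Sum>j=1..g. (m0 # ks) ! j)" by blast
    obtain g' where g': "g = Suc g'" using g by (cases g) auto
    have "(\<Sum>j=1..g'. (m0 # ks) ! j) = sum_list (take g' ks)"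
      "(\<Sum>j=1..Suc g'. (m0 # ks) ! j) = sum_list (take (Suc g') ks)"
      using g g' by (intro sum_nth_Cons; simp)+
    then have "t = omega_type u (m0 + i)" using ti[OF i(1), of g'] t g unfolding g' by simp
    then show "t \<in> (\<lambda>i. omega_type u (m0 + i)) ` {1..<sum_list ks}" using i by auto
  next
    fix t assume "t \<in> (\<lambda>i. omega_type u (m0 + i)) ` {1..<sum_list ks}"
    then obtain i where i: "1 \<le> i" "i < sum_list ks" "t = omega_type u (m0 + i)" by auto
    then obtain g where g: "g < length ks" "sum_list (take g ks) \<le> i" "i < sum_list (take (Suc g) ks)"
      using ex_run by blast
    have s: "(\<Sum>j=1..g. (m0 # ks) ! j) = sum_list (take g ks)"
      "(\<Sum>j=1..Suc g. (m0 # ks) ! j) = sum_list (take (Suc g) ks)"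
      using g by (intro sum_nth_Cons; simp)+
    then have "t = [Plain (m0 + i), Circ 0, Plain ((\<Sum>j=1..Suc g. (m0 # ks) ! j) - i)] @
        map Plain (drop (Suc g) ks)"
      using ti[OF i(1) g] i(3) by simp
    then show "t \<in> ?M" using i g s by (intro CollectI exI[of _ i] exI[of _ "Suc g"]) simp
  qed
  have "{count_list u 0..length u} = {m0} \<union> (\<lambda>i. m0 + i) ` {1..<sum_list ks} \<union> {m0 + sum_list ks}"
  proof (intro equalityI subsetI)
    fix s assume "s \<in> {count_list u 0..length u}"
    then have "s = m0 \<or> s = m0 + sum_list ks \<or> (s = m0 + (s - m0) \<and> s - m0 \<in> {1..<sum_list ks})"
      by (auto simp: lu m0_def[symmetric])
    then show "s \<in> {m0} \<union> (\<lambda>i. m0 + i) ` {1..<sum_list ks} \<union> {m0 + sum_list ks}" by blast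
  qed (auto simp: lu m0_def[symmetric])
  then show ?thesis unfolding m O M by (simp only: image_Un image_image image_insert image_empty)
qed

section \<open>Parking functions and rearrangement\<close>

text \<open>Redirecting \<open>f\<close> so that it fixes the last index does not decrease the sum,
  as the change is a product of two nonnegative differences. What remains is the shorter
  case.\<close>

lemma rearrangement:
  fixes x y :: "nat \<Rightarrow> real"
  assumes "\<And>i j. i \<le> j \<Longrightarrow> j < n \<Longrightarrow> x i \<le> x j" "\<And>i j. i \<le> j \<Longrightarrow> j < n \<Longrightarrow> y i \<le> y j"
    and "bij_betw f {..<n} {..<n}"
  shows "(\<Sum>k<n. x k * y (f k)) \<le> (\<Sum>k<n. x k * y k)"
  using assms
proof (induction n arbitrary: f)
  case (Suc n)
  define f' where "f' = Transposition.transpose (f n) n \<circ> f"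
  have fn: "f n < Suc n" using Suc.prems(3) by (auto simp: bij_betw_def)
  have bij': "bij_betw f' {..<Suc n} {..<Suc n}"
    unfolding f'_def
  proof (rule bij_betw_trans[OF Suc.prems(3)])
    show "bij_betw (Transposition.transpose (f n) n) {..<Suc n} {..<Suc n}"
      using fn permutes_swap_id[of "f n" "{..<Suc n}" n] permutes_imp_bij by blast
  qed
  have f'n: "f' n = n" by (simp add: f'_def)
  have bijn: "bij_betw f' {..<n} {..<n}"
    using bij_betw_DiffI[OF bij', of "{n}" "{n}"] f'n by (simp add: lessThan_Suc bij_betw_def)
  have IH: "(\<Sum>k<n. x k * y (f' k)) \<le> (\<Sum>k<n. x k * y k)"
    using Suc.prems by (intro Suc.IH bijn) auto
  have "(\<Sum>k<Suc n. x k * y (f k)) \<le> (\<Sum>k<Suc n. x k * y (f' k))"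
  proof (cases "f n = n")
    case False
    obtain j where j: "j < Suc n" "f j = n"
      using Suc.prems(3) by (metis bij_betw_def f_the_inv_into_f lessI lessThan_iff the_inv_into_into subset_refl)
    then have jn: "j < n" using False by (metis less_antisym)
    have inj: "inj_on f {..<Suc n}" using Suc.prems(3) by (simp add: bij_betw_def)
    have eq: "f' k = f k" if "k < n" "k \<noteq> j" for k
    proof -
      have "f k \<noteq> f n" "f k \<noteq> f j" using inj that jn by (auto dest!: inj_onD)
      then show ?thesis using j by (simp add: f'_def)
    qed
    have f'j: "f' j = f n" using j by (simp add: f'_def)
    have "(\<Sum>k\<in>{..<n}-{j}. x k * y (f k)) = (\<Sum>k\<in>{..<n}-{j}. x k * y (f' k))"
      using eq by (intro sum.cong) auto
    moreover have "x j \<le> x n" "y (f n) \<le> y n" using Suc.prems(1)[of j n] Suc.prems(2)[of "f n" n] jn fn by auto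
    then have "0 \<le> (x n - x j) * (y n - y (f n))" by simp
    then have "x j * y n + x n * y (f n) \<le> x j * y (f n) + x n * y n" by (simp add: algebra_simps)
    ultimately show ?thesis
      using jn j(2) f'j f'n by (simp add: sum.remove[of "{..<n}" j])
  next
    case True
    then show ?thesis by (simp add: f'_def)
  qed
  then show ?case using IH f'n by simp
qed simp

text \<open>A maximal element takes the last position. The order may be partial, so coordinates can
  be sorted by weight or by block with ties left open.\<close>

lemma linear_extension:
  assumes "finite X" "\<And>p. \<not> r p p" "\<And>p q t. r p q \<Longrightarrow> r q t \<Longrightarrow> r p t"
  shows "\<exists>\<sigma>. bij_betw \<sigma> X {..<card X} \<and> (\<forall>p\<in>X. \<forall>q\<in>X. r p q \<longrightarrow> \<sigma> p < (\<sigma> q :: nat))"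
  using assms(1)
proof (induction "card X" arbitrary: X)
  case 0
  then show ?case by (simp add: bij_betw_def)
next
  case (Suc k)
  have "\<exists>t\<in>X. \<forall>q\<in>X. \<not> r t q"
  proof (rule ccontr)
    assume none: "\<not> (\<exists>t\<in>X. \<forall>q\<in>X. \<not> r t q)"
    have "wf {(q, p). p \<in> X \<and> q \<in> X \<and> r p q}"
    proof (rule finite_acyclic_wf)
      show "finite {(q, p). p \<in> X \<and> q \<in> X \<and> r p q}"
        by (rule finite_subset[of _ "X \<times> X"]) (use Suc.prems in auto)
      have "trans {(q, p). p \<in> X \<and> q \<in> X \<and> r p q}" using assms(3) by (auto simp: trans_def)
      then show "acyclic {(q, p). p \<in> X \<and> q \<in> X \<and> r p q}" using assms(2) by (simp add: acyclic_def)
    qed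
    moreover obtain x where "x \<in> X" using Suc.hyps(2) by fastforce
    ultimately show False using none by (metis (mono_tags, lifting) case_prodI mem_Collect_eq wfE_min)
  qed
  then obtain t where t: "t \<in> X" "\<And>q. q \<in> X \<Longrightarrow> \<not> r t q" by blast
  have cX: "card (X - {t}) = k" using Suc.hyps(2) t Suc.prems by simp
  then obtain \<sigma> where \<sigma>: "bij_betw \<sigma> (X - {t}) {..<k}"
    "\<forall>p\<in>X - {t}. \<forall>q\<in>X - {t}. r p q \<longrightarrow> \<sigma> p < \<sigma> q"
    using Suc.hyps(1)[of "X - {t}"] Suc.prems by auto
  let ?\<sigma> = "\<sigma>(t := k)"
  have "bij_betw ?\<sigma> (X - {t}) {..<k}" using \<sigma>(1) by (subst bij_betw_cong[of _ _ \<sigma>]) auto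
  moreover have "bij_betw ?\<sigma> {t} {k}" by (simp add: bij_betw_def)
  ultimately have "bij_betw ?\<sigma> ((X - {t}) \<union> {t}) ({..<k} \<union> {k})"
    by (rule bij_betw_combine) simp
  then have "bij_betw ?\<sigma> X {..<card X}"
    using t by (simp add: insert_absorb lessThan_Suc flip: Suc.hyps(2))
  moreover have "?\<sigma> p < ?\<sigma> q" if "p \<in> X" "q \<in> X" "r p q" for p q
    using that t \<sigma> by (auto simp: bij_betw_def)
  ultimately show ?case by blast
qed

section \<open>Parking functions as vectors dominated by rearrangements\<close>

lemma mset_eq_imp_bij:
  assumes "mset xs = mset ys" "length ys = n"
  shows "\<exists>f. bij_betw f {..<n} {..<n} \<and> (\<forall>i<n. xs ! i = ys ! f i)"
proof -
  obtain p where "p permutes {..<length ys}" "permute_list p ys = xs"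
    using mset_eq_permutation[OF assms(1)] .
  then show ?thesis using assms(2) by (metis permute_list_nth permutes_imp_bij)
qed

text \<open>A bijection into the entries of \<open>u\<close> replaces sorting, since it can be
  transposed and fed into the rearrangement inequality. That any such assignment may be replaced by
  the sorted one is a pigeonhole argument.\<close>

lemma parking_function_iff:
  fixes e :: "nat \<Rightarrow> 'n::finite"
  assumes u: "sorted u" and n: "length u = n"
  shows "parking_function e u a \<longleftrightarrow>
    (\<forall>i\<in>{1..n}. 0 \<le> coord e a i) \<and>
    (\<exists>\<sigma>. bij_betw \<sigma> {1..n} {..<n} \<and> (\<forall>i\<in>{1..n}. coord e a i \<le> u ! \<sigma> i))"
proof -
  define xs where "xs = map (\<lambda>i. a $ e i) [1..<Suc n]"
  have lx: "length xs = n" by (simp add: xs_def)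
  have nx: "xs ! i = coord e a (Suc i)" if "i < n" for i
    using that by (simp add: xs_def coord_def nth_append del: upt_Suc)
  have shift: "bij_betw Suc {..<n} {1..n}"
    by (rule bij_betw_byWitness[of _ "\<lambda>i. i - 1"]) auto
  have shift': "bij_betw (\<lambda>i. i - 1) {1..n} {..<n}"
    by (rule bij_betw_byWitness[of _ Suc]) auto
  have "(\<forall>i<n. sort xs ! i \<le> u ! i) \<longleftrightarrow>
     (\<exists>\<sigma>. bij_betw \<sigma> {1..n} {..<n} \<and> (\<forall>i\<in>{1..n}. coord e a i \<le> u ! \<sigma> i))"
  proof
    assume l: "\<forall>i<n. sort xs ! i \<le> u ! i"
    have "mset xs = mset (sort xs)" by simp
    then obtain f where f: "bij_betw f {..<n} {..<n}" "\<forall>i<n. xs ! i = sort xs ! f i"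
      using mset_eq_imp_bij[of xs "sort xs"] lx by auto
    have "bij_betw (f \<circ> (\<lambda>i. i - 1)) {1..n} {..<n}"
      using bij_betw_trans[OF shift' f(1)] .
    moreover have "coord e a i \<le> u ! (f \<circ> (\<lambda>i. i - 1)) i" if "i \<in> {1..n}" for i
    proof -
      have i: "i - 1 < n" "Suc (i - 1) = i" using that by auto
      then have "f (i - 1) < n" using f(1) by (auto simp: bij_betw_def)
      then have "sort xs ! f (i - 1) \<le> u ! f (i - 1)" using l by blast
      then show ?thesis using f(2) i nx[OF i(1)] by auto
    qed
    ultimately show "\<exists>\<sigma>. bij_betw \<sigma> {1..n} {..<n} \<and> (\<forall>i\<in>{1..n}. coord e a i \<le> u ! \<sigma> i)" by blast
  next
    assume "\<exists>\<sigma>. bij_betw \<sigma> {1..n} {..<n} \<and> (\<forall>i\<in>{1..n}. coord e a i \<le> u ! \<sigma> i)"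
    then obtain \<sigma> where \<sigma>: "bij_betw \<sigma> {1..n} {..<n}" "\<forall>i\<in>{1..n}. coord e a i \<le> u ! \<sigma> i" by blast
    have "mset (sort xs) = mset xs" by simp
    then obtain f where f: "bij_betw f {..<n} {..<n}" "\<forall>i<n. sort xs ! i = xs ! f i"
      using mset_eq_imp_bij[of "sort xs" xs] lx by auto
    let ?g = "\<sigma> \<circ> (Suc \<circ> f)"
    have g: "bij_betw ?g {..<n} {..<n}"
      using bij_betw_trans[OF bij_betw_trans[OF f(1) shift] \<sigma>(1)] .
    have le: "sort xs ! j \<le> u ! ?g j" if "j < n" for j
    proof -
      have "f j < n" using f(1) that by (auto simp: bij_betw_def)
      then have "xs ! f j \<le> u ! \<sigma> (Suc (f j))" using \<sigma>(2) nx by simp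
      then show ?thesis using f(2) that by simp
    qed
    show "\<forall>i<n. sort xs ! i \<le> u ! i"
    proof (intro allI impI, rule ccontr)
      fix i assume i: "i < n" "\<not> sort xs ! i \<le> u ! i"
      \<comment> \<open>If the sorted entry \<open>i\<close> exceeds its bound, all entries from
        \<open>i\<close> on need bounds at indices beyond \<open>i\<close>: \<open>n - i\<close>
        entries for \<open>n - i - 1\<close> places.\<close>
      have "i < ?g j" if "j \<in> {i..<n}" for j
      proof (rule ccontr)
        assume "\<not> i < ?g j"
        then have "u ! ?g j \<le> u ! i" using i u n by (intro sorted_nth_mono) auto
        moreover have "sort xs ! i \<le> sort xs ! j" using that lx by (intro sorted_nth_mono) auto
        moreover have "sort xs ! j \<le> u ! ?g j" using le that by simp
        ultimately show False using i(2) by linarith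
      qed
      moreover have "?g j < n" if "j \<in> {i..<n}" for j using g that by (auto simp: bij_betw_def)
      ultimately have "?g ` {i..<n} \<subseteq> {i<..<n}" by (intro image_subsetI) simp
      moreover have "inj_on ?g {i..<n}" using g by (auto simp: bij_betw_def intro: inj_on_subset)
      ultimately have "card {i..<n} \<le> card {i<..<n}" by (metis card_inj_on_le finite_greaterThanLessThan)
      then show False using i by simp
    qed
  qed
  moreover have "(\<forall>i\<in>{1..n}. 0 \<le> a $ e i) \<longleftrightarrow> (\<forall>i\<in>{1..n}. 0 \<le> coord e a i)"
    by (auto simp: coord_def)
  ultimately show ?thesis
    unfolding parking_function_def Let_def n xs_def[symmetric] by blast
qed

lemma polytope_convex_hull_Union:
  assumes "finite \<B>" "\<And>B. B \<in> \<B> \<Longrightarrow> polytope B"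
  shows "polytope (convex hull (\<Union>\<B>))"
proof -
  have "\<exists>V. finite V \<and> B = convex hull V" if "B \<in> \<B>" for B
    using assms(2)[OF that] by (auto simp: polytope_def)
  then obtain V where V: "\<And>B. B \<in> \<B> \<Longrightarrow> finite (V B) \<and> B = convex hull (V B)" by metis
  have "B \<subseteq> convex hull (\<Union>(V ` \<B>))" if "B \<in> \<B>" for B
    using V[OF that] that by (metis UN_upper hull_mono)
  then have "convex hull (\<Union>\<B>) \<subseteq> convex hull (\<Union>(V ` \<B>))"
    by (intro hull_minimal convex_convex_hull) auto
  moreover have "V B \<subseteq> B" if "B \<in> \<B>" for B using V[OF that] hull_subset by metis
  then have "convex hull (\<Union>(V ` \<B>)) \<subseteq> convex hull (\<Union>\<B>)"
    by (intro hull_mono) auto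
  ultimately have "convex hull (\<Union>\<B>) = convex hull (\<Union>(V ` \<B>))" by blast
  then show ?thesis unfolding polytope_def using assms(1) V by (metis finite_UN)
qed

text \<open>The set of parking functions is infinite in general, but it is a finite union of boxes
  spanned by the origin and the rearrangements of \<open>u\<close>.\<close>

lemma polytope_PF:
  fixes e :: "nat \<Rightarrow> 'n::finite"
  assumes u: "sorted u" and e: "bij_betw e {1..length u} UNIV"
  shows "polytope (PF e u)"
proof -
  let ?n = "length u"
  define Y :: "(real ^ 'n) set" where
    "Y = {y. \<exists>\<sigma>. bij_betw \<sigma> {1..?n} {..<?n} \<and> (\<forall>i\<in>{1..?n}. coord e y i = u ! \<sigma> i)}"
  have surj: "\<exists>i\<in>{1..?n}. e i = k" for k
    using e by (metis UNIV_I bij_betw_def imageE)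
  have "Y \<subseteq> vec_lambda ` (PiE UNIV (\<lambda>_. set u))"
  proof
    fix y assume "y \<in> Y"
    then obtain \<sigma> where \<sigma>: "bij_betw \<sigma> {1..?n} {..<?n}" "\<forall>i\<in>{1..?n}. coord e y i = u ! \<sigma> i"
      by (auto simp: Y_def)
    have "y $ k \<in> set u" for k
    proof -
      obtain i where i: "i \<in> {1..?n}" "e i = k" using surj by blast
      then have "y $ k = u ! \<sigma> i" using \<sigma>(2) by (auto simp: coord_def)
      moreover have "\<sigma> i < ?n" using \<sigma>(1) i by (auto simp: bij_betw_def)
      ultimately show ?thesis by simp
    qed
    then have "vec_nth y \<in> PiE UNIV (\<lambda>_. set u)" by auto
    then show "y \<in> vec_lambda ` (PiE UNIV (\<lambda>_. set u))" by (metis image_eqI vec_nth_inverse)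
  qed
  then have "finite Y" by (rule finite_subset) (intro finite_imageI finite_PiE; simp)
  have "{a. parking_function e u a} = \<Union>(cbox 0 ` Y)"
  proof (intro equalityI subsetI)
    fix a assume "a \<in> {a. parking_function e u a}"
    then have "parking_function e u a" by simp
    then obtain \<sigma> where \<sigma>: "\<forall>i\<in>{1..?n}. 0 \<le> coord e a i" "bij_betw \<sigma> {1..?n} {..<?n}"
      "\<forall>i\<in>{1..?n}. coord e a i \<le> u ! \<sigma> i"
      unfolding parking_function_iff[OF u refl] by blast
    let ?y = "vec_of ?n e (\<lambda>i. u ! \<sigma> i)"
    have y: "coord e ?y i = u ! \<sigma> i" if "i \<in> {1..?n}" for i using coord_vec_of[OF e that] .
    then have "?y \<in> Y" using \<sigma> by (auto simp: Y_def)
    moreover have "0 \<le> a $ k \<and> a $ k \<le> ?y $ k" for k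
    proof -
      obtain i where i: "i \<in> {1..?n}" "e i = k" using surj by blast
      then have "0 \<le> coord e a i" "coord e a i \<le> coord e ?y i" using \<sigma> y by auto
      then show ?thesis using i by (auto simp: coord_def)
    qed
    then have "a \<in> cbox 0 ?y" by (simp add: mem_box_cart)
    ultimately show "a \<in> \<Union>(cbox 0 ` Y)" by blast
  next
    fix a assume "a \<in> \<Union>(cbox 0 ` Y)"
    then obtain y where "y \<in> Y" and a: "a \<in> cbox 0 y" by blast
    then obtain \<sigma> where \<sigma>: "bij_betw \<sigma> {1..?n} {..<?n}" "\<forall>i\<in>{1..?n}. coord e y i = u ! \<sigma> i"
      by (auto simp: Y_def)
    have "0 \<le> coord e a i" "coord e a i \<le> coord e y i" for i
      using a by (auto simp: mem_box_cart coord_def)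
    then show "a \<in> {a. parking_function e u a}"
      using parking_function_iff[OF u refl] \<sigma> by (metis mem_Collect_eq)
  qed
  moreover have "polytope (convex hull (\<Union>(cbox 0 ` Y)))"
    using \<open>finite Y\<close> polytope_interval by (intro polytope_convex_hull_Union) auto
  ultimately show ?thesis by (simp add: PF_def)
qed

lemma inner_eq_sum_coord:
  assumes "bij_betw e {1..n} UNIV"
  shows "c \<bullet> y = (\<Sum>i\<in>{1..n}. coord e c i * coord e y i)"
proof -
  have "c \<bullet> y = (\<Sum>k\<in>UNIV. c $ k * y $ k)" by (simp add: inner_vec_def)
  also have "\<dots> = (\<Sum>i\<in>{1..n}. c $ e i * y $ e i)"
    using sum.reindex_bij_betw[OF assms, of "\<lambda>k. c $ k * y $ k"] by simp
  finally show ?thesis by (simp add: coord_def)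
qed

text \<open>The inverse of \<open>\<sigma>\<close> lists \<open>X\<close> with nondecreasing
  \<open>f\<close>; reindexing by it turns both sums into those of the rearrangement
  inequality.\<close>

lemma rearrangement_bij:
  fixes f :: "nat \<Rightarrow> real"
  assumes u: "sorted u" "length u = n"
    and \<sigma>: "bij_betw \<sigma> X {..<n}" and \<tau>: "bij_betw \<tau> X {..<n}"
    and mono: "\<And>p q. p \<in> X \<Longrightarrow> q \<in> X \<Longrightarrow> \<sigma> p < \<sigma> q \<Longrightarrow> f p \<le> f q"
  shows "(\<Sum>p\<in>X. f p * u ! \<tau> p) \<le> (\<Sum>p\<in>X. f p * u ! \<sigma> p)"
proof -
  define g where "g = inv_into X \<sigma>"
  have g: "bij_betw g {..<n} X" using \<sigma> unfolding g_def by (rule bij_betw_inv_into)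
  have \<sigma>g: "\<sigma> (g k) = k" if "k < n" for k
    using \<sigma> that unfolding g_def by (auto simp: bij_betw_def intro: f_inv_into_f)
  have gX: "g k \<in> X" if "k < n" for k using g that by (auto simp: bij_betw_def)
  have "(\<Sum>p\<in>X. f p * u ! \<tau> p) = (\<Sum>k<n. f (g k) * u ! ((\<tau> \<circ> g) k))"
    using sum.reindex_bij_betw[OF g, of "\<lambda>p. f p * u ! \<tau> p"] by simp
  also have "\<dots> \<le> (\<Sum>k<n. f (g k) * u ! k)"
  proof (rule rearrangement)
    show "bij_betw (\<tau> \<circ> g) {..<n} {..<n}" using bij_betw_trans[OF g \<tau>] .
    show "u ! i \<le> u ! j" if "i \<le> j" "j < n" for i j using that u by (intro sorted_nth_mono) auto
    show "f (g i) \<le> f (g j)" if "i \<le> j" "j < n" for i j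
      using mono[of "g i" "g j"] gX \<sigma>g that by (cases "i = j") auto
  qed
  also have "\<dots> = (\<Sum>k<n. f (g k) * u ! \<sigma> (g k))" using \<sigma>g by (intro sum.cong) auto
  also have "\<dots> = (\<Sum>p\<in>X. f p * u ! \<sigma> p)"
    using sum.reindex_bij_betw[OF g, of "\<lambda>p. f p * u ! \<sigma> p"] .
  finally show ?thesis .
qed

section \<open>The vertex belonging to a maximal partition\<close>

lemma park_vec_split:
  assumes "sorted u" "\<forall>x\<in>set u. 0 \<le> x"
  shows "\<exists>r. u = replicate (count_list u 0) (0 :: real) @ r \<and> (\<forall>x\<in>set r. 0 < x)"
  using assms
proof (induction u)
  case (Cons x u)
  show ?case
  proof (cases "x = 0")
    case True
    then show ?thesis using Cons by auto
  next
    case False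
    then have "\<forall>y\<in>set (x # u). 0 < y" using Cons.prems by force
    then have "count_list (x # u) 0 = 0" using count_list_0_iff by (metis less_irrefl)
    then show ?thesis using \<open>\<forall>y\<in>set (x # u). 0 < y\<close> by simp
  qed
qed simp

lemma park_vec_nth:
  assumes "is_park_vec u" "k < length u"
  shows "u ! k = 0 \<longleftrightarrow> k < count_list u 0" "0 \<le> u ! k"
proof -
  have su: "sorted u" "\<forall>x\<in>set u. 0 \<le> x" using assms(1) by (auto simp: is_park_vec_def)
  then show "0 \<le> u ! k" using assms(2) by simp
  obtain r where r: "u = replicate (count_list u 0) 0 @ r" "\<forall>x\<in>set r. 0 < x"
    using park_vec_split[OF su] by blast
  define m where "m = count_list u 0"
  have um: "u = replicate m 0 @ r" using r(1) by (simp add: m_def)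
  have "u ! k = 0 \<longleftrightarrow> k < m"
  proof (cases "k < m")
    case False
    then have "r ! (k - m) \<in> set r" using assms(2) um by (intro nth_mem) auto
    then have "0 < r ! (k - m)" using r(2) by blast
    moreover have "u ! k = r ! (k - m)" using False by (subst um) (simp add: nth_append)
    ultimately show ?thesis using False by simp
  qed (subst um, simp add: nth_append)
  then show "u ! k = 0 \<longleftrightarrow> k < count_list u 0" by (simp add: m_def)
qed

lemma count_mset_nth: "count (mset xs) x = card {k. k < length xs \<and> xs ! k = x}"
  by (auto simp: count_mset count_list_eq_length_filter length_filter_conv_card intro!: arg_cong[of _ _ card])

lemma is_sbp_facts:
  assumes "is_sbp n B"
  shows "\<not> homog B 0" "0 \<in> blk B 0 \<or> 0 \<in> blk B 1" "0 \<in> blk B 0 \<Longrightarrow> blk B 1 = {}"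
    "1 \<le> j \<Longrightarrow> j < length B \<Longrightarrow> card (blk B j) = 1 \<Longrightarrow> \<not> homog B j"
    "blk B 1 = {} \<Longrightarrow> \<not> homog B 1"
  using assms unfolding is_sbp_def by blast+

lemma parking_in_PF:
  assumes "is_park_vec u" "length u = n" "bij_betw \<sigma> {1..n} {..<n}"
    "\<And>i. i \<in> {1..n} \<Longrightarrow> 0 \<le> coord e y i \<and> coord e y i \<le> u ! \<sigma> i"
  shows "y \<in> PF e u"
proof -
  have "sorted u" using assms(1) by (simp add: is_park_vec_def)
  then have "parking_function e u y" using parking_function_iff[of u n e y] assms(2-) by blast
  then show ?thesis unfolding PF_def by (intro hull_inc) simp
qed

context
  fixes e :: "nat \<Rightarrow> 'n::finite" and u :: "real list" and n s :: nat and A :: sbp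
  assumes u: "is_park_vec u" and n: "length u = n" and e: "bij_betw e {1..n} UNIV"
    and A: "is_sbp n A" and s: "count_list u 0 \<le> s" "s \<le> n"
    and type: "sbp_type A = omega_type u s"
begin

definition "coord_pos = block_pos A"
definition "cut_values = sorted_list_of_set (set (drop s u))"
text \<open>Positions 0 and 1 are \<open>B\<^sub>-\<^sub>1\<close> and \<open>B\<^sub>0\<close>,
  hence the offset 2. Entries of \<open>u\<close> before the cut may be positive and are lowered to
  0.\<close>

definition "block_value j = (if j < 2 then 0 else cut_values ! (j - 2))" for j :: nat
definition "block_vertex = vec_of n e (\<lambda>p. block_value (coord_pos p))"

lemma sorted_u: "sorted u" using u by (simp add: is_park_vec_def)

lemma cut_values: "set cut_values = set (drop s u)" "sorted_wrt (<) cut_values"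
  by (auto simp: cut_values_def)

lemma drop_pos: "x \<in> set (drop s u) \<Longrightarrow> 0 < x"
proof -
  assume "x \<in> set (drop s u)"
  then obtain k where k: "k < length (drop s u)" "x = drop s u ! k" by (metis in_set_conv_nth)
  then have *: "x = u ! (s + k)" "s + k < length u" using n s by auto
  then show "0 < x" using park_vec_nth[OF u *(2)] s(1) by (simp add: less_le)
qed

lemma type_tail:
  "map (\<lambda>(S, h). if h then Star (card S) else Plain (card S)) (drop 2 A) =
    map Plain (value_counts (drop s u))"
  using type by (auto simp: sbp_type_def omega_type_def split: if_splits)

lemma length_ds: "length cut_values = length (value_counts (drop s u))"
  by (simp add: cut_values_def value_counts_def)

lemma length_A: "length A = length cut_values + 2"
proof -
  have "length (drop 2 A) = length cut_values"
    using arg_cong[OF type_tail, of length] length_ds by (simp only: length_map)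
  then show ?thesis using sbp_length[OF A] by simp
qed

lemma tail_nth:
  assumes "j < length cut_values"
  shows "\<not> homog A (j + 2)" "card (blk A (j + 2)) = count_list (drop s u) (cut_values ! j)"
proof -
  obtain S h where Sh: "A ! (j + 2) = (S, h)" by force
  have "(if h then Star (card S) else Plain (card S)) = Plain (value_counts (drop s u) ! j)"
    using arg_cong[OF type_tail, of "\<lambda>xs. xs ! j"] assms length_A length_ds Sh
    by (simp add: add.commute)
  then have "\<not> h" "card S = value_counts (drop s u) ! j" by (auto split: if_splits)
  moreover have "value_counts (drop s u) ! j = count_list (drop s u) (cut_values ! j)"
    using assms by (simp add: value_counts_def cut_values_def)
  ultimately show "\<not> homog A (j + 2)" "card (blk A (j + 2)) = count_list (drop s u) (cut_values ! j)"
    using Sh by (simp_all add: homog_def blk_def)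
qed

lemma len2: "0 < length A" "1 < length A" using length_A by auto

lemma blk_A: "j < length A \<Longrightarrow> blk A j = {p. p \<le> n \<and> coord_pos p = j}"
  unfolding coord_pos_def by (rule blk_eq_block_pos[OF A])

lemma a_less: "p \<le> n \<Longrightarrow> coord_pos p < length A"
  unfolding coord_pos_def by (rule block_pos(1)[OF A])

text \<open>The second type entry decides: undecorated, it puts \<open>0\<close> into
  \<open>B\<^sub>-\<^sub>1\<close> next to \<open>s\<close> other elements; as
  \<open>Circ 0\<close>, it makes \<open>B\<^sub>0\<close> the singleton of \<open>0\<close>, and
  all \<open>s\<close> elements of \<open>B\<^sub>-\<^sub>1\<close> are coordinates.\<close>

lemma head:
  shows "coord_pos 0 = (if 0 < s \<and> s = count_list u 0 then 0 else 1)"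
    and "card {p\<in>{1..n}. coord_pos p = 0} = s"
    and "\<And>p. p \<le> n \<Longrightarrow> coord_pos p = 1 \<Longrightarrow> p = 0"
    and "\<not> homog A 1"
proof -
  have fin: "finite (blk A 0)" "finite (blk A 1)" using blk_A len2 by auto
  have z: "0 \<in> blk A 0 \<longleftrightarrow> coord_pos 0 = 0" "0 \<in> blk A 1 \<longleftrightarrow> coord_pos 0 = 1" using blk_A len2 by auto
  have pos0: "{p\<in>{1..n}. coord_pos p = 0} = blk A 0 - {0}" using blk_A[OF len2(1)] by auto
  have all: "coord_pos 0 = (if 0 < s \<and> s = count_list u 0 then 0 else 1) \<and> card {p\<in>{1..n}. coord_pos p = 0} = s \<and>
    (\<forall>p\<le>n. coord_pos p = 1 \<longrightarrow> p = 0) \<and> \<not> homog A 1"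
  proof (cases "0 \<in> blk A 1")
    case True
    then have a0: "coord_pos 0 = 1" using z by simp
    have t: "card (blk A 0) = s" "card (blk A 1) - 1 = 0" "\<not> (0 < s \<and> s = count_list u 0)"
      using type True by (auto simp: sbp_type_def omega_type_def split: if_splits)
    have "0 \<notin> blk A 0" using z a0 by simp
    then have "card {p\<in>{1..n}. coord_pos p = 0} = s" using pos0 t by simp
    moreover have c1: "card (blk A 1) = 1" using t(2) True fin(2)
      by (metis One_nat_def Suc_diff_1 card_gt_0_iff empty_iff)
    then have "\<not> homog A 1" using is_sbp_facts(4)[OF A _ len2(2)] by simp
    moreover have "blk A 1 = {0}" using c1 True by (metis card_1_singletonE singletonD)
    then have "\<forall>p\<le>n. coord_pos p = 1 \<longrightarrow> p = 0" using blk_A[OF len2(2)] by blast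
    ultimately show ?thesis using a0 t(3) by auto
  next
    case False
    then have 0: "0 \<in> blk A 0" and e1: "blk A 1 = {}" using is_sbp_facts[OF A] by blast+
    then have a0: "coord_pos 0 = 0" using z by simp
    have t: "card (blk A 0) - 1 = s" "0 < s \<and> s = count_list u 0"
      using type False by (auto simp: sbp_type_def omega_type_def split: if_splits)
    have "card {p\<in>{1..n}. coord_pos p = 0} = s" using pos0 t 0 fin by (simp add: card_Diff_singleton)
    moreover have "\<forall>p\<le>n. coord_pos p = 1 \<longrightarrow> p = 0" using blk_A[OF len2(2)] e1 by blast
    ultimately show ?thesis using a0 t(2) is_sbp_facts(5)[OF A e1] by auto
  qed
  then show "coord_pos 0 = (if 0 < s \<and> s = count_list u 0 then 0 else 1)"
    "card {p\<in>{1..n}. coord_pos p = 0} = s" "\<not> homog A 1" by blast+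
  show "\<And>p. p \<le> n \<Longrightarrow> coord_pos p = 1 \<Longrightarrow> p = 0" using all by blast
qed

lemma not_homog: "j < length A \<Longrightarrow> \<not> homog A j"
proof -
  assume j: "j < length A"
  consider "j = 0" | "j = 1" | i where "j = i + 2" by (metis One_nat_def Suc_1 add.commute less_2_cases_iff le_Suc_ex not_less)
  then show ?thesis
    by cases (use is_sbp_facts(1)[OF A] head(4) tail_nth(1) j length_A in auto)
qed

text \<open>The types carry no star and \<open>B\<^sub>0\<close> has at most one element, so every
  block is an antichain. This is the situation treated for glued classes.\<close>

lemma preorder_A: "sbp_preorder n A = level_preorder n coord_pos (\<lambda>_. False)"
  unfolding sbp_preorder_block_pos[OF A] coord_pos_def[symmetric] level_preorder_def
  using not_homog a_less by blast

lemma a0_le: "coord_pos 0 \<le> 1" using head(1) by simp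

lemma val_less: "i < j \<Longrightarrow> 2 \<le> j \<Longrightarrow> j < length A \<Longrightarrow> block_value i < block_value j"
proof -
  assume *: "i < j" "2 \<le> j" "j < length A"
  then have "cut_values ! (j - 2) \<in> set cut_values" using length_A by (intro nth_mem) auto
  then have "0 < cut_values ! (j - 2)" using drop_pos cut_values by blast
  moreover have "cut_values ! (i - 2) < cut_values ! (j - 2)" if "2 \<le> i"
    using * that length_A by (intro sorted_wrt_nth_less[OF cut_values(2)]) auto
  ultimately show "block_value i < block_value j" using * by (auto simp: block_value_def)
qed

lemma val_mono: "i \<le> j \<Longrightarrow> j < length A \<Longrightarrow> block_value i \<le> block_value j"
  using val_less[of i j] by (cases "i = j"; cases "j < 2") (auto simp: block_value_def)

lemma val_nonneg: "p \<le> n \<Longrightarrow> 0 \<le> block_value (coord_pos p)"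
  using val_mono[of 0 "coord_pos p"] a_less by (simp add: block_value_def)

lemma a_cases: "p \<in> {1..n} \<Longrightarrow> coord_pos p = 0 \<or> 2 \<le> coord_pos p"
  using head(3)[of p] by force

text \<open>The type prescribes the size of each upper block as the multiplicity of its value after
  the cut. As a multiset, the coordinates of the vertex are therefore \<open>u\<close> with its
  first \<open>s\<close> entries replaced by 0.\<close>

lemma card_val: "card {p\<in>{1..n}. block_value (coord_pos p) = x} = count (mset (replicate s 0 @ drop s u)) x"
proof (cases "x = 0")
  case True
  have "block_value (coord_pos p) = 0 \<longleftrightarrow> coord_pos p = 0" if "p \<in> {1..n}" for p
    using a_cases[OF that] val_less[of 0 "coord_pos p"] a_less[of p] that by (auto simp: block_value_def)
  then have "{p\<in>{1..n}. block_value (coord_pos p) = x} = {p\<in>{1..n}. coord_pos p = 0}" using True by auto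
  moreover have "count_list (drop s u) 0 = 0" using drop_pos count_list_0_iff by (metis less_irrefl)
  ultimately show ?thesis using head(2) True by (simp add: count_mset)
next
  case False
  show ?thesis
  proof (cases "x \<in> set cut_values")
    case True
    then obtain j where j: "j < length cut_values" "x = cut_values ! j" by (metis in_set_conv_nth)
    have vj: "block_value (j + 2) = x" using j by (simp add: block_value_def)
    have "block_value (coord_pos p) = x \<longleftrightarrow> coord_pos p = j + 2" if "p \<le> n" for p
    proof
      assume vp: "block_value (coord_pos p) = x"
      have "2 \<le> coord_pos p"
      proof (rule ccontr)
        assume "\<not> 2 \<le> coord_pos p"
        then show False using vp False by (simp add: block_value_def)
      qed
      then show "coord_pos p = j + 2"
        using val_less[of "coord_pos p" "j + 2"] val_less[of "j + 2" "coord_pos p"] a_less[OF that] j(1) length_A vj vp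
        by (cases "coord_pos p" "j + 2" rule: linorder_cases) auto
    qed (use vj in simp)
    moreover have "p \<noteq> 0" if "coord_pos p = j + 2" for p using a0_le that by (cases "p = 0") auto
    ultimately have "{p\<in>{1..n}. block_value (coord_pos p) = x} = {p. p \<le> n \<and> coord_pos p = j + 2}" by force
    also have "\<dots> = blk A (j + 2)" using blk_A[of "j + 2"] j length_A by simp
    finally show ?thesis using tail_nth(2)[OF j(1)] j(2) False by (simp add: count_mset)
  next
    case nin: False
    have "block_value (coord_pos p) \<noteq> x" if "p \<in> {1..n}" for p
    proof (cases "coord_pos p < 2")
      case True then show ?thesis using False by (simp add: block_value_def)
    next
      case ge: False
      then have "coord_pos p - 2 < length cut_values" using a_less[of p] that length_A by auto
      then show ?thesis using nin ge by (auto simp: block_value_def)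
    qed
    then have "{p\<in>{1..n}. block_value (coord_pos p) = x} = {}" by blast
    moreover have "count_list (drop s u) x = 0" using nin cut_values count_list_0_iff by metis
    ultimately show ?thesis using False by (simp add: count_mset)
  qed
qed

text \<open>Listed along \<open>\<sigma>\<close>, the block values form a sorted list with the
  multiset of \<open>replicate s 0 @ drop s u\<close>, and a sorted list is determined by its
  multiset.\<close>

lemma val_eq_nth:
  assumes \<sigma>: "bij_betw \<sigma> {1..n} {..<n}"
    and mono: "\<And>p q. p \<in> {1..n} \<Longrightarrow> q \<in> {1..n} \<Longrightarrow> coord_pos p < coord_pos q \<Longrightarrow> \<sigma> p < \<sigma> q"
    and p: "p \<in> {1..n}"
  shows "block_value (coord_pos p) = (if \<sigma> p < s then 0 else u ! \<sigma> p)" "coord_pos p = 0 \<longleftrightarrow> \<sigma> p < s"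
proof -
  define g where "g = inv_into {1..n} \<sigma>"
  have g: "bij_betw g {..<n} {1..n}" using \<sigma> unfolding g_def by (rule bij_betw_inv_into)
  have \<sigma>g: "\<sigma> (g k) = k" if "k < n" for k
    using \<sigma> that unfolding g_def by (auto simp: bij_betw_def intro: f_inv_into_f)
  have g\<sigma>: "g (\<sigma> p) = p" if "p \<in> {1..n}" for p
    using \<sigma> that unfolding g_def by (auto simp: bij_betw_def)
  have gX: "g k \<in> {1..n}" if "k < n" for k using g that by (auto simp: bij_betw_def)
  define L where "L = map (\<lambda>k. block_value (coord_pos (g k))) [0..<n]"
  have L: "L ! k = block_value (coord_pos (g k))" if "k < n" for k using that by (simp add: L_def)
  have "sorted L"
    unfolding sorted_iff_nth_mono
  proof (intro allI impI)
    fix i j assume ij: "i \<le> j" "j < length L"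
    then have jn: "i < n" "j < n" by (auto simp: L_def)
    have "coord_pos (g i) \<le> coord_pos (g j)" using mono[of "g j" "g i"] gX jn \<sigma>g ij by (metis not_less)
    then show "L ! i \<le> L ! j" using val_mono a_less gX jn L by auto
  qed
  moreover have su: "sorted (replicate s 0 @ drop s u)"
    using sorted_u drop_pos by (auto simp: sorted_append sorted_wrt_drop less_imp_le)
  moreover have "mset L = mset (replicate s 0 @ drop s u)"
  proof (rule multiset_eqI)
    fix x
    have "count (mset L) x = card {k. k < n \<and> block_value (coord_pos (g k)) = x}"
      unfolding count_mset_nth using L by (intro arg_cong[of _ _ card]) (auto simp: L_def)
    also have "\<dots> = card (g ` {k. k < n \<and> block_value (coord_pos (g k)) = x})"
      using g by (intro card_image[symmetric]) (auto simp: bij_betw_def intro: inj_on_subset)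
    also have "g ` {k. k < n \<and> block_value (coord_pos (g k)) = x} = {p\<in>{1..n}. block_value (coord_pos p) = x}"
    proof (intro equalityI subsetI)
      fix p assume p: "p \<in> {p\<in>{1..n}. block_value (coord_pos p) = x}"
      then have "\<sigma> p < n" using \<sigma> by (auto simp: bij_betw_def)
      then show "p \<in> g ` {k. k < n \<and> block_value (coord_pos (g k)) = x}"
        using p g\<sigma> by (intro image_eqI[of _ _ "\<sigma> p"]) auto
    qed (use gX in auto)
    finally show "count (mset L) x = count (mset (replicate s 0 @ drop s u)) x"
      using card_val by simp
  qed
  ultimately have eq: "L = replicate s 0 @ drop s u"
    by (metis properties_for_sort)
  have \<sigma>n: "\<sigma> p < n" using \<sigma> p by (auto simp: bij_betw_def)
  have "block_value (coord_pos p) = L ! \<sigma> p" using L[OF \<sigma>n] g\<sigma>[OF p] by simp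
  then show v: "block_value (coord_pos p) = (if \<sigma> p < s then 0 else u ! \<sigma> p)"
    using \<sigma>n n s(2) by (simp add: eq nth_append)
  have "u ! \<sigma> p \<noteq> 0" if "\<not> \<sigma> p < s" using park_vec_nth(1)[OF u, of "\<sigma> p"] \<sigma>n n s that by simp
  moreover have "block_value (coord_pos p) = 0 \<longleftrightarrow> coord_pos p = 0"
    using a_cases[OF p] val_less[of 0 "coord_pos p"] a_less[of p] p by (auto simp: block_value_def)
  ultimately show "coord_pos p = 0 \<longleftrightarrow> \<sigma> p < s" using v by (auto split: if_splits)
qed

lemma coord_block_vertex: "p \<in> {1..n} \<Longrightarrow> coord e block_vertex p = block_value (coord_pos p)"
  unfolding block_vertex_def by (rule coord_vec_of[OF e])

lemma val_le_nth:
  assumes "bij_betw \<sigma> {1..n} {..<n}"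
    and "\<And>p q. p \<in> {1..n} \<Longrightarrow> q \<in> {1..n} \<Longrightarrow> coord_pos p < coord_pos q \<Longrightarrow> \<sigma> p < \<sigma> q"
    and "p \<in> {1..n}"
  shows "block_value (coord_pos p) \<le> u ! \<sigma> p"
proof -
  have "\<sigma> p < n" using assms by (auto simp: bij_betw_def)
  then show ?thesis using val_eq_nth(1)[OF assms] park_vec_nth(2)[OF u, of "\<sigma> p"] n by simp
qed

text \<open>Blocks take precedence and \<open>f\<close> only breaks ties inside a block; a constant
  \<open>f\<close> gives an arbitrary compatible order.\<close>

lemma ex_order:
  obtains \<sigma> where "bij_betw \<sigma> {1..n} {..<n}"
    "\<And>p q. p \<in> {1..n} \<Longrightarrow> q \<in> {1..n} \<Longrightarrow> coord_pos p < coord_pos q \<or> coord_pos p = coord_pos q \<and> f p < (f q :: real) \<Longrightarrow> \<sigma> p < \<sigma> q"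
proof -
  have "\<exists>\<sigma>. bij_betw \<sigma> {1..n} {..<card {1..n}} \<and>
    (\<forall>p\<in>{1..n}. \<forall>q\<in>{1..n}. coord_pos p < coord_pos q \<or> coord_pos p = coord_pos q \<and> f p < f q \<longrightarrow> \<sigma> p < \<sigma> q)"
    by (rule linear_extension) auto
  then obtain \<sigma> where "bij_betw \<sigma> {1..n} {..<n}"
    "\<forall>p\<in>{1..n}. \<forall>q\<in>{1..n}. coord_pos p < coord_pos q \<or> coord_pos p = coord_pos q \<and> f p < f q \<longrightarrow> \<sigma> p < \<sigma> q" by auto
  then show ?thesis by (intro that[of \<sigma>]) blast+
qed

section \<open>The normal cone of the vertex\<close>

lemma block_vertex_in_PF: "block_vertex \<in> PF e u"
proof -
  obtain \<sigma> where \<sigma>: "bij_betw \<sigma> {1..n} {..<n}"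
    "\<And>p q. p \<in> {1..n} \<Longrightarrow> q \<in> {1..n} \<Longrightarrow> coord_pos p < coord_pos q \<or> coord_pos p = coord_pos q \<and> (0::real) < 0 \<Longrightarrow> \<sigma> p < \<sigma> q"
    using ex_order[of "\<lambda>_. 0"] by blast
  show ?thesis
    by (rule parking_in_PF[OF u n \<sigma>(1)]) (use coord_block_vertex val_le_nth[OF \<sigma>(1)] \<sigma>(2) val_nonneg in auto)
qed

text \<open>As \<open>y\<close> is nonnegative, replacing weights by their positive parts can only
  increase \<open>c \<bullet> y\<close>. By rearrangement, \<open>u\<close> listed along the blocks
  is then optimal, and the vertex attains this bound.\<close>

lemma cone_subset_normal_cone: "sliced_cone e n A \<subseteq> normal_cone (PF e u) {block_vertex}"
proof
  fix c assume c: "c \<in> sliced_cone e n A"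
  have cle: "coord e c p \<le> coord e c q" if "p \<le> n" "q \<le> n" "coord_pos p < coord_pos q" for p q
    using c that unfolding sliced_cone_eq preorder_A
    by (intro in_preorder_coneD) (auto simp: level_preorder_def)
  define f where "f p = max 0 (coord e c p)" for p
  \<comment> \<open>Ties inside a block are broken by \<open>f\<close>, so that
    \<open>\<sigma>\<close> sorts the clipped weights.\<close>
  obtain \<sigma> where \<sigma>: "bij_betw \<sigma> {1..n} {..<n}"
    "\<And>p q. p \<in> {1..n} \<Longrightarrow> q \<in> {1..n} \<Longrightarrow> coord_pos p < coord_pos q \<or> coord_pos p = coord_pos q \<and> f p < f q \<Longrightarrow> \<sigma> p < \<sigma> q"
    using ex_order[of f] by blast
  have fmono: "f p \<le> f q" if "p \<in> {1..n}" "q \<in> {1..n}" "\<sigma> p < \<sigma> q" for p q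
  proof (rule ccontr)
    assume "\<not> f p \<le> f q"
    then have lt: "f q < f p" by simp
    have "\<not> \<sigma> q < \<sigma> p" using that by simp
    then have "coord_pos p < coord_pos q" using \<sigma>(2)[OF that(2,1)] lt by (metis linorder_neqE_nat)
    then have "coord e c p \<le> coord e c q" using cle that by auto
    then show False using lt by (auto simp: f_def)
  qed
  \<comment> \<open>Lowering entries of \<open>u\<close> to 0 costs nothing: in the lowest block
    either the entry is 0 already, or \<open>0\<close> lies strictly above the block and the clipped
    weight is 0. In the upper blocks weights are nonnegative and clipping has no effect.\<close>
  have termwise: "f p * u ! \<sigma> p = coord e c p * block_value (coord_pos p)" if p: "p \<in> {1..n}" for p
  proof -
    have v: "block_value (coord_pos p) = (if \<sigma> p < s then 0 else u ! \<sigma> p)" "coord_pos p = 0 \<longleftrightarrow> \<sigma> p < s"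
      using val_eq_nth[OF \<sigma>(1) _ p] \<sigma>(2) by blast+
    show ?thesis
    proof (cases "coord_pos p = 0")
      case True
      then have "block_value (coord_pos p) = 0" by (simp add: block_value_def)
      moreover have "f p = 0 \<or> u ! \<sigma> p = 0"
      proof (cases "0 < s \<and> s = count_list u 0")
        case True
        then have "\<sigma> p < count_list u 0" using v \<open>coord_pos p = 0\<close> by simp
        moreover have "\<sigma> p < n" using \<sigma>(1) p by (auto simp: bij_betw_def)
        ultimately show ?thesis using park_vec_nth(1)[OF u, of "\<sigma> p"] n by simp
      next
        case False
        then have "coord_pos p < coord_pos 0" using head(1) True by simp
        then show ?thesis using cle[of p 0] p by (simp add: f_def)
      qed
      ultimately show ?thesis by auto
    next
      case False
      then have "coord_pos 0 < coord_pos p" using a_cases[OF p] a0_le by auto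
      then have "0 \<le> coord e c p" using cle[of 0 p] p by simp
      then show ?thesis using v False by (simp add: f_def)
    qed
  qed
  have "{y. parking_function e u y} \<subseteq> {y. c \<bullet> y \<le> c \<bullet> block_vertex}"
  proof clarify
    fix y assume "parking_function e u y"
    then obtain \<tau> where y: "\<forall>i\<in>{1..n}. 0 \<le> coord e y i" and
      \<tau>: "bij_betw \<tau> {1..n} {..<n}" "\<forall>i\<in>{1..n}. coord e y i \<le> u ! \<tau> i"
      unfolding parking_function_iff[OF sorted_u n] by blast
    have "c \<bullet> y = (\<Sum>i\<in>{1..n}. coord e c i * coord e y i)" by (rule inner_eq_sum_coord[OF e])
    also have "\<dots> \<le> (\<Sum>i\<in>{1..n}. f i * u ! \<tau> i)"
    proof (rule sum_mono)
      fix i assume i: "i \<in> {1..n}"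
      have "coord e c i * coord e y i \<le> f i * coord e y i"
        using y i by (intro mult_right_mono) (auto simp: f_def)
      also have "\<dots> \<le> f i * u ! \<tau> i" using \<tau>(2) i by (intro mult_left_mono) (auto simp: f_def)
      finally show "coord e c i * coord e y i \<le> f i * u ! \<tau> i" .
    qed
    also have "\<dots> \<le> (\<Sum>i\<in>{1..n}. f i * u ! \<sigma> i)"
      by (rule rearrangement_bij[OF sorted_u n \<sigma>(1) \<tau>(1) fmono])
    also have "\<dots> = (\<Sum>i\<in>{1..n}. coord e c i * coord e block_vertex i)"
      using termwise coord_block_vertex by (intro sum.cong) auto
    also have "\<dots> = c \<bullet> block_vertex" by (rule inner_eq_sum_coord[OF e, symmetric])
    finally show "c \<bullet> y \<le> c \<bullet> block_vertex" .
  qed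
  then have "PF e u \<subseteq> {y. c \<bullet> y \<le> c \<bullet> block_vertex}"
    unfolding PF_def by (rule hull_minimal) (rule convex_halfspace_le)
  then show "c \<in> normal_cone (PF e u) {block_vertex}" by (auto simp: normal_cone_def)
qed

lemma normal_cone_subset_cone: "normal_cone (PF e u) {block_vertex} \<subseteq> sliced_cone e n A"
proof
  fix w assume w: "w \<in> normal_cone (PF e u) {block_vertex}"
  obtain \<sigma> where \<sigma>: "bij_betw \<sigma> {1..n} {..<n}"
    "\<And>p q. p \<in> {1..n} \<Longrightarrow> q \<in> {1..n} \<Longrightarrow> coord_pos p < coord_pos q \<or> coord_pos p = coord_pos q \<and> (0::real) < 0 \<Longrightarrow> \<sigma> p < \<sigma> q"
    using ex_order[of "\<lambda>_. 0"] by blast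
  have le: "block_value (coord_pos i) \<le> u ! \<sigma> i" if "i \<in> {1..n}" for i using val_le_nth[OF \<sigma>(1)] \<sigma>(2) that by blast
  have test: "(\<Sum>i\<in>{1..n}. coord e w i * f i) \<le> (\<Sum>i\<in>{1..n}. coord e w i * block_value (coord_pos i))"
    if \<tau>: "bij_betw \<tau> {1..n} {..<n}" and f: "\<And>i. i \<in> {1..n} \<Longrightarrow> 0 \<le> f i \<and> f i \<le> u ! \<tau> i" for \<tau> f
  proof -
    have cf: "coord e (vec_of n e f) i = f i" if "i \<in> {1..n}" for i using coord_vec_of[OF e that] .
    have "vec_of n e f \<in> PF e u" by (rule parking_in_PF[OF u n \<tau>]) (use f cf in simp)
    then have "w \<bullet> vec_of n e f \<le> w \<bullet> block_vertex" using w by (auto simp: normal_cone_def)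
    moreover have "(\<Sum>i\<in>{1..n}. coord e w i * coord e (vec_of n e f) i) =
      (\<Sum>i\<in>{1..n}. coord e w i * f i)" using cf by (intro sum.cong) auto
    moreover have "(\<Sum>i\<in>{1..n}. coord e w i * coord e block_vertex i) =
      (\<Sum>i\<in>{1..n}. coord e w i * block_value (coord_pos i))" using coord_block_vertex by (intro sum.cong) auto
    ultimately show ?thesis unfolding inner_eq_sum_coord[OF e] by simp
  qed
  \<comment> \<open>Competitors differing from the vertex in a single coordinate; their domination
    by \<open>u\<close> may be witnessed by a bijection other than \<open>\<sigma>\<close>.\<close>
  have one: "coord e w p * x \<le> coord e w p * block_value (coord_pos p)"
    if p: "p \<in> {1..n}" and \<tau>: "bij_betw \<tau> {1..n} {..<n}" and x: "0 \<le> x" "x \<le> u ! \<tau> p"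
      and f: "\<And>i. i \<in> {1..n} \<Longrightarrow> i \<noteq> p \<Longrightarrow> block_value (coord_pos i) \<le> u ! \<tau> i" for p x \<tau>
  proof -
    let ?f = "\<lambda>i. if i = p then x else block_value (coord_pos i)"
    have "(\<Sum>i\<in>{1..n}. coord e w i * ?f i) \<le> (\<Sum>i\<in>{1..n}. coord e w i * block_value (coord_pos i))"
      by (rule test[OF \<tau>]) (use x f val_nonneg in auto)
    moreover have "(\<Sum>i\<in>{1..n}-{p}. coord e w i * ?f i) = (\<Sum>i\<in>{1..n}-{p}. coord e w i * block_value (coord_pos i))"
      by (intro sum.cong) auto
    moreover have "sum g {1..n} = g p + sum g ({1..n} - {p})" for g :: "nat \<Rightarrow> real"
      by (rule sum.remove) (use p in auto)
    ultimately show ?thesis by simp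
  qed
  have tr: "bij_betw (\<sigma> \<circ> Transposition.transpose p q) {1..n} {..<n}" if "p \<in> {1..n}" "q \<in> {1..n}" for p q
    using bij_betw_trans[OF permutes_imp_bij[OF permutes_swap_id[OF that]] \<sigma>(1)] .
  have "coord e w p \<le> coord e w q" if pq: "p \<le> n" "q \<le> n" "coord_pos p < coord_pos q" for p q
  proof -
    consider "p = 0" | "q = 0" "p \<noteq> 0" | "p \<in> {1..n}" "q \<in> {1..n}"
      using pq(1,2) by (cases "p = 0"; cases "q = 0") auto
    then show ?thesis
    proof cases
      \<comment> \<open>Lowering the positive coordinate \<open>q\<close> to 0 must not increase the
        functional, so the weight of \<open>q\<close> is nonnegative.\<close>
      case 1
      then have q: "q \<in> {1..n}" using pq by (cases "q = 0") auto
      then have "2 \<le> coord_pos q" using a_cases[OF q] pq(3) by auto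
      then have pos: "0 < block_value (coord_pos q)" using val_less[of 0 "coord_pos q"] a_less q by (simp add: block_value_def)
      have "u ! \<sigma> q \<ge> 0" using le[OF q] pos by simp
      then have "coord e w q * 0 \<le> coord e w q * block_value (coord_pos q)"
        using one[OF q \<sigma>(1), of 0] le by simp
      then have "0 \<le> coord e w q" using pos by (simp add: zero_le_mult_iff)
      then show ?thesis using 1 by simp
    next
      case 2
      then have p: "p \<in> {1..n}" using pq by simp
      have a0: "coord_pos 0 = 1" "coord_pos p = 0" using 2 pq a0_le by auto
      have "\<not> (0 < s \<and> s = count_list u 0)"
      proof
        assume "0 < s \<and> s = count_list u 0"
        then have "coord_pos 0 = 0" unfolding head(1) by (rule if_P)
        then show False using a0(1) by simp
      qed
      moreover have "0 < s"
        using val_eq_nth(2)[OF \<sigma>(1) _ p] \<sigma>(2) a0 by (metis gr0I not_less0)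
      \<comment> \<open>Here the cut lies beyond the zeros of \<open>u\<close>, so
        \<open>u ! (s - 1)\<close>, the last entry lowered to 0, is positive. Coordinate
        \<open>p\<close> is raised to it; exchanging \<open>p\<close> with the element
        \<open>p'\<close> assigned to that entry keeps the result a parking function.\<close>
      ultimately have s': "count_list u 0 \<le> s - 1" "s - 1 < n" using s by auto
      then have pos: "0 < u ! (s - 1)"
        using park_vec_nth[OF u, of "s - 1"] n by (simp add: less_le)
      obtain p' where p': "p' \<in> {1..n}" "\<sigma> p' = s - 1"
        using \<sigma>(1) s' by (metis bij_betw_def imageE lessThan_iff)
      then have "coord_pos p' = 0" using val_eq_nth(2)[OF \<sigma>(1) _ p'(1)] \<sigma>(2) \<open>0 < s\<close> by (metis diff_less less_one)
      have "coord e w p * u ! (s - 1) \<le> coord e w p * block_value (coord_pos p)"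
      proof (rule one[OF p tr[OF p p'(1)]])
        show "0 \<le> u ! (s - 1)" using pos by simp
        show "u ! (s - 1) \<le> u ! (\<sigma> \<circ> Transposition.transpose p p') p" using p' by simp
      next
        fix i assume i: "i \<in> {1..n}" "i \<noteq> p"
        show "block_value (coord_pos i) \<le> u ! (\<sigma> \<circ> Transposition.transpose p p') i"
        proof (cases "i = p'")
          case True
          then have "block_value (coord_pos i) = 0" using \<open>coord_pos p' = 0\<close> by (simp add: block_value_def)
          moreover have "\<sigma> p < n" using \<sigma>(1) p by (auto simp: bij_betw_def)
          ultimately show ?thesis using True park_vec_nth(2)[OF u, of "\<sigma> p"] n by simp
        next
          case False
          then show ?thesis using le i by simp
        qed
      qed
      then have "coord e w p * u ! (s - 1) \<le> 0" using a0 by (simp add: block_value_def)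
      then have "coord e w p \<le> 0" using pos by (simp add: mult_le_0_iff)
      then show ?thesis using 2 by simp
    next
      case 3
      have "p \<noteq> q" using pq by auto
      have "2 \<le> coord_pos q" using a_cases[OF 3(2)] pq(3) by auto
      then have lt: "block_value (coord_pos p) < block_value (coord_pos q)" using val_less pq a_less by blast
      let ?t = "Transposition.transpose p q"
      have tX: "?t i \<in> {1..n}" if "i \<in> {1..n}" for i using that 3 by (auto simp: Transposition.transpose_def)
      have "(\<Sum>i\<in>{1..n}. coord e w i * block_value (coord_pos (?t i))) \<le> (\<Sum>i\<in>{1..n}. coord e w i * block_value (coord_pos i))"
        by (rule test[OF tr[OF 3]]) (use le tX val_nonneg in auto)
      moreover have "(\<Sum>i\<in>{1..n}-{p}-{q}. coord e w i * block_value (coord_pos (?t i))) =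
        (\<Sum>i\<in>{1..n}-{p}-{q}. coord e w i * block_value (coord_pos i))"
        by (intro sum.cong) (auto simp: Transposition.transpose_def)
      moreover have "sum g {1..n} = g p + (g q + sum g ({1..n} - {p} - {q}))" for g :: "nat \<Rightarrow> real"
        using 3 \<open>p \<noteq> q\<close> sum.remove[of "{1..n}" p g] sum.remove[of "{1..n} - {p}" q g] by simp
      ultimately have "coord e w p * block_value (coord_pos q) + coord e w q * block_value (coord_pos p) \<le>
        coord e w p * block_value (coord_pos p) + coord e w q * block_value (coord_pos q)"
        by simp
      then have "0 \<le> (coord e w q - coord e w p) * (block_value (coord_pos q) - block_value (coord_pos p))" by (simp add: algebra_simps)
      then show ?thesis using lt by (simp add: zero_le_mult_iff)
    qed
  qed
  then show "w \<in> sliced_cone e n A"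
    unfolding sliced_cone_eq preorder_A preorder_cone_def level_preorder_def by auto
qed

lemma normal_cone_eq: "normal_cone (PF e u) {block_vertex} = sliced_cone e n A"
  using cone_subset_normal_cone normal_cone_subset_cone by blast

lemma ex_sbp_closure:
  assumes "w \<in> preorder_cone e (sbp_preorder n A)"
  shows "\<exists>B. is_sbp n B \<and>
    sbp_preorder n B = (sbp_preorder n A \<union> tight (coord e w) (sbp_preorder n A))\<^sup>+"
proof -
  have "coord e w p \<le> coord e w q" if "p \<le> n" "q \<le> n" "coord_pos p < coord_pos q" for p q
    using in_preorder_coneD[OF assms, of p q] that by (simp add: preorder_A level_preorder_def)
  then show ?thesis
    unfolding preorder_A using a0_le head(3) by (intro ex_sbp_glued_closure)
qed

end

section \<open>The fan of a multiplicity vector\<close>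

text \<open>The functional decides where \<open>u\<close> is cut: coordinates of negative weight
  should vanish, and as many as \<open>u\<close> has zeros vanish anyway. The entries after the cut
  are assigned in the order of the weights.\<close>

lemma ex_maximal_sbp:
  fixes c :: "real ^ 'n::finite"
  assumes u: "is_park_vec u" and n: "length u = n"
  obtains A s where "is_sbp n A" "count_list u 0 \<le> s" "s \<le> n" "sbp_type A = omega_type u s"
    "c \<in> sliced_cone e n A"
proof -
  define w where "w = coord e c"
  define m where "m = count_list u 0"
  have "\<exists>\<sigma>. bij_betw \<sigma> {1..n} {..<card {1..n}} \<and>
    (\<forall>p\<in>{1..n}. \<forall>q\<in>{1..n}. w p < w q \<longrightarrow> \<sigma> p < \<sigma> q)"
    by (rule linear_extension) auto
  then obtain \<sigma> where \<sigma>: "bij_betw \<sigma> {1..n} {..<n}"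
    and mono: "\<And>p q. p \<in> {1..n} \<Longrightarrow> q \<in> {1..n} \<Longrightarrow> w p < w q \<Longrightarrow> \<sigma> p < \<sigma> q" by auto
  define g where "g = inv_into {1..n} \<sigma>"
  have g: "bij_betw g {..<n} {1..n}" using \<sigma> unfolding g_def by (rule bij_betw_inv_into)
  have \<sigma>g: "\<sigma> (g k) = k" if "k < n" for k
    using \<sigma> that unfolding g_def by (auto simp: bij_betw_def intro: f_inv_into_f)
  have g\<sigma>: "g (\<sigma> p) = p" if "p \<in> {1..n}" for p
    using \<sigma> that unfolding g_def by (auto simp: bij_betw_def)
  have gX: "g k \<in> {1..n}" if "k < n" for k using g that by (auto simp: bij_betw_def)
  have \<sigma>n: "\<sigma> p < n" if "p \<in> {1..n}" for p using \<sigma> that by (auto simp: bij_betw_def)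
  have ginj: "inj_on g K" if "K \<subseteq> {..<n}" for K
    using g that by (meson bij_betw_def inj_on_subset)
  define N where "N = {p\<in>{1..n}. w p < 0}"
  define k where "k = card N"
  have fN: "finite N" by (simp add: N_def)
  have "N \<subseteq> {1..n}" by (auto simp: N_def)
  then have kn: "k \<le> n" using card_mono[of "{1..n}" N] by (simp add: k_def)
  \<comment> \<open>Everything listed before a negative weight can be taken no larger, hence is
    negative too, so the negative weights fill the first \<open>k\<close> places.\<close>
  have seg: "\<sigma> p < k \<longleftrightarrow> w p < 0" if p: "p \<in> {1..n}" for p
  proof
    assume neg: "w p < 0"
    have "g ` {..\<sigma> p} \<subseteq> N"
    proof
      fix q assume "q \<in> g ` {..\<sigma> p}"
      then obtain i where i: "i \<le> \<sigma> p" "q = g i" by auto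
      then have "i < n" using \<sigma>n[OF p] by simp
      then have "q \<in> {1..n}" "\<sigma> q \<le> \<sigma> p" using i gX \<sigma>g by auto
      then have "\<not> w p < w q" using mono[OF p] by (meson not_less)
      then show "q \<in> N" using neg \<open>q \<in> {1..n}\<close> by (auto simp: N_def)
    qed
    then have "card (g ` {..\<sigma> p}) \<le> k" unfolding k_def by (rule card_mono[OF fN])
    moreover have "card (g ` {..\<sigma> p}) = Suc (\<sigma> p)"
      using \<sigma>n[OF p] by (subst card_image[OF ginj]) auto
    ultimately show "\<sigma> p < k" by simp
  next
    assume less: "\<sigma> p < k"
    show "w p < 0"
    proof (rule ccontr)
      assume "\<not> w p < 0"
      then have "\<sigma> q < \<sigma> p" if "q \<in> N" for q using mono[of q p] p that by (auto simp: N_def)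
      then have "card (\<sigma> ` N) \<le> card {..<\<sigma> p}" by (intro card_mono) auto
      moreover have "inj_on \<sigma> N" using \<sigma> by (auto simp: bij_betw_def N_def intro: inj_on_subset)
      ultimately show False using less by (simp add: card_image k_def)
    qed
  qed
  \<comment> \<open>The \<open>m\<close> zeros of \<open>u\<close> are always used; if more weights
    are negative, positive entries of \<open>u\<close> are given up as well.\<close>
  define s where "s = max m k"
  have sm: "m \<le> s" "k \<le> s" and sn: "s \<le> n"
    using kn count_le_length[of u 0] n by (auto simp: s_def m_def)
  have upos: "0 < u ! i" if "s \<le> i" "i < n" for i
    using park_vec_nth[OF u, of i] n that sm by (simp add: less_le m_def)
  \<comment> \<open>If the cut equals the number of zeros, the weights before it may have either
    sign, so these elements share the level of \<open>0\<close>. Otherwise they are all negative,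
    and any level below 0 serves, here -1.\<close>
  define lvl :: "nat \<Rightarrow> real" where
    "lvl p = (if p = 0 then 0 else if \<sigma> p < s then (if s = m then 0 else -1) else u ! \<sigma> p)" for p
  have lvl0: "lvl 0 = 0" by (simp add: lvl_def)
  have lvl: "lvl p = (if \<sigma> p < s then (if s = m then 0 else -1) else u ! \<sigma> p)" if "p \<in> {1..n}" for p
    using that by (simp add: lvl_def)
  have lvl_pos: "0 < lvl p \<longleftrightarrow> s \<le> \<sigma> p" if "p \<in> {1..n}" for p
    using upos[of "\<sigma> p"] \<sigma>n[OF that] lvl[OF that] by auto
  have lvl_neg: "lvl p < 0 \<longleftrightarrow> \<sigma> p < s \<and> s \<noteq> m" if "p \<in> {1..n}" for p
    using upos[of "\<sigma> p"] \<sigma>n[OF that] lvl[OF that] by auto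
  have lvl_zero: "lvl p = 0 \<longleftrightarrow> \<sigma> p < s \<and> s = m" if "p \<in> {1..n}" for p
    using upos[of "\<sigma> p"] \<sigma>n[OF that] lvl[OF that] by auto
  have X: "p \<in> {1..n}" if "p \<le> n" "lvl p \<noteq> 0" for p using that lvl0 by (cases "p = 0") auto
  have lvl_less: "\<sigma> p < \<sigma> q" if pq: "p \<in> {1..n}" "q \<in> {1..n}" "lvl p < lvl q" for p q
  proof (rule ccontr)
    assume "\<not> \<sigma> p < \<sigma> q"
    then have le: "\<sigma> q \<le> \<sigma> p" by simp
    have "lvl q \<le> lvl p"
    proof (cases "\<sigma> q < s")
      case True
      then show ?thesis using lvl[OF pq(1)] lvl[OF pq(2)] upos[of "\<sigma> p"] \<sigma>n[OF pq(1)] by force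
    next
      case False
      moreover have "u ! \<sigma> q \<le> u ! \<sigma> p"
        using u le \<sigma>n[OF pq(1)] n by (intro sorted_nth_mono) (auto simp: is_park_vec_def)
      ultimately show ?thesis using lvl[OF pq(1)] lvl[OF pq(2)] le by auto
    qed
    then show False using pq by simp
  qed
  let ?h = "\<lambda>_::real. False"
  let ?A = "mk_sbp n lvl ?h"
  have H: "is_sbp n ?A \<and> sbp_preorder n ?A = level_preorder n lvl ?h"
  proof -
    have 3: "lvl q = lvl p" if "p \<le> n" "q \<le> n" "lvl p < lvl 0" "lvl q < lvl 0" for p q
    proof -
      have "p \<in> {1..n}" "q \<in> {1..n}" using X that lvl0 by auto
      then show ?thesis using lvl_neg lvl that lvl0 by auto
    qed
    have 4: "lvl 0 \<le> lvl q" if "\<not> ?h (lvl 0)" "p \<le> n" "p \<noteq> 0" "lvl p = lvl 0" "q \<le> n" for p q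
    proof -
      have "s = m" using lvl_zero[of p] that lvl0 by auto
      then show ?thesis using lvl_neg[of q] X[OF that(5)] lvl0 by force
    qed
    show ?thesis by (intro conjI mk_sbp; (fact 3 4 | simp))
  qed
  have cone: "c \<in> sliced_cone e n ?A"
  proof -
    have "w p \<le> w q" if pq: "p \<le> n" "q \<le> n" "lvl p < lvl q" for p q
    proof -
      consider "p = 0" "q \<in> {1..n}" | "q = 0" "p \<in> {1..n}" | "p \<in> {1..n}" "q \<in> {1..n}"
        using pq by (cases "p = 0"; cases "q = 0") auto
      then show ?thesis
      proof cases
        case 1
        then have "k \<le> \<sigma> q" using lvl_pos[of q] pq lvl0 sm by simp
        then have "0 \<le> w q" using seg[of q] 1 by auto
        then show ?thesis using 1 by (simp add: w_def)
      next
        case 2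
        then have "\<sigma> p < s" "s \<noteq> m" using lvl_neg[of p] pq lvl0 by auto
        then have "\<sigma> p < k" by (auto simp: s_def max_def split: if_splits)
        then have "w p < 0" using seg 2 by blast
        then show ?thesis using 2 by (simp add: w_def)
      next
        case 3
        then show ?thesis using lvl_less[OF 3 pq(3)] mono[of q p] by (meson less_asym not_less)
      qed
    qed
    then show ?thesis
      unfolding sliced_cone_eq H[THEN conjunct2] preorder_cone_def level_preorder_def w_def by auto
  qed
  have segs: "{p\<in>{1..n}. \<sigma> p < s} = g ` {..<s}"
    using sn gX \<sigma>g g\<sigma> by (force intro: image_eqI[of _ g "\<sigma> _"])
  have cards: "card {p\<in>{1..n}. \<sigma> p < s} = s"
    unfolding segs using sn by (subst card_image[OF ginj]) auto
  have T: "{t \<in> lvl ` {0..n}. lvl 0 < t} = set (drop s u)"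
  proof (intro equalityI subsetI)
    fix t assume "t \<in> {t \<in> lvl ` {0..n}. lvl 0 < t}"
    then obtain p where p: "p \<le> n" "t = lvl p" "0 < t" using lvl0 by auto
    then have pX: "p \<in> {1..n}" using X by simp
    then have ge: "s \<le> \<sigma> p" using lvl_pos p by simp
    then have "t = drop s u ! (\<sigma> p - s)" using lvl[OF pX] p n sn by simp
    moreover have "\<sigma> p - s < length (drop s u)" using ge \<sigma>n[OF pX] n by simp
    ultimately show "t \<in> set (drop s u)" by (metis nth_mem)
  next
    fix t assume "t \<in> set (drop s u)"
    then obtain i where i: "i < length (drop s u)" "t = drop s u ! i" by (metis in_set_conv_nth)
    then have j: "s + i < n" "t = u ! (s + i)" using n sn by auto
    then have "lvl (g (s + i)) = t" using lvl[OF gX] \<sigma>g by simp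
    moreover have "0 < t" using upos j by simp
    ultimately show "t \<in> {t \<in> lvl ` {0..n}. lvl 0 < t}" using gX[OF j(1)] lvl0 by force
  qed
  have cnt: "card {p. p \<le> n \<and> lvl p = t} = count_list (drop s u) t" if t: "t \<in> set (drop s u)" for t
  proof -
    have tp: "0 < t" using t lvl0 unfolding T[symmetric] by simp
    have "{p. p \<le> n \<and> lvl p = t} = (\<lambda>i. g (s + i)) ` {i. i < n - s \<and> u ! (s + i) = t}"
    proof (intro equalityI subsetI)
      fix p assume p: "p \<in> {p. p \<le> n \<and> lvl p = t}"
      then have pX: "p \<in> {1..n}" using X tp by auto
      then have "s \<le> \<sigma> p" "u ! \<sigma> p = t" using lvl_pos[OF pX] lvl[OF pX] p tp by auto
      then show "p \<in> (\<lambda>i. g (s + i)) ` {i. i < n - s \<and> u ! (s + i) = t}"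
        using \<sigma>n[OF pX] g\<sigma>[OF pX] by (intro image_eqI[of _ _ "\<sigma> p - s"]) auto
    next
      fix p assume "p \<in> (\<lambda>i. g (s + i)) ` {i. i < n - s \<and> u ! (s + i) = t}"
      then obtain i where "i < n - s" and it: "u ! (s + i) = t" "p = g (s + i)" by blast
      then have i: "s + i < n" "u ! (s + i) = t" "p = g (s + i)" by simp_all
      then show "p \<in> {p. p \<le> n \<and> lvl p = t}" using gX[OF i(1)] lvl[OF gX[OF i(1)]] \<sigma>g[OF i(1)] by auto
    qed
    moreover have "inj_on (\<lambda>i. g (s + i)) {i. i < n - s \<and> u ! (s + i) = t}"
    proof (rule inj_onI)
      fix i j assume ij: "i \<in> {i. i < n - s \<and> u ! (s + i) = t}" "j \<in> {i. i < n - s \<and> u ! (s + i) = t}"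
        "g (s + i) = g (s + j)"
      then have "s + i < n" "s + j < n" by auto
      have "\<sigma> (g (s + i)) = s + i" "\<sigma> (g (s + j)) = s + j"
        using \<sigma>g[OF \<open>s + i < n\<close>] \<sigma>g[OF \<open>s + j < n\<close>] .
      then show "i = j" using ij(3) by (metis add_left_cancel)
    qed
    ultimately have "card {p. p \<le> n \<and> lvl p = t} = card {i. i < n - s \<and> u ! (s + i) = t}"
      by (simp add: card_image)
    also have "\<dots> = count (mset (drop s u)) t"
      unfolding count_mset_nth using n sn by (intro arg_cong[of _ _ card]) auto
    finally show ?thesis by (simp add: count_mset)
  qed
  have cond: "(\<exists>p\<in>{1..n}. lvl p = lvl 0) \<longleftrightarrow> 0 < s \<and> s = m"
  proof
    assume "0 < s \<and> s = m"
    then have "g 0 \<in> {1..n}" "\<sigma> (g 0) < s" using gX[of 0] \<sigma>g[of 0] sn by auto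
    then show "\<exists>p\<in>{1..n}. lvl p = lvl 0" using lvl_zero[of "g 0"] \<open>0 < s \<and> s = m\<close> lvl0 by auto
  qed (use lvl_zero lvl0 in auto)
  have tail: "map (\<lambda>(S, h). if h then Star (card S) else Plain (card S))
      (map (\<lambda>t. ({p. p \<le> n \<and> lvl p = t}, False)) (sorted_list_of_set (set (drop s u)))) =
      map Plain (value_counts (drop s u))"
    by (simp add: value_counts_def cnt)
  have type: "sbp_type ?A = omega_type u s"
  proof (cases "0 < s \<and> s = m")
    case True
    have "{p. p \<le> n \<and> (lvl p < 0 \<or> lvl p = 0)} = insert 0 {p\<in>{1..n}. \<sigma> p < s}"
      using lvl0 lvl_zero lvl_neg X True by (auto simp: Suc_le_eq)
    then have "card {p. p \<le> n \<and> (lvl p < 0 \<or> lvl p = 0)} - 1 = s" using cards by simp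
    then show ?thesis
      using tail unfolding mk_sbp_def Let_def lvl0 cond[unfolded lvl0] T[unfolded lvl0]
        omega_type_def m_def[symmetric] Eq_TrueI[OF True]
      by (simp add: sbp_type_def blk_def)
  next
    case False
    have "(p \<le> n \<and> lvl p < 0) = (p \<in> {1..n} \<and> \<sigma> p < s)" for p
      using lvl_neg[of p] X[of p] False by (cases "p \<in> {1..n}") auto
    then have "{p. p \<le> n \<and> lvl p < 0} = {p\<in>{1..n}. \<sigma> p < s}" by simp
    then have "card {p. p \<le> n \<and> lvl p < 0} = s" using cards by simp
    moreover have "{p. p \<le> n \<and> lvl p = 0} = {0}"
      using False cond lvl0 by (auto simp: Suc_le_eq)
    ultimately show ?thesis
      using tail unfolding mk_sbp_def Let_def lvl0 cond[unfolded lvl0] T[unfolded lvl0]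
        omega_type_def m_def[symmetric] Eq_FalseI[OF False]
      by (simp add: sbp_type_def blk_def)
  qed
  show ?thesis using that[of ?A s] H sm sn type cone by (simp add: m_def)
qed

section \<open>Faces of sliced cones and contractions of partitions\<close>

lemma sbp_preorder_props:
  assumes "is_sbp n B"
  shows "trans (sbp_preorder n B)" "refl_on {0..n} (sbp_preorder n B)"
    "sbp_preorder n B \<subseteq> {0..n} \<times> {0..n}" "finite (sbp_preorder n B)"
proof -
  show *: "trans (sbp_preorder n B)" "refl_on {0..n} (sbp_preorder n B)"
    "sbp_preorder n B \<subseteq> {0..n} \<times> {0..n}"
    unfolding sbp_preorder_block_pos[OF assms] by (rule level_preorder)+
  show "finite (sbp_preorder n B)" using finite_subset[OF *(3)] by blast
qed

lemma sliced_cone_inj: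
  assumes "bij_betw e {1..n} UNIV" "is_sbp n B" "is_sbp n C" "sliced_cone e n B = sliced_cone e n C"
  shows "B = C"
  using sbp_preorder_inj[OF assms(2,3)]
    preorder_cone_inj[OF assms(1) sbp_preorder_props(3,1,2)[OF assms(2)] sbp_preorder_props(3,1,2)[OF assms(3)]]
    assms(4) by (simp add: sliced_cone_eq)

lemma sbp_le_imp_face_of:
  assumes "is_sbp n B" "sbp_le n C B"
  shows "sliced_cone e n C face_of sliced_cone e n B"
  using contraction_preorder_cone_face_of[OF _ sbp_preorder_props(1-3)[OF assms(1)]] assms(2)
  by (simp add: sbp_le_def sliced_cone_eq)

text \<open>Reversing the relations tight at a relative interior point \<open>w\<close> of the
  smaller cone cuts out the same face. As cones determine preorders, this closure is the preorder of
  \<open>C\<close>, and such closures are contractions.\<close>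

lemma face_of_imp_sbp_le:
  assumes e: "bij_betw e {1..n} UNIV" and B: "is_sbp n B" and C: "is_sbp n C"
    and face: "sliced_cone e n C face_of sliced_cone e n B"
  shows "sbp_le n C B"
proof -
  let ?R = "sbp_preorder n B"
  note R = sbp_preorder_props[OF B]
  have "rel_interior (sliced_cone e n C) \<noteq> {}"
    using zero_in_preorder_cone unfolding sliced_cone_eq
    by (metis convex_preorder_cone empty_iff rel_interior_eq_empty)
  then obtain w where w: "w \<in> rel_interior (sliced_cone e n C)" by blast
  then have wB: "w \<in> preorder_cone e ?R"
    using rel_interior_subset face_of_imp_subset[OF face] unfolding sliced_cone_eq by blast
  let ?S = "tight (coord e w) ?R"
  let ?T = "(?R \<union> ?S)\<^sup>+"
  have "preorder_cone e (sbp_preorder n C) = preorder_cone e ?T"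
    using face_of_eq[OF face] preorder_cone_closure_face_of[OF tight_subset]
      in_rel_interior_tight_cone[OF R(4) wB] w unfolding sliced_cone_eq by blast
  moreover have "?T \<subseteq> {0..n} \<times> {0..n}"
    using R(3) tight_subset[of "coord e w" ?R] by (intro trancl_subset_Sigma) auto
  moreover have "refl_on {0..n} ?T"
    using R(2) \<open>?T \<subseteq> {0..n} \<times> {0..n}\<close> by (auto simp: refl_on_def)
  ultimately have "sbp_preorder n C = ?T"
    using sbp_preorder_props[OF C] by (intro preorder_cone_inj[OF e]) auto
  then show ?thesis
    unfolding sbp_le_def using contraction_of_closure[OF _ R(1-3) tight_subset] by simp
qed

theorem corollary5p18:
  fixes m :: "nat list" and d :: "real list" and e :: "nat \<Rightarrow> 'n::finite"
  assumes "is_MD_pair m d"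
    and "bij_betw e {1..sum_list m} (UNIV :: 'n set)"
  shows "poset_iso (SBP m) (sbp_le (sum_list m))
           (normal_fan (PF_MD e m d)) (\<subseteq>)
           (sliced_cone e (sum_list m)) \<and>
         (\<exists>f. poset_iso (nonempty_faces (PF_MD e m d)) (\<subseteq>)
           (SBP m) (\<lambda>B B'. sbp_le (sum_list m) B' B) f)"
proof -
  obtain u where u: "is_park_vec u" and m: "m = multiplicity_vector u" and d: "d = data_vector u"
    using assms(1) by (auto simp: is_MD_pair_def)
  define n where "n = sum_list m"
  have v: "vec_of_MD m d = u" using vec_of_MD_recovers[OF u] m d by simp
  have "length m = length (0 # d)" by (simp add: m d multiplicity_vector_def)
  from length_runs[OF this] have n: "length u = n" using v by (simp add: n_def runs_def vec_of_MD_def)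
  have e: "bij_betw e {1..n} (UNIV :: 'n set)" using assms(2) by (simp add: n_def)
  define P where "P = PF e u"
  have P: "PF_MD e m d = P" by (simp add: PF_MD_def P_def v)
  have poly: "polytope P"
    unfolding P_def using polytope_PF[of u e] u e n by (simp add: is_park_vec_def)
  have SBP: "B \<in> SBP m \<longleftrightarrow> is_sbp n B \<and> (\<exists>A s. is_sbp n A \<and> count_list u 0 \<le> s \<and> s \<le> n \<and>
      sbp_type A = omega_type u s \<and> sbp_le n B A)" for B
    unfolding SBP_def Omega_eq[OF u, folded m] n_def[symmetric] n mem_Collect_eq image_iff
      Bex_def atLeastAtMost_iff by blast
  have vertex: "\<exists>v. v \<in> P \<and> normal_cone P {v} = sliced_cone e n A"
    if "is_sbp n A" "count_list u 0 \<le> s" "s \<le> n" "sbp_type A = omega_type u s" for A s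
    using block_vertex_in_PF[OF u n e that] normal_cone_eq[OF u n e that] unfolding P_def by blast
  have ne: "P \<noteq> {}"
    using ex_maximal_sbp[OF u n] vertex by (metis empty_iff)
  \<comment> \<open>The cone of a contraction is a face of the normal cone at the vertex of
    \<open>A\<close>, hence the normal cone of the face maximising any of its relative interior
    points.\<close>
  have fan: "\<exists>F\<in>nonempty_faces P. sliced_cone e n B = normal_cone P F" if B: "B \<in> SBP m" for B
  proof -
    obtain A s where A: "is_sbp n A" "count_list u 0 \<le> s" "s \<le> n" "sbp_type A = omega_type u s"
      "sbp_le n B A" using B SBP by blast
    obtain v where v: "v \<in> P" "normal_cone P {v} = sliced_cone e n A" using vertex A by blast
    have "rel_interior (sliced_cone e n B) \<noteq> {}"
      using zero_in_preorder_cone unfolding sliced_cone_eq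
      by (metis convex_preorder_cone empty_iff rel_interior_eq_empty)
    then obtain w where w: "w \<in> rel_interior (sliced_cone e n B)" by blast
    then have "sliced_cone e n B = normal_cone P (maxface P w)"
      using face_of_normal_cone_eq[OF poly v(1)] sbp_le_imp_face_of[OF A(1,5)] v(2) by metis
    then show ?thesis using maxface_in_nonempty_faces[OF poly ne] by blast
  qed
  \<comment> \<open>A functional exposing \<open>F\<close> lies in some maximal cone; contracting
    the relations of \<open>A\<close> that are tight at it yields the required partition.\<close>
  have surj: "\<exists>B\<in>SBP m. sliced_cone e n B = normal_cone P F" if F: "F \<in> nonempty_faces P" for F
  proof -
    obtain w where w: "F = maxface P w" using nonempty_face_is_maxface[OF poly F] .
    obtain A s where max: "is_sbp n A" "count_list u 0 \<le> s" "s \<le> n" "sbp_type A = omega_type u s"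
      "w \<in> sliced_cone e n A" using ex_maximal_sbp[OF u n] .
    obtain v where v: "v \<in> P" "normal_cone P {v} = sliced_cone e n A" using vertex max by blast
    note R = sbp_preorder_props[OF max(1)]
    have wR: "w \<in> preorder_cone e (sbp_preorder n A)" using max(5) by (simp add: sliced_cone_eq)
    obtain B where B: "is_sbp n B"
      "sbp_preorder n B = (sbp_preorder n A \<union> tight (coord e w) (sbp_preorder n A))\<^sup>+"
      using ex_sbp_closure[OF u n e max(1-4) wR] by blast
    have "sbp_le n B A"
      unfolding sbp_le_def B(2) by (rule contraction_of_closure[OF _ R(1-3) tight_subset]) simp
    then have "B \<in> SBP m" using SBP max B(1) by blast
    moreover have "sliced_cone e n B face_of normal_cone P {v}"
      unfolding v(2) sliced_cone_eq B(2) by (rule preorder_cone_closure_face_of[OF tight_subset])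
    moreover have "w \<in> rel_interior (sliced_cone e n B)"
      unfolding sliced_cone_eq B(2) by (rule in_rel_interior_tight_cone[OF R(4) wR])
    ultimately show ?thesis using face_of_normal_cone_eq[OF poly v(1)] w by blast
  qed
  have "bij_betw (sliced_cone e n) (SBP m) (normal_fan P)"
    unfolding bij_betw_def
  proof
    show "inj_on (sliced_cone e n) (SBP m)"
      by (rule inj_onI) (use sliced_cone_inj[OF e] SBP in blast)
    show "sliced_cone e n ` SBP m = normal_fan P"
      unfolding normal_fan_def
    proof (intro equalityI image_subsetI)
      show "sliced_cone e n B \<in> normal_cone P ` nonempty_faces P" if "B \<in> SBP m" for B
        using fan[OF that] by blast
      show "normal_cone P F \<in> sliced_cone e n ` SBP m" if "F \<in> nonempty_faces P" for F
        using surj[OF that] by (metis image_eqI)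
    qed
  qed
  moreover have "sbp_le n C B \<longleftrightarrow> sliced_cone e n C \<subseteq> sliced_cone e n B"
    if CB: "C \<in> SBP m" "B \<in> SBP m" for C B
  proof
    have sbp: "is_sbp n B" "is_sbp n C" using that SBP by blast+
    then show "sbp_le n C B \<Longrightarrow> sliced_cone e n C \<subseteq> sliced_cone e n B"
      using sbp_le_imp_face_of face_of_imp_subset by blast
    assume sub: "sliced_cone e n C \<subseteq> sliced_cone e n B"
    obtain F F' where F: "F \<in> nonempty_faces P" "sliced_cone e n C = normal_cone P F"
      "F' \<in> nonempty_faces P" "sliced_cone e n B = normal_cone P F'"
      using fan[OF CB(1)] fan[OF CB(2)] by blast
    then have "F' \<subseteq> F" using normal_cone_subset_iff[OF poly] sub by metis
    \<comment> \<open>Inclusion of convex cones alone does not make one a face of the other; here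
      both are normal cones of nested faces of \<open>P\<close>.\<close>
    then have "sliced_cone e n C face_of sliced_cone e n B"
      unfolding F using F(1,3) by (intro normal_cone_face_of) (auto simp: nonempty_faces_def dest: face_of_imp_subset)
    then show "sbp_le n C B" using face_of_imp_sbp_le[OF e] sbp by blast
  qed
  ultimately have iso: "poset_iso (SBP m) (sbp_le n) (normal_fan P) (\<subseteq>) (sliced_cone e n)"
    unfolding poset_iso_def by blast
  show ?thesis
    unfolding P n_def[symmetric] using iso poset_iso_normal_fan_imp_dual[OF poly iso] by blast
qed

end
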